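(* Let $n\geq 2$ and suppose $E=\bigcup_{k=1}^{n}[a_k,b_k]$, where $-1=a_1<b_1<a_2<b_2<\cdots<a_n<b_n=1$. Write $\theta(x)=\arccos(x)$. Then \[ \mathrm{cap}\,E\;\leq\;\frac{1}{2}\left\{\cos\left[\frac{1}{2}\sum_{k=1}^{n-1}\big(\theta(a_{k+1})-\theta(b_k)\big)\right]\right\}^{1/(n-1)}. \] Equality is attained for $E=E(l,2(n-1))$, $0<l<2\pi$.
   Context: Logarithmic capacity: for a compact set $E\subset\mathbb{C}$, let $B$ be the connected component of $\overline{\mathbb{C}}\setminus E$ containing the point at infinity and let $g_B(z,\infty)$ be its Green function with pole at infinity. Then \[ \mathrm{cap}\,E=\exp\Big\{\lim_{z\to\infty}\big[\log|z|-g_B(z,\infty)\big]\Big\}, \] and $\mathrm{cap}\,E=0$ if $B$ does not admit a Green function. Let $\Gamma=\{z\in\mathbb{C}:|z|=1\}$. For $0<l<2\pi$ and a positive integer $s$ let $F(l,s)=\{z\in\Gamma:|\arg(z^s)|\leq l/2\}$, where $\arg$ takes values in $(-\pi,\pi]$, and let $E(l,s)\subset[-1,1]$ be the orthogonal projection of $F(l,s)$ onto the real axis. The set $E(l,2(n-1))$ is a union of $n$ disjoint closed intervals of the form required of $E$. *)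

theory Defs
  imports "HOL-Analysis.Analysis"
begin

definition riemann_sphere :: "complex option topology" where
  "riemann_sphere = Alexandroff_compactification euclidean"

(* The finite points of the component B of the complement of E in the sphere that
   contains the point at infinity, which is represented by None. *)
definition exterior_domain :: "complex set \<Rightarrow> complex set" where
  "exterior_domain E =
     {z. Some z \<in> connected_component_of_set
           (subtopology riemann_sphere (- (Some ` E))) None}"

(* Twice continuously differentiable with vanishing Laplacian; S is meant to be open.
   The functions ux, uy, uxx, ... are the partial derivatives. *)
definition harmonic_on :: "(complex \<Rightarrow> real) \<Rightarrow> complex set \<Rightarrow> bool" where
  "harmonic_on u S \<longleftrightarrow>
     (\<exists>ux uy uxx uxy uyx uyy :: complex \<Rightarrow> real.
        (\<forall>z\<in>S. (u has_derivative (\<lambda>h. ux z * Re h + uy z * Im h)) (at z)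
           \<and> (ux has_derivative (\<lambda>h. uxx z * Re h + uxy z * Im h)) (at z)
           \<and> (uy has_derivative (\<lambda>h. uyx z * Re h + uyy z * Im h)) (at z)
           \<and> uxx z + uyy z = 0)
        \<and> continuous_on S uxx \<and> continuous_on S uxy
        \<and> continuous_on S uyx \<and> continuous_on S uyy)"

(* Positive harmonic functions on D (a domain of the sphere with its point at infinity
   removed) with singularity log|z| at infinity. By the removable singularity theorem the
   finite limit says exactly that h(z) - log|z| extends harmonically to infinity. *)
definition log_pole_at_infinity :: "complex set \<Rightarrow> (complex \<Rightarrow> real) \<Rightarrow> bool" where
  "log_pole_at_infinity D h \<longleftrightarrow>
     harmonic_on h D \<and> (\<forall>z\<in>D. 0 < h z) \<and>
     (\<exists>c. ((\<lambda>z. h z - ln (cmod z)) \<longlongrightarrow> c) at_infinity)"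

(* The Green function of an arbitrary domain: the smallest positive harmonic function with
   the given logarithmic pole. No boundary values are prescribed, since a general boundary
   may have irregular points; if all boundary points are regular, this is the function
   vanishing on the boundary. *)
definition is_green_at_infinity :: "complex set \<Rightarrow> (complex \<Rightarrow> real) \<Rightarrow> bool" where
  "is_green_at_infinity D g \<longleftrightarrow>
     log_pole_at_infinity D g \<and>
     (\<forall>h. log_pole_at_infinity D h \<longrightarrow> (\<forall>z\<in>D. g z \<le> h z))"

(* Minimality determines the Green function on D, hence near infinity when E is compact,
   so the value of the limit does not depend on the choice made by SOME. *)
definition log_capacity :: "complex set \<Rightarrow> real" where
  "log_capacity E =
     (if \<exists>g. is_green_at_infinity (exterior_domain E) g
      then exp (Lim at_infinity
             (\<lambda>z. ln (cmod z) - (SOME g. is_green_at_infinity (exterior_domain E) g) z))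
      else 0)"

definition interval_endpoints :: "nat \<Rightarrow> (nat \<Rightarrow> real) \<Rightarrow> (nat \<Rightarrow> real) \<Rightarrow> bool" where
  "interval_endpoints n a b \<longleftrightarrow>
     a 1 = -1 \<and> b n = 1 \<and>
     (\<forall>k\<in>{1..n}. a k < b k) \<and> (\<forall>k\<in>{1..<n}. b k < a (k + 1))"

definition interval_union :: "nat \<Rightarrow> (nat \<Rightarrow> real) \<Rightarrow> (nat \<Rightarrow> real) \<Rightarrow> complex set" where
  "interval_union n a b = complex_of_real ` (\<Union>k\<in>{1..n}. {a k..b k})"

definition circle_arcs :: "real \<Rightarrow> nat \<Rightarrow> complex set" where
  "circle_arcs l s = {z. cmod z = 1 \<and> \<bar>Arg (z ^ s)\<bar> \<le> l / 2}"

definition projected_arcs :: "real \<Rightarrow> nat \<Rightarrow> complex set" where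
  "projected_arcs l s = (\<lambda>z. complex_of_real (Re z)) ` circle_arcs l s"

end

theory Submission
  imports Defs "HOL-Complex_Analysis.Complex_Analysis"
begin

text \<open>Let \<open>\<gamma>\<close> be the total length of the gaps of \<open>arccos E\<close> and
  \<open>m = n - 1\<close>. Lifting \<open>E\<close> to the circle gives \<open>2 * m\<close> arcs, and there is a finite
  Blaschke product \<open>B\<close> of degree \<open>2 * m\<close> with \<open>B 0 = 0\<close> mapping all of them into the single arc
  \<open>Re \<ge> - cos \<gamma>\<close>: it is a Moebius transform of the quotient of the monic polynomials
  vanishing at the starts and at the ends of the gaps. The powers of \<open>B\<close> are orthogonal in the Dirichlet space
  with \<open>B ^ k\<close> of squared norm \<open>2 * m * k\<close>, so Bessel's inequality bounds the logarithmic
  energy of points on the lifted arcs below by \<open>1 / (2 * m)\<close> times the energy of their images. The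
  real parts of the images lie in an interval of length \<open>1 + cos \<gamma> = 2 * cos (\<gamma> / 2) ^ 2\<close>,
  whose energy is bounded below by rescaling to \<open>[-1, 1]\<close>. Applied to Leja points of \<open>E\<close>, this bounds every
  positive harmonic function with the given pole from below at infinity, by comparison with the logarithms of the
  Leja polynomials. In the equality case \<open>E\<close> is the preimage of an interval under a Chebyshev polynomial
  and the Green function is explicit.\<close>

subsection \<open>Harmonic functions with a logarithmic pole\<close>

text \<open>Capacity is defined through a Green function, whose existence is a separate matter. The
  upper bound bypasses it: each positive harmonic \<open>h\<close> with the required pole has a
  constant \<open>c\<close>, the limit of \<open>h z - ln (cmod z)\<close> at infinity, and
  \<open>exp (- c)\<close> is bounded for all of them at once. The obstacle on the energy side is
  the diagonal: the kernel \<open>- ln (cmod (1 - z * cnj w))\<close> blows up there for unimodular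
  points, and its expansion into squares takes place in the open disc. So the points are pulled in
  to a radius \<open>r < 1\<close>. The diagonal then costs only a multiple of \<open>N\<close>,
  negligible against \<open>N ^ 2\<close>, but \<open>r\<close> has to be fixed before
  \<open>N\<close>; uniform continuity of the Blaschke product on the closed disc allows this.
  Origin of the bound: conjugate pairs turn circle distances into
  \<open>2 * \<bar>Re u - Re v\<bar>\<close>, whence the factor 1/2. An interval of length
  \<open>2 * \<kappa>\<close> with \<open>\<kappa> = cos (\<gamma> / 2) ^ 2\<close> contributes
  \<open>- ln \<kappa>\<close> to the normalized energy, and division by the degree
  \<open>2 * m\<close> leaves \<open>cos (\<gamma> / 2)\<close> to the power
  \<open>1 / m\<close>.\<close>

lemma harmonic_onI_holomorphic:
  assumes S: "open S" and F: "F holomorphic_on S"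
    and u: "\<And>z. z \<in> S \<Longrightarrow> (u has_derivative (\<lambda>h. Re (F z * h))) (at z)"
  shows "harmonic_on u S"
proof -
  \<comment> \<open>\<open>F\<close> plays the role of \<open>ux - \<i> * uy\<close>. Its derivative
    supplies all second partials, and the Cauchy-Riemann equations for \<open>F\<close> are the
    vanishing of the Laplacian.\<close>
  define G where "G = deriv F"
  have G: "G holomorphic_on S" unfolding G_def by (rule holomorphic_deriv[OF F S])
  have FG: "(F has_derivative (\<lambda>h. G z * h)) (at z)" if "z \<in> S" for z
    using holomorphic_derivI[OF F S that] unfolding G_def by (simp add: has_field_derivative_def mult_commute_abs)
  have cG: "continuous_on S G" by (rule holomorphic_on_imp_continuous_on[OF G])
  have Re': "((\<lambda>w. Re (F w)) has_derivative (\<lambda>h. Re (G z * h))) (at z)"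
    and Im': "((\<lambda>w. - Im (F w)) has_derivative (\<lambda>h. - Im (G z * h))) (at z)" if "z \<in> S" for z
    using FG[OF that] by (auto intro!: derivative_eq_intros)
  show ?thesis unfolding harmonic_on_def
  proof (intro exI conjI ballI)
    fix z assume z: "z \<in> S"
    show "(u has_derivative (\<lambda>h. Re (F z) * Re h + (- Im (F z)) * Im h)) (at z)"
      using u[OF z] by simp
    show "((\<lambda>w. Re (F w)) has_derivative (\<lambda>h. Re (G z) * Re h + (- Im (G z)) * Im h)) (at z)"
      using Re'[OF z] by simp
    show "((\<lambda>w. - Im (F w)) has_derivative (\<lambda>h. (- Im (G z)) * Re h + (- Re (G z)) * Im h)) (at z)"
      using Im'[OF z] by (simp add: algebra_simps)
    show "Re (G z) + (- Re (G z)) = 0" by simp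
  qed (intro continuous_intros cG)+
qed

text \<open>The logarithmic derivative of \<open>f\<close> is single-valued even where
  \<open>ln f\<close> has no global branch, so it can serve as the \<open>F\<close> of the previous
  lemma on a domain that is not simply connected.\<close>

lemma harmonic_on_scaled_ln_norm:
  assumes S: "open S" and f: "f holomorphic_on S" and nz: "\<And>z. z \<in> S \<Longrightarrow> f z \<noteq> 0"
  shows "harmonic_on (\<lambda>z. c * ln (cmod (f z)) + d) S"
proof (rule harmonic_onI_holomorphic[OF S])
  show "(\<lambda>z. of_real c * deriv f z / f z) holomorphic_on S"
    using nz by (intro holomorphic_intros holomorphic_deriv f S)
  fix z assume z: "z \<in> S"
  have fd: "(f has_derivative (\<lambda>h. deriv f z * h)) (at z)"
    using holomorphic_derivI[OF f S z] by (simp add: has_field_derivative_def mult_commute_abs)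
  have "((\<lambda>w. cmod (f w)) has_derivative (\<lambda>h. (deriv f z * h) \<bullet> sgn (f z))) (at z)"
    by (rule has_derivative_norm[THEN has_derivative_compose[OF fd]]) (use nz z in simp)
  then have "((\<lambda>w. c * ln (cmod (f w)) + d) has_derivative (\<lambda>h. c * (((deriv f z * h) \<bullet> sgn (f z)) / cmod (f z)))) (at z)"
    using nz[OF z] by (auto intro!: derivative_eq_intros simp: field_simps)
  moreover have eq: "((deriv f z * h) \<bullet> sgn (f z)) / cmod (f z) = Re (deriv f z * h / f z)" for h
  proof -
    have "X \<bullet> sgn Y / cmod Y = Re (X * cnj Y) / (cmod Y)\<^sup>2" for X Y
      by (simp add: inner_complex_def sgn_div_norm power2_eq_square divide_inverse algebra_simps)
    then have "(deriv f z * h) \<bullet> sgn (f z) / cmod (f z) = Re (deriv f z * h * cnj (f z)) / (cmod (f z))\<^sup>2" .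
    also have "\<dots> = Re (deriv f z * h / f z)"
      by (subst complex_div_cnj) (simp add: Re_divide_of_real flip: of_real_power)
    finally show ?thesis .
  qed
  moreover have "Re (of_real c * deriv f z / f z * h) = c * Re (deriv f z * h / f z)" for h
  proof -
    have "of_real c * deriv f z / f z * h = of_real c * (deriv f z * h / f z)" by simp
    then show ?thesis
      by (simp only: times_complex.sel Re_complex_of_real Im_complex_of_real mult_zero_left diff_zero)
  qed
  ultimately show "((\<lambda>w. c * ln (cmod (f w)) + d) has_derivative (\<lambda>h. Re (of_real c * deriv f z / f z * h))) (at z)"
    by (simp only:)
qed

lemma harmonic_on_subset:
  assumes "harmonic_on u S" "T \<subseteq> S" shows "harmonic_on u T"
proof -
  from assms(1) obtain ux uy uxx uxy uyx uyy where *: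
    "\<forall>z\<in>S. (u has_derivative (\<lambda>h. ux z * Re h + uy z * Im h)) (at z)
       \<and> (ux has_derivative (\<lambda>h. uxx z * Re h + uxy z * Im h)) (at z)
       \<and> (uy has_derivative (\<lambda>h. uyx z * Re h + uyy z * Im h)) (at z)
       \<and> uxx z + uyy z = 0"
    "continuous_on S uxx" "continuous_on S uxy" "continuous_on S uyx" "continuous_on S uyy"
    unfolding harmonic_on_def by (elim exE conjE)
  then have "\<forall>z\<in>T. (u has_derivative (\<lambda>h. ux z * Re h + uy z * Im h)) (at z)
       \<and> (ux has_derivative (\<lambda>h. uxx z * Re h + uxy z * Im h)) (at z)
       \<and> (uy has_derivative (\<lambda>h. uyx z * Re h + uyy z * Im h)) (at z)
       \<and> uxx z + uyy z = 0"
    using assms(2) by blast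
  then show ?thesis unfolding harmonic_on_def
    using continuous_on_subset[OF *(2) assms(2)] continuous_on_subset[OF *(3) assms(2)]
      continuous_on_subset[OF *(4) assms(2)] continuous_on_subset[OF *(5) assms(2)]
    by (intro exI conjI)
qed

section \<open>Maximum principle and comparison of functions with a logarithmic pole\<close>

lemma local_max_second_deriv:
  fixes \<phi> \<psi> :: "real \<Rightarrow> real"
  assumes d: "0 < d" and D1: "\<And>t. \<bar>t\<bar> < d \<Longrightarrow> (\<phi> has_real_derivative \<psi> t) (at t)"
    and D2: "(\<psi> has_real_derivative l) (at 0)"
    and max: "\<And>t. \<bar>t\<bar> < d \<Longrightarrow> \<phi> t \<le> \<phi> 0"
  shows "l \<le> 0"
proof (rule ccontr)
  assume "\<not> l \<le> 0"
  then have l: "0 < l" by simp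
  have p0: "\<psi> 0 = 0"
    by (rule DERIV_local_max[OF D1 d]) (use d max in auto)
  from DERIV_pos_inc_right[OF D2 l] obtain e where e: "0 < e" "\<And>h. 0 < h \<Longrightarrow> h < e \<Longrightarrow> \<psi> 0 < \<psi> h" by auto
  define t where "t = min d e / 2"
  have t: "0 < t" "t < d" "t < e" using d e by (auto simp: t_def)
  have "\<phi> 0 < \<phi> t"
  proof (rule DERIV_pos_imp_increasing_open[OF t(1)])
    fix x assume "0 < x" "x < t"
    then show "\<exists>y. (\<phi> has_real_derivative y) (at x) \<and> 0 < y"
      using D1[of x] e(2)[of x] p0 t by (auto intro!: exI[of _ "\<psi> x"])
  next
    show "continuous_on {0..t} \<phi>"
    proof (intro continuous_at_imp_continuous_on ballI)
      fix x assume "x \<in> {0..t}"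
      then show "isCont \<phi> x" using t by (intro DERIV_isCont[OF D1]) auto
    qed
  qed
  with max[of t] t show False by simp
qed

text \<open>The quadratic term raises the Laplacian to \<open>4 * e > 0\<close>, so the second
  derivative test already excludes an interior maximum. The factor \<open>c\<close> is there for the
  shrunken function \<open>(1 - \<eta>) * v\<close> of the comparison below.\<close>

lemma harmonic_max_principle:
  assumes u: "harmonic_on u \<Omega>" and v: "harmonic_on v \<Omega>" and \<Omega>: "open \<Omega>" and z0: "z0 \<in> \<Omega>" and e: "0 < e"
  shows "\<exists>z\<in>\<Omega>. c * u z0 - v z0 + e * (cmod z0)\<^sup>2 < c * u z - v z + e * (cmod z)\<^sup>2"
proof (rule ccontr)
  assume "\<not> ?thesis"
  then have max: "c * u z - v z + e * (cmod z)\<^sup>2 \<le> c * u z0 - v z0 + e * (cmod z0)\<^sup>2" if "z \<in> \<Omega>" for z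
    using that by fastforce
  obtain ux uy uxx uxy uyx uyy where
    U: "\<And>z. z \<in> \<Omega> \<Longrightarrow> (u has_derivative (\<lambda>h. ux z * Re h + uy z * Im h)) (at z)"
       "\<And>z. z \<in> \<Omega> \<Longrightarrow> (ux has_derivative (\<lambda>h. uxx z * Re h + uxy z * Im h)) (at z)"
       "\<And>z. z \<in> \<Omega> \<Longrightarrow> (uy has_derivative (\<lambda>h. uyx z * Re h + uyy z * Im h)) (at z)"
       "\<And>z. z \<in> \<Omega> \<Longrightarrow> uxx z + uyy z = 0"
    using u unfolding harmonic_on_def by blast
  obtain vx vy vxx vxy vyx vyy where
    V: "\<And>z. z \<in> \<Omega> \<Longrightarrow> (v has_derivative (\<lambda>h. vx z * Re h + vy z * Im h)) (at z)"
       "\<And>z. z \<in> \<Omega> \<Longrightarrow> (vx has_derivative (\<lambda>h. vxx z * Re h + vxy z * Im h)) (at z)"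
       "\<And>z. z \<in> \<Omega> \<Longrightarrow> (vy has_derivative (\<lambda>h. vyx z * Re h + vyy z * Im h)) (at z)"
       "\<And>z. z \<in> \<Omega> \<Longrightarrow> vxx z + vyy z = 0"
    using v unfolding harmonic_on_def by blast
  obtain d where d: "0 < d" "ball z0 d \<subseteq> \<Omega>" using \<Omega> z0 openE by blast
  have in\<Omega>: "z0 + of_real t * k \<in> \<Omega>" if "\<bar>t\<bar> < d" "cmod k = 1" for t k
    using that d by (auto simp: dist_norm norm_mult)
  have chain: "((\<lambda>t. f (z0 + of_real t * k)) has_real_derivative (a * Re k + b * Im k)) (at t)"
    if "(f has_derivative (\<lambda>h. a * Re h + b * Im h)) (at (z0 + of_real t * k))" for f a b t k
  proof -
    have "((\<lambda>t. z0 + of_real t * k) has_derivative (\<lambda>h. of_real h * k)) (at t)"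
      by (auto intro!: derivative_eq_intros)
    from has_derivative_compose[OF this that] show ?thesis
      unfolding has_field_derivative_def
      by (rule has_derivative_eq_rhs) (simp add: fun_eq_iff algebra_simps)
  qed
  have sq: "(cmod (z0 + of_real t * k))\<^sup>2 = (Re z0 + t * Re k)\<^sup>2 + (Im z0 + t * Im k)\<^sup>2" for t k
    by (simp add: cmod_power2)
  define P where "P k t = c * u (z0 + of_real t * k) - v (z0 + of_real t * k) + e * (cmod (z0 + of_real t * k))\<^sup>2" for k t
  have Pmax: "P k t \<le> P k 0" if "\<bar>t\<bar> < d" "cmod k = 1" for k t
    using max[OF in\<Omega>[OF that]] by (simp add: P_def)
  have sqd: "((\<lambda>t. (a + t * b)\<^sup>2 + (a' + t * b')\<^sup>2) has_real_derivative (2 * (a + t * b) * b + 2 * (a' + t * b') * b')) (at t)"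
    for a b a' b' t :: real
    by (auto intro!: derivative_eq_intros simp: algebra_simps)
  have lind: "((\<lambda>t. 2 * (a + t * b) * b + 2 * (a' + t * b') * b') has_real_derivative (2 * b * b + 2 * b' * b')) (at t)"
    for a b a' b' t :: real
    by (auto intro!: derivative_eq_intros)
  have second: "c * ((uxx z0 * Re k + uxy z0 * Im k) * Re k + (uyx z0 * Re k + uyy z0 * Im k) * Im k)
      - ((vxx z0 * Re k + vxy z0 * Im k) * Re k + (vyx z0 * Re k + vyy z0 * Im k) * Im k)
      + e * (2 * Re k * Re k + 2 * Im k * Im k) \<le> 0" if k: "cmod k = 1" for k
  proof (rule local_max_second_deriv[OF d(1)])
    show "\<And>t. \<bar>t\<bar> < d \<Longrightarrow> P k t \<le> P k 0" using Pmax k by simp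
    show "(P k has_real_derivative
        c * (ux (z0 + of_real t * k) * Re k + uy (z0 + of_real t * k) * Im k)
        - (vx (z0 + of_real t * k) * Re k + vy (z0 + of_real t * k) * Im k)
        + e * (2 * (Re z0 + t * Re k) * Re k + 2 * (Im z0 + t * Im k) * Im k)) (at t)"
      if "\<bar>t\<bar> < d" for t
      unfolding P_def[abs_def] sq
      by (intro DERIV_add DERIV_diff DERIV_cmult chain U(1) V(1) in\<Omega> sqd that k)
    have z0': "z0 + of_real 0 * k = z0" by simp
    show "((\<lambda>t. c * (ux (z0 + of_real t * k) * Re k + uy (z0 + of_real t * k) * Im k)
        - (vx (z0 + of_real t * k) * Re k + vy (z0 + of_real t * k) * Im k)
        + e * (2 * (Re z0 + t * Re k) * Re k + 2 * (Im z0 + t * Im k) * Im k)) has_real_derivative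
        c * ((uxx z0 * Re k + uxy z0 * Im k) * Re k + (uyx z0 * Re k + uyy z0 * Im k) * Im k)
      - ((vxx z0 * Re k + vxy z0 * Im k) * Re k + (vyx z0 * Re k + vyy z0 * Im k) * Im k)
      + e * (2 * Re k * Re k + 2 * Im k * Im k)) (at 0)"
      by (intro DERIV_add DERIV_diff DERIV_cmult DERIV_cmult_right chain lind; unfold z0'; intro U V z0)
  qed
  \<comment> \<open>The second derivatives along \<open>1\<close> and \<open>\<i>\<close> add up to
    the Laplacian, in which all harmonic contributions cancel.\<close>
  have "c * uxx z0 - vxx z0 + 2 * e \<le> 0" using second[of 1] by simp
  moreover have "c * uyy z0 - vyy z0 + 2 * e \<le> 0" using second[of \<i>] by simp
  moreover have "c * (uxx z0 + uyy z0) = 0" "vxx z0 + vyy z0 = 0" using U(4)[OF z0] V(4)[OF z0] by auto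
  then have "c * uxx z0 + c * uyy z0 = 0" by (simp add: algebra_simps)
  ultimately show False using e \<open>vxx z0 + vyy z0 = 0\<close> by linarith
qed


text \<open>At \<open>E\<close> the upper limits of \<open>v\<close> are at most 0 while
  \<open>h\<close> is positive. At infinity the two poles cancel, which decides nothing; shrinking
  \<open>v\<close> by \<open>1 - \<eta>\<close> makes the difference tend to minus infinity, so a
  violation is confined to a compact part of the complement of \<open>E\<close>.\<close>

lemma comparison:
  fixes v h :: "complex \<Rightarrow> real" and E :: "complex set"
  assumes E: "compact E" and v: "harmonic_on v (- E)" and h: "log_pole_at_infinity (- E) h"
    and lim: "((\<lambda>z. v z - ln (cmod z)) \<longlongrightarrow> c) at_infinity"
    and bdry: "\<And>\<zeta> e. \<zeta> \<in> E \<Longrightarrow> 0 < e \<Longrightarrow> eventually (\<lambda>z. v z < e) (at \<zeta> within - E)"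
    and z: "z \<in> - E"
  shows "v z \<le> h z"
proof -
  have hh: "harmonic_on h (- E)" and hpos: "\<And>z. z \<in> - E \<Longrightarrow> 0 < h z"
    using h by (auto simp: log_pole_at_infinity_def)
  obtain c' where lim': "((\<lambda>z. h z - ln (cmod z)) \<longlongrightarrow> c') at_infinity"
    using h by (auto simp: log_pole_at_infinity_def)
  have oE: "open (- E)" using E by (simp add: compact_imp_closed open_Compl)
  have cont: "continuous_on (- E) u" if "harmonic_on u (- E)" for u
    using that unfolding harmonic_on_def
    by (intro continuous_at_imp_continuous_on ballI) (blast intro: has_derivative_continuous)
  have main: "(1 - \<eta>) * v z - h z \<le> 0" if \<eta>: "0 < \<eta>" "\<eta> < 1" for \<eta>
  proof (rule ccontr)
    assume neg: "\<not> (1 - \<eta>) * v z - h z \<le> 0"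
    define d where "d = ((1 - \<eta>) * v z - h z) / 2"
    have d: "0 < d" using neg by (simp add: d_def)
    define g where "g w = (1 - \<eta>) * v w - h w" for w
    have "filterlim (\<lambda>w. ln (cmod w)) at_top at_infinity"
      by (rule filterlim_compose[OF ln_at_top filterlim_norm_at_top])
    then have "eventually (\<lambda>w. ((1 - \<eta>) * c - c' + 1) / \<eta> \<le> ln (cmod w)) at_infinity"
      by (simp add: filterlim_at_top)
    then have ev1: "eventually (\<lambda>w. ((1 - \<eta>) * c - c' + 1) + - \<eta> * ln (cmod w) \<le> 0) at_infinity"
      by eventually_elim (use \<eta> in \<open>simp add: field_simps\<close>)
    have "((\<lambda>w. (1 - \<eta>) * (v w - ln (cmod w)) - (h w - ln (cmod w))) \<longlongrightarrow> (1 - \<eta>) * c - c') at_infinity"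
      by (intro tendsto_intros lim lim')
    then have ev2: "eventually (\<lambda>w. (1 - \<eta>) * (v w - ln (cmod w)) - (h w - ln (cmod w)) < (1 - \<eta>) * c - c' + 1) at_infinity"
      by (rule order_tendstoD) simp
    have "eventually (\<lambda>w. g w < 0) at_infinity"
      using ev1 ev2 by eventually_elim (simp add: g_def algebra_simps)
    then obtain R where R: "\<And>w. R \<le> cmod w \<Longrightarrow> g w < 0"
      by (auto simp: eventually_at_infinity)
    have gz: "g z = 2 * d" by (simp add: g_def d_def)
    then have zR: "cmod z < R" using R[of z] d by (cases "R \<le> cmod z") auto
    then have R0: "0 < R" using norm_ge_zero le_less_trans by blast
    \<comment> \<open>On the disc of radius \<open>R\<close> the quadratic term is at most
      \<open>d / 2\<close>. Since \<open>g z = 2 * d\<close>, any point that beats the perturbed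
      maximum still satisfies \<open>d \<le> g w\<close> and falls back into
      \<open>K\<close>.\<close>
    define e where "e = d / (2 * R\<^sup>2)"
    have e: "0 < e" using d R0 by (simp add: e_def)
    define K where "K = {w \<in> - E. d \<le> g w}"
    have KR: "cmod w < R" if "w \<in> K" for w
      using that R[of w] d by (cases "R \<le> cmod w") (auto simp: K_def)
    have zK: "z \<in> K" using z gz d by (simp add: K_def)
    have "closed K"
      unfolding closed_sequential_limits
    proof (intro allI impI, elim conjE)
      fix x l assume x: "\<forall>n. x n \<in> K" and l: "x \<longlonglongrightarrow> l"
      \<comment> \<open>Near a point of \<open>E\<close> the function \<open>v\<close> is below
        \<open>d\<close>, and positivity of \<open>h\<close> then forces \<open>g < d\<close>; so
        \<open>K\<close> cannot accumulate at \<open>E\<close>.\<close>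
      have lE: "l \<notin> E"
      proof
        assume lE: "l \<in> E"
        have "eventually (\<lambda>w. v w < d) (at l within - E)" by (rule bdry[OF lE d])
        moreover have "filterlim x (at l within - E) sequentially"
          using x l lE by (auto simp: filterlim_at K_def intro!: always_eventually)
        ultimately have "eventually (\<lambda>n. v (x n) < d) sequentially"
          by (rule eventually_compose_filterlim)
        then obtain n where n: "v (x n) < d" by (auto simp: eventually_sequentially)
        have xn: "x n \<in> - E" "d \<le> g (x n)" using x by (auto simp: K_def)
        have "g (x n) < (1 - \<eta>) * v (x n)" using hpos[OF xn(1)] by (simp add: g_def)
        also have "\<dots> \<le> d"
        proof (cases "0 \<le> v (x n)")
          case True
          then have "(1 - \<eta>) * v (x n) \<le> 1 * v (x n)" using \<eta> by (intro mult_right_mono) auto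
          then show ?thesis using n by simp
        next
          case False
          then have "(1 - \<eta>) * v (x n) \<le> 0" using \<eta> by (simp add: mult_nonneg_nonpos)
          then show ?thesis using d by simp
        qed
        finally show False using xn(2) by simp
      qed
      have "isCont g l"
        using cont[OF v] cont[OF hh] lE oE unfolding g_def
        by (intro continuous_intros) (auto simp: continuous_on_eq_continuous_at)
      then have "(\<lambda>n. g (x n)) \<longlonglongrightarrow> g l" using l by (rule isCont_tendsto_compose)
      then have "d \<le> g l" by (rule LIMSEQ_le_const) (use x in \<open>auto simp: K_def\<close>)
      then show "l \<in> K" using lE by (simp add: K_def)
    qed
    moreover have "bounded K" using KR by (intro boundedI[of K R]) (auto intro: less_imp_le)
    ultimately have cK: "compact K" by (simp add: compact_eq_bounded_closed)
    have "continuous_on K (\<lambda>w. g w + e * (cmod w)\<^sup>2)"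
      unfolding g_def
      by (intro continuous_intros continuous_on_subset[OF cont[OF v]] continuous_on_subset[OF cont[OF hh]]) (auto simp: K_def)
    from continuous_attains_sup[OF cK _ this] zK obtain z0 where z0: "z0 \<in> K"
      and sup: "\<And>w. w \<in> K \<Longrightarrow> g w + e * (cmod w)\<^sup>2 \<le> g z0 + e * (cmod z0)\<^sup>2" by blast
    define \<Omega> where "\<Omega> = - E \<inter> ball 0 R"
    have \<Omega>: "open \<Omega>" "z0 \<in> \<Omega>" "\<Omega> \<subseteq> - E"
      using oE z0 KR[OF z0] by (auto simp: \<Omega>_def K_def)
    from harmonic_max_principle[OF harmonic_on_subset[OF v \<Omega>(3)] harmonic_on_subset[OF hh \<Omega>(3)] \<Omega>(1,2) e, of "1 - \<eta>"]
    obtain w where w: "w \<in> \<Omega>" "g z0 + e * (cmod z0)\<^sup>2 < g w + e * (cmod w)\<^sup>2" by (auto simp: g_def)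
    have "2 * d \<le> g z + e * (cmod z)\<^sup>2" using gz e by simp
    also have "\<dots> \<le> g z0 + e * (cmod z0)\<^sup>2" by (rule sup[OF zK])
    also have "\<dots> < g w + e * (cmod w)\<^sup>2" by (rule w)
    also have "e * (cmod w)\<^sup>2 \<le> e * R\<^sup>2"
      using w e by (intro mult_left_mono power_mono) (auto simp: \<Omega>_def)
    also have "e * R\<^sup>2 = d / 2" using R0 by (simp add: e_def)
    finally have "d \<le> g w" using d by simp
    then have "w \<in> K" using w by (auto simp: K_def \<Omega>_def)
    with sup w show False by force
  qed
  show ?thesis
  proof (rule ccontr)
    assume "\<not> v z \<le> h z"
    then have gt: "h z < v z" and vpos: "0 < v z" using hpos[OF z] by auto
    \<comment> \<open>With this choice the shrinking costs \<open>\<eta> * v z\<close>, exactly half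
      of the assumed excess.\<close>
    define \<eta> where "\<eta> = (v z - h z) / (2 * v z)"
    have "0 < \<eta>" "\<eta> < 1" using gt vpos hpos[OF z] by (auto simp: \<eta>_def field_simps)
    from main[OF this] have "v z - h z \<le> \<eta> * v z" by (simp add: algebra_simps)
    also have "\<dots> = (v z - h z) / 2" using vpos by (simp add: \<eta>_def)
    finally show False using gt by simp
  qed
qed

lemma comparison_at_infinity:
  fixes v h :: "complex \<Rightarrow> real" and E :: "complex set"
  assumes E: "compact E" and v: "harmonic_on v (- E)" and h: "log_pole_at_infinity (- E) h"
    and lim: "((\<lambda>z. v z - ln (cmod z)) \<longlongrightarrow> c) at_infinity"
    and bdry: "\<And>\<zeta> e. \<zeta> \<in> E \<Longrightarrow> 0 < e \<Longrightarrow> eventually (\<lambda>z. v z < e) (at \<zeta> within - E)"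
    and lim': "((\<lambda>z. h z - ln (cmod z)) \<longlongrightarrow> c') at_infinity"
  shows "c \<le> c'"
proof (rule tendsto_le[OF _ lim' lim])
  from compact_imp_bounded[OF E] obtain R where R: "\<And>z. z \<in> E \<Longrightarrow> cmod z \<le> R" by (auto simp: bounded_iff)
  have "v z - ln (cmod z) \<le> h z - ln (cmod z)" if "R + 1 \<le> cmod z" for z
    using comparison[OF E v h lim bdry, of z] R[of z] that by auto
  then show "eventually (\<lambda>z. v z - ln (cmod z) \<le> h z - ln (cmod z)) at_infinity"
    by (auto simp: eventually_at_infinity)
qed (simp add: trivial_limit_at_infinity)

section \<open>Leja points and the constant at infinity\<close>

text \<open>A greedy choice: the polynomial vanishing at the first \<open>k\<close> points attains
  its maximum modulus on \<open>E\<close> at the next one. A bound on sup norms of polynomials thus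
  becomes a bound on distances between points of a single sequence. Infinitude of \<open>E\<close>
  keeps these maxima positive and hence the points distinct.\<close>

lemma leja_points:
  assumes E: "compact E" and inf: "infinite E"
  obtains x :: "nat \<Rightarrow> complex" where "\<And>k. x k \<in> E" "inj x"
    "\<And>k z. z \<in> E \<Longrightarrow> (\<Prod>j<k. cmod (z - x j)) \<le> (\<Prod>j<k. cmod (x k - x j))"
proof -
  have ex: "\<exists>y. y \<in> E \<and> (\<forall>z\<in>E. (\<Prod>j<k. cmod (z - f j)) \<le> (\<Prod>j<k. cmod (y - f j)))" for k and f :: "nat \<Rightarrow> complex"
  proof -
    have "continuous_on E (\<lambda>z. \<Prod>j<k. cmod (z - f j))" by (intro continuous_intros)
    moreover have "E \<noteq> {}" using inf by auto
    ultimately show ?thesis using continuous_attains_sup[OF E, of "\<lambda>z. \<Prod>j<k. cmod (z - f j)"] by blast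
  qed
  have "\<exists>x :: nat \<Rightarrow> complex. \<forall>k. x k \<in> E \<and> (\<forall>z\<in>E. (\<Prod>j<k. cmod (z - x j)) \<le> (\<Prod>j<k. cmod (x k - x j)))"
  proof (rule dependent_wellorder_choice)
    fix f g :: "nat \<Rightarrow> complex" and k r
    assume "\<And>j. j < k \<Longrightarrow> f j = g j"
    then have "(\<Prod>j<k. cmod (z - f j)) = (\<Prod>j<k. cmod (z - g j))" for z by (intro prod.cong) auto
    then show "(r \<in> E \<and> (\<forall>z\<in>E. (\<Prod>j<k. cmod (z - f j)) \<le> (\<Prod>j<k. cmod (r - f j)))) =
      (r \<in> E \<and> (\<forall>z\<in>E. (\<Prod>j<k. cmod (z - g j)) \<le> (\<Prod>j<k. cmod (r - g j))))" by (simp only:)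
  qed (rule ex)
  then obtain x :: "nat \<Rightarrow> complex" where *:
    "\<forall>k. x k \<in> E \<and> (\<forall>z\<in>E. (\<Prod>j<k. cmod (z - x j)) \<le> (\<Prod>j<k. cmod (x k - x j)))" by (elim exE)
  have x: "x k \<in> E" "z \<in> E \<Longrightarrow> (\<Prod>j<k. cmod (z - x j)) \<le> (\<Prod>j<k. cmod (x k - x j))" for k z
    using *[rule_format, of k] by simp_all
  have ne: "x k \<noteq> x i" if "i < k" for i k
  proof
    assume "x k = x i"
    then have 0: "(\<Prod>j<k. cmod (x k - x j)) = 0" using that by auto
    have "infinite (E - x ` {..<k})" using inf by simp
    then obtain z where "z \<in> E" "z \<notin> x ` {..<k}" by (metis Diff_iff finite.emptyI ex_in_conv)
    then have "0 < (\<Prod>j<k. cmod (z - x j))" by (intro prod_pos) auto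
    with x(2)[OF \<open>z \<in> E\<close>, of k] 0 show False by simp
  qed
  have "inj x" by (rule injI) (metis ne linorder_neqE_nat)
  from that[OF x(1) this x(2)] show ?thesis .
qed

text \<open>The Bernstein-Walsh argument: with \<open>M\<close> the maximum of
  \<open>cmod (f z)\<close> on \<open>E\<close>, the function \<open>v\<close>, which is
  \<open>ln (cmod (f z) / M) / k\<close>, has the right pole, constant \<open>- ln M / k\<close> at
  infinity, and upper limits at most 0 on \<open>E\<close>.\<close>

lemma log_pole_leja_bound:
  assumes E: "compact E" and xE: "\<And>k. x k \<in> E" and inj: "inj x"
    and leja: "\<And>k z. z \<in> E \<Longrightarrow> (\<Prod>j<k. cmod (z - x j)) \<le> (\<Prod>j<k. cmod (x k - x j))"
    and h: "log_pole_at_infinity (- E) h" and lim: "((\<lambda>z. h z - ln (cmod z)) \<longlongrightarrow> c) at_infinity"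
  shows "(\<Sum>j<k. - ln (cmod (x k - x j))) \<le> real k * c"
proof (cases "k = 0")
  case False
  define f where "f z = (\<Prod>j<k. z - x j)" for z
  define M where "M = (\<Prod>j<k. cmod (x k - x j))"
  have M: "0 < M" unfolding M_def using inj by (intro prod_pos) (auto simp: inj_eq)
  have lnM: "ln M = (\<Sum>j<k. ln (cmod (x k - x j)))"
    unfolding M_def using inj by (intro ln_prod) (auto simp: inj_eq)
  define v where "v z = 1 / real k * ln (cmod (f z)) + - ln M / real k" for z
  have oE: "open (- E)" using E by (simp add: compact_imp_closed open_Compl)
  have f0: "f z \<noteq> 0" if "z \<notin> E" for z using that xE by (auto simp: f_def)
  have hv: "harmonic_on v (- E)"
    unfolding v_def by (rule harmonic_on_scaled_ln_norm[OF oE]) (use f0 in \<open>auto simp: f_def intro!: holomorphic_intros\<close>)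
  have "((\<lambda>z. x j / z) \<longlongrightarrow> 0) at_infinity" for j
    by (rule tendsto_divide_0[OF tendsto_const filterlim_ident])
  then have "((\<lambda>z. ln (cmod (1 - x j / z))) \<longlongrightarrow> ln (cmod (1 - 0))) at_infinity" for j
    by (intro tendsto_ln tendsto_norm tendsto_diff tendsto_const) simp_all
  then have "((\<lambda>z. \<Sum>j<k. ln (cmod (1 - x j / z))) \<longlongrightarrow> (\<Sum>j<k. ln (cmod (1 - 0)))) at_infinity"
    by (rule tendsto_sum)
  then have "((\<lambda>z. 1 / real k * (\<Sum>j<k. ln (cmod (1 - x j / z))) + - ln M / real k) \<longlongrightarrow>
      1 / real k * (\<Sum>j<k. ln (cmod (1 - 0))) + - ln M / real k) at_infinity"
    by (intro tendsto_add tendsto_mult_left tendsto_const)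
  moreover obtain R where R: "\<And>z. z \<in> E \<Longrightarrow> cmod z \<le> R" using compact_imp_bounded[OF E] by (auto simp: bounded_iff)
  have "1 / real k * (\<Sum>j<k. ln (cmod (1 - x j / z))) + - ln M / real k = v z - ln (cmod z)" if z: "max 0 R + 1 \<le> cmod z" for z
  proof -
    have z0: "z \<noteq> 0" using z by auto
    have zE: "z \<notin> E" using R z by force
    have s1: "ln (cmod (1 - x j / z)) = ln (cmod (z - x j)) - ln (cmod z)" for j
    proof -
      have "1 - x j / z = (z - x j) / z" using z0 by (simp add: field_simps)
      moreover have "z - x j \<noteq> 0" using zE xE by auto
      ultimately show ?thesis using z0 by (simp add: norm_divide ln_div)
    qed
    have s2: "ln (cmod (f z)) = (\<Sum>j<k. ln (cmod (z - x j)))"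
      unfolding f_def prod_norm[symmetric] using zE xE by (intro ln_prod) auto
    show ?thesis unfolding v_def s1 s2 sum_subtractf using False by (simp add: field_simps)
  qed
  then have "eventually (\<lambda>z. 1 / real k * (\<Sum>j<k. ln (cmod (1 - x j / z))) + - ln M / real k = v z - ln (cmod z)) at_infinity"
    by (auto simp: eventually_at_infinity)
  ultimately have limv: "((\<lambda>z. v z - ln (cmod z)) \<longlongrightarrow> - ln M / real k) at_infinity"
    by (subst (asm) tendsto_cong) auto
  have "- ln M / real k \<le> c"
  proof (rule comparison_at_infinity[OF E hv h limv _ lim])
    fix \<zeta> :: complex and e :: real assume \<zeta>: "\<zeta> \<in> E" and e: "0 < e"
    have "cmod (f \<zeta>) \<le> M" using leja[OF \<zeta>] by (simp add: f_def M_def prod_norm[symmetric])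
    also have "M < M * exp (real k * e)" using M e False by simp
    finally have "cmod (f \<zeta>) < M * exp (real k * e)" .
    moreover have "((\<lambda>z. cmod (f z)) \<longlongrightarrow> cmod (f \<zeta>)) (at \<zeta> within - E)"
      unfolding f_def by (intro tendsto_intros)
    ultimately have "eventually (\<lambda>z. cmod (f z) < M * exp (real k * e)) (at \<zeta> within - E)"
      by (intro order_tendstoD(2))
    moreover have "eventually (\<lambda>z. z \<in> - E) (at \<zeta> within - E)" by (simp add: eventually_at_filter)
    ultimately show "eventually (\<lambda>z. v z < e) (at \<zeta> within - E)"
    proof eventually_elim
      case (elim z)
      then have "ln (cmod (f z)) < ln (M * exp (real k * e))" using f0 M by (subst ln_less_cancel_iff) auto
      also have "\<dots> = ln M + real k * e" using M by (simp add: ln_mult_pos)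
      finally show ?case using False by (simp add: v_def field_simps)
    qed
  qed
  then have "- ln M \<le> real k * c" using False by (simp add: field_simps)
  then show ?thesis by (simp add: lnM sum_negf)
qed simp

lemma leja_energy_bound:
  assumes "\<And>k. (\<Sum>j<k. - ln (cmod (x k - x j))) \<le> real k * c"
  shows "(\<Sum>i<N. \<Sum>j\<in>{..<N} - {i}. - ln (cmod (x i - x j))) \<le> real N * (real N - 1) * c"
proof (induction N)
  case (Suc N)
  have split: "(\<Sum>i<Suc N. \<Sum>j\<in>{..<Suc N} - {i}. F i j) =
      (\<Sum>i<N. \<Sum>j\<in>{..<N} - {i}. F i j) + (\<Sum>i<N. F i N) + (\<Sum>j<N. F N j)" for F :: "nat \<Rightarrow> nat \<Rightarrow> real"
  proof -
    have "{..<Suc N} - {N} = {..<N}" by auto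
    moreover have "{..<Suc N} - {i} = insert N ({..<N} - {i})" if "i < N" for i using that by auto
    ultimately show ?thesis by (simp add: sum.distrib add_ac)
  qed
  have "(\<Sum>i<Suc N. \<Sum>j\<in>{..<Suc N} - {i}. - ln (cmod (x i - x j))) =
    (\<Sum>i<N. \<Sum>j\<in>{..<N} - {i}. - ln (cmod (x i - x j))) + (\<Sum>i<N. - ln (cmod (x i - x N)))
     + (\<Sum>j<N. - ln (cmod (x N - x j)))"
    by (rule split)
  also have "\<dots> = (\<Sum>i<N. \<Sum>j\<in>{..<N} - {i}. - ln (cmod (x i - x j))) + 2 * (\<Sum>j<N. - ln (cmod (x N - x j)))"
    by (simp add: norm_minus_commute[of _ "x N"])
  also have "\<dots> \<le> real N * (real N - 1) * c + 2 * (real N * c)"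
    using Suc assms[of N] by (intro add_mono mult_left_mono) auto
  also have "\<dots> = real (Suc N) * (real (Suc N) - 1) * c" by (simp add: algebra_simps)
  finally show ?case .
qed simp


section \<open>Exterior domain and capacity of compact sets on the real line\<close>

text \<open>A vertical ray pointing away from the real axis joins any point off \<open>E\<close> to
  infinity. Neighbourhoods of infinity are complements of bounded sets, so \<open>None\<close> is in
  the closure of the ray and may be added without losing connectedness.\<close>

lemma exterior_domain_real:
  assumes E: "compact E" and re: "E \<subseteq> \<real>"
  shows "exterior_domain E = - E"
proof
  let ?X = "subtopology riemann_sphere (- (Some ` E))"
  have "connected_component_of_set ?X None \<subseteq> topspace ?X"
    by (rule connected_component_of_subset_topspace)
  then show "exterior_domain E \<subseteq> - E" by (auto simp: exterior_domain_def)
  show "- E \<subseteq> exterior_domain E"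
  proof
    fix z assume z: "z \<in> - E"
    \<comment> \<open>For real \<open>z\<close> the ray goes upwards and touches the axis only at
      its starting point, which is off \<open>E\<close> by assumption.\<close>
    define k where "k = (if 0 \<le> Im z then \<i> else - \<i>)"
    have k1: "cmod k = 1" by (simp add: k_def)
    define L where "L = (\<lambda>t. z + of_real t * k) ` {0..}"
    have LE: "L \<inter> E = {}"
    proof -
      have "z + of_real t * k \<notin> E" if "0 \<le> t" for t
      proof
        assume t: "z + of_real t * k \<in> E"
        then have "Im (z + of_real t * k) = 0" using re by (auto simp: complex_is_Real_iff)
        then have "t = 0" using that by (auto simp: k_def split: if_splits)
        then show False using t z by simp
      qed
      then show ?thesis by (auto simp: L_def)
    qed
    have "connected L" unfolding L_def by (intro connected_continuous_image continuous_intros) simp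
    then have conn: "connectedin riemann_sphere (Some ` L)"
      unfolding riemann_sphere_def
      by (intro connectedin_continuous_map_image[OF continuous_map_Some]) simp
    have None_closure: "None \<in> riemann_sphere closure_of (Some ` L)"
      unfolding in_closure_of
    proof (intro conjI allI impI)
      show "None \<in> topspace riemann_sphere" by (simp add: riemann_sphere_def)
      fix T assume T: "None \<in> T \<and> openin riemann_sphere T"
      then obtain C where C: "compactin euclidean C" "T = insert None (Some ` (UNIV - C))"
        unfolding riemann_sphere_def openin_Alexandroff_compactification by auto
      then have "bounded C" using compact_imp_bounded by auto
      then obtain R where R: "\<And>w. w \<in> C \<Longrightarrow> cmod w \<le> R" by (auto simp: bounded_iff)
      define t where "t = \<bar>R\<bar> + cmod z + 1"
      have t: "0 \<le> t" by (simp add: t_def add_nonneg_nonneg)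
      have "cmod (of_real t * k) \<le> cmod (z + of_real t * k) + cmod z"
        using norm_triangle_ineq4[of "z + of_real t * k" z] by simp
      moreover have "cmod (of_real t * k) = t"
        using t by (simp only: norm_mult norm_of_real k1 mult_1_right abs_of_nonneg)
      ultimately have "R < cmod (z + of_real t * k)" unfolding t_def by linarith
      then have "z + of_real t * k \<notin> C" using R by force
      then show "\<exists>y. y \<in> Some ` L \<and> y \<in> T" using t C by (auto simp: L_def)
    qed
    have "Some ` L \<subseteq> riemann_sphere closure_of (Some ` L)"
      by (rule closure_of_subset) (use conn connectedin_subset_topspace in blast)
    with None_closure have "connectedin riemann_sphere (insert None (Some ` L))"
      by (intro connectedin_intermediate_closure_of[OF conn]) auto
    then have "connectedin ?X (insert None (Some ` L))"
      using LE by (auto simp: connectedin_subtopology)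
    moreover have "z \<in> L" unfolding L_def by (rule image_eqI[of _ _ 0]) auto
    ultimately have "connected_component_of ?X None (Some z)"
      unfolding connected_component_of_def by (intro exI[of _ "insert None (Some ` L)"]) auto
    then show "z \<in> exterior_domain E" by (simp add: exterior_domain_def)
  qed
qed

text \<open>The function picked by SOME is itself one of the competing \<open>h\<close>; if there is
  no Green function, the capacity is 0 and \<open>0 \<le> B\<close> settles the claim.\<close>

lemma log_capacity_le:
  assumes E: "compact E" and re: "E \<subseteq> \<real>" and B: "0 \<le> B"
    and bound: "\<And>h c. log_pole_at_infinity (- E) h \<Longrightarrow> ((\<lambda>z. h z - ln (cmod z)) \<longlongrightarrow> c) at_infinity \<Longrightarrow> exp (- c) \<le> B"
  shows "log_capacity E \<le> B"
proof (cases "\<exists>g. is_green_at_infinity (- E) g")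
  case True
  define g where "g = (SOME g. is_green_at_infinity (- E) g)"
  have "is_green_at_infinity (- E) g" unfolding g_def using True by (rule someI_ex)
  then have g: "log_pole_at_infinity (- E) g" by (simp add: is_green_at_infinity_def)
  then obtain c where c: "((\<lambda>z. g z - ln (cmod z)) \<longlongrightarrow> c) at_infinity"
    by (auto simp: log_pole_at_infinity_def)
  from tendsto_minus[OF c] have "((\<lambda>z. ln (cmod z) - g z) \<longlongrightarrow> - c) at_infinity" by simp
  then have "Lim at_infinity (\<lambda>z. ln (cmod z) - g z) = - c"
    by (intro tendsto_Lim) (simp_all add: trivial_limit_at_infinity)
  then show ?thesis
    using True bound[OF g c] by (simp add: log_capacity_def exterior_domain_real[OF E re] g_def)
next
  case False
  then show ?thesis using B by (simp add: log_capacity_def exterior_domain_real[OF E re])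
qed

lemma log_capacity_eqI:
  assumes E: "compact E" and re: "E \<subseteq> \<real>" and g: "is_green_at_infinity (- E) g"
    and c: "((\<lambda>z. g z - ln (cmod z)) \<longlongrightarrow> c) at_infinity"
  shows "log_capacity E = exp (- c)"
proof -
  define g' where "g' = (SOME g. is_green_at_infinity (- E) g)"
  have g': "is_green_at_infinity (- E) g'" using someI_ex[of "is_green_at_infinity (- E)"] g unfolding g'_def by blast
  have eq: "g' z = g z" if "z \<in> - E" for z
    using g g' that unfolding is_green_at_infinity_def by (meson order_antisym)
  from compact_imp_bounded[OF E] obtain R where R: "\<And>z. z \<in> E \<Longrightarrow> cmod z \<le> R" by (auto simp: bounded_iff)
  have "ln (cmod z) - g z = ln (cmod z) - g' z" if "R + 1 \<le> cmod z" for z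
  proof -
    have "z \<notin> E" using R[of z] that by force
    then show ?thesis using eq[of z] by simp
  qed
  then have ev: "eventually (\<lambda>z. ln (cmod z) - g z = ln (cmod z) - g' z) at_infinity"
    by (auto simp: eventually_at_infinity)
  from tendsto_minus[OF c] have "((\<lambda>z. ln (cmod z) - g z) \<longlongrightarrow> - c) at_infinity" by simp
  then have "((\<lambda>z. ln (cmod z) - g' z) \<longlongrightarrow> - c) at_infinity"
    by (rule Lim_transform_eventually[OF _ ev])
  then have "Lim at_infinity (\<lambda>z. ln (cmod z) - g' z) = - c"
    by (intro tendsto_Lim) (simp_all add: trivial_limit_at_infinity)
  then show ?thesis using g by (auto simp: log_capacity_def exterior_domain_real[OF E re] g'_def)
qed

subsection \<open>Logarithmic energy and inner functions\<close>

text \<open>Real part of the logarithmic series. The term \<open>k = 0\<close> is a division by zero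
  and therefore 0; the same convention holds in all the series below.\<close>

lemma neg_ln_cmod_sums:
  assumes "cmod w < 1"
  shows "(\<lambda>k. Re (w ^ k) / real k) sums (- ln (cmod (1 - w)))"
proof -
  have "(\<lambda>n. - ((- (- w)) ^ n) / of_nat n) sums ln (1 + (- w))"
    by (rule Ln_series') (use assms in simp)
  from sums_Re[OF this] have "(\<lambda>n. - (Re (w ^ n) / real n)) sums Re (ln (1 - w))"
    by simp
  moreover have "1 - w \<noteq> 0" using assms by auto
  ultimately have "(\<lambda>n. - (Re (w ^ n) / real n)) sums (ln (cmod (1 - w)))"
    by simp
  from sums_minus[OF this] show ?thesis by simp
qed

text \<open>The kernel is the real part of the reproducing kernel of the Dirichlet space of
  functions vanishing at 0, so the double sum, diagonal included, is the squared norm of a sum of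
  point evaluations.\<close>

lemma energy_sums:
  assumes "finite J" "\<And>i. i \<in> J \<Longrightarrow> cmod (z i) < 1"
  shows "(\<lambda>k. (cmod (\<Sum>i\<in>J. z i ^ k))\<^sup>2 / real k) sums
         (\<Sum>i\<in>J. \<Sum>j\<in>J. - ln (cmod (1 - z i * cnj (z j))))"
proof -
  have "(\<lambda>k. \<Sum>i\<in>J. \<Sum>j\<in>J. Re ((z i * cnj (z j)) ^ k) / real k) sums
         (\<Sum>i\<in>J. \<Sum>j\<in>J. - ln (cmod (1 - z i * cnj (z j))))"
  proof (intro sums_sum neg_ln_cmod_sums)
    fix i j assume "i \<in> J" "j \<in> J"
    then have "cmod (z i) * cmod (z j) < 1 * 1"
      using assms by (intro mult_strict_mono) auto
    then show "cmod (z i * cnj (z j)) < 1" by (simp add: norm_mult)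
  qed
  moreover have "(\<Sum>i\<in>J. \<Sum>j\<in>J. Re ((z i * cnj (z j)) ^ k) / real k)
      = (cmod (\<Sum>i\<in>J. z i ^ k))\<^sup>2 / real k" for k
  proof -
    have "(\<Sum>i\<in>J. \<Sum>j\<in>J. Re ((z i * cnj (z j)) ^ k) / real k) =
      Re (\<Sum>i\<in>J. \<Sum>j\<in>J. z i ^ k * cnj (z j ^ k)) / real k"
      by (simp add: sum_divide_distrib power_mult_distrib)
    also have "(\<Sum>i\<in>J. \<Sum>j\<in>J. z i ^ k * cnj (z j ^ k)) = (\<Sum>i\<in>J. z i ^ k) * cnj (\<Sum>i\<in>J. z i ^ k)"
      by (simp add: sum_product)
    also have "Re \<dots> = (cmod (\<Sum>i\<in>J. z i ^ k))\<^sup>2"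
      by (subst complex_norm_square[symmetric]) simp
    finally show ?thesis .
  qed
  ultimately show ?thesis by simp
qed

lemma energy_nonneg:
  assumes "finite J" "\<And>i. i \<in> J \<Longrightarrow> cmod (z i) < 1"
  shows "0 \<le> (\<Sum>i\<in>J. \<Sum>j\<in>J. - ln (cmod (1 - z i * cnj (z j))))"
  by (rule sums_le[OF _ sums_zero energy_sums[OF assms]]) auto

text \<open>When \<open>cmod (B u) = 1\<close> on the circle, \<open>inverse (B u) ^ k\<close> is
  the conjugate of \<open>B u ^ k\<close>, so these are the Dirichlet inner products of powers of
  \<open>B\<close>. For different exponents the integrand has a single-valued primitive, a multiple
  of a nonzero integer power of \<open>B\<close>; for equal ones it is a multiple of the logarithmic
  derivative. At \<open>l = 0\<close> the truncated \<open>l - 1\<close> is masked by the factor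
  \<open>of_nat l\<close>.\<close>

lemma circle_integral_powers:
  assumes "1 < R" "B holomorphic_on ball 0 R" and B1: "\<And>z. cmod z = 1 \<Longrightarrow> B z \<noteq> 0"
    and q: "contour_integral (circlepath 0 1) (\<lambda>z. deriv B z / B z) = 2 * of_real pi * \<i> * of_nat q"
  shows "((\<lambda>u. of_nat l * B u ^ (l - 1) * deriv B u * inverse (B u) ^ k) has_contour_integral
           (if k = l then 2 * of_real pi * \<i> * of_nat q * of_nat l else 0)) (circlepath 0 1)"
proof (cases "k = l")
  case True
  have sub: "sphere 0 1 \<subseteq> ball (0::complex) R" using assms(1) by auto
  have "(\<lambda>z. deriv B z / B z) contour_integrable_on (circlepath 0 1)"
    using B1 sub assms(2)
    by (intro contour_integrable_continuous_circlepath continuous_intros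
          holomorphic_on_imp_continuous_on holomorphic_on_subset[OF holomorphic_deriv[OF assms(2)]]
          holomorphic_on_subset[OF assms(2)]) auto
  then have "((\<lambda>z. of_nat l * (deriv B z / B z)) has_contour_integral
        of_nat l * (2 * of_real pi * \<i> * of_nat q)) (circlepath 0 1)"
    using q by (metis has_contour_integral_integral has_contour_integral_lmul)
  then have "((\<lambda>u. of_nat l * B u ^ (l - 1) * deriv B u * inverse (B u) ^ k) has_contour_integral
       of_nat l * (2 * of_real pi * \<i> * of_nat q)) (circlepath 0 1)"
  proof (rule has_contour_integral_eq)
    fix x assume "x \<in> path_image (circlepath 0 1)"
    then have "B x \<noteq> 0" using B1 by auto
    then show "of_nat l * (deriv B x / B x) = of_nat l * B x ^ (l - 1) * deriv B x * inverse (B x) ^ k"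
      using True by (cases l) (auto simp: field_simps)
  qed
  then show ?thesis using True by (simp add: algebra_simps)
next
  case False
  let ?d = "int l - int k"
  have nz: "of_int ?d \<noteq> (0::complex)" using False by (metis of_int_eq_0_iff eq_iff_diff_eq_0 of_nat_eq_iff)
  have "((\<lambda>u. of_nat l * B u powi (?d - 1) * deriv B u) has_contour_integral 0) (circlepath 0 1)"
  proof (rule Cauchy_theorem_primitive[where S = "sphere 0 1" and f = "\<lambda>u. of_nat l / of_int ?d * B u powi ?d"])
    fix x :: complex assume x: "x \<in> sphere 0 1"
    have "(B has_field_derivative deriv B x) (at x)"
      using x assms by (intro holomorphic_derivI[OF assms(2)]) auto
    then have "(B has_field_derivative deriv B x) (at x within sphere 0 1)"
      by (rule has_field_derivative_at_within)
    then show "((\<lambda>u. of_nat l / of_int ?d * B u powi ?d) has_field_derivative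
        of_nat l * B x powi (?d - 1) * deriv B x) (at x within sphere 0 1)"
      using B1[of x] x nz by (auto intro!: derivative_eq_intros)
  qed auto
  then have "((\<lambda>u. of_nat l * B u ^ (l - 1) * deriv B u * inverse (B u) ^ k) has_contour_integral
       0) (circlepath 0 1)"
  proof (rule has_contour_integral_eq)
    fix x assume "x \<in> path_image (circlepath 0 1)"
    then have "B x \<noteq> 0" using B1 by auto
    then show "of_nat l * B x powi (?d - 1) * deriv B x = of_nat l * B x ^ (l - 1) * deriv B x * inverse (B x) ^ k"
      by (cases l) (auto simp: power_int_diff field_simps)
  qed
  then show ?thesis using False by simp
qed

text \<open>Boundary form of the area integral of the squared modulus of \<open>deriv f\<close>. On
  the unit circle \<open>cnj (f u)\<close> is a power series in \<open>inverse u\<close>, and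
  integrating \<open>deriv f\<close> against its terms picks out Taylor coefficients.\<close>

lemma dirichlet_norm_sums:
  fixes f :: "complex \<Rightarrow> complex"
  assumes R: "1 < R" and hf: "f holomorphic_on ball 0 R"
    and I: "((\<lambda>u. deriv f u * cnj (f u)) has_contour_integral (2 * of_real pi * \<i> * of_real d)) (circlepath 0 1)"
  shows "(\<lambda>m. real m * (cmod ((deriv ^^ m) f 0 / fact m))\<^sup>2) sums d"
proof -
  define a where "a m = (deriv ^^ m) f 0 / fact m" for m
  have ser: "(\<lambda>m. a m * w ^ m) sums f w" if "cmod w < R" for w
    using holomorphic_power_series[OF hf, of w] that by (simp add: a_def)
  \<comment> \<open>Convergence at a radius beyond 1 makes the series converge absolutely, hence
    uniformly, on the unit circle, so that it may be integrated term by term.\<close>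
  define r where "r = (1 + R) / 2"
  have r: "1 < r" "r < R" using R by (auto simp: r_def)
  have "summable (\<lambda>m. a m * of_real r ^ m)" using ser[of "of_real r"] r by (auto simp: sums_iff)
  then have "summable (\<lambda>m. norm (a m * 1 ^ m))"
    by (rule powser_insidea) (use r in simp)
  then have suma: "summable (\<lambda>m. cmod (a m))" by simp
  have sub: "sphere 0 1 \<subseteq> ball (0::complex) R" "cball 0 1 \<subseteq> ball (0::complex) R" using R by auto
  have hdf: "deriv f holomorphic_on ball 0 R" by (rule holomorphic_deriv[OF hf]) simp
  have cdf: "continuous_on (cball 0 1) (deriv f)" and cf: "continuous_on (sphere 0 1) f"
    using hdf hf sub by (auto intro!: holomorphic_on_imp_continuous_on intro: holomorphic_on_subset)
  have cdf': "continuous_on (sphere 0 1) (deriv f)" using cdf by (rule continuous_on_subset) auto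
  have ul: "uniform_limit (sphere 0 1) (\<lambda>n u. \<Sum>m<n. cnj (a m) * inverse u ^ m)
              (\<lambda>u. \<Sum>m. cnj (a m) * inverse u ^ m) sequentially"
    by (rule Weierstrass_m_test[OF _ suma]) (auto simp: norm_mult norm_power norm_inverse)
  have cnjf: "(\<Sum>m. cnj (a m) * inverse u ^ m) = cnj (f u)" if "cmod u = 1" for u
  proof -
    have "(\<lambda>m. a m * u ^ m) sums f u" using ser that R by auto
    then have "(\<lambda>m. cnj (a m * u ^ m)) sums cnj (f u)" by (subst sums_cnj)
    moreover have "inverse u = cnj u" using that
      by (metis complex_norm_square inverse_unique mult.commute of_real_1 one_power2)
    ultimately show ?thesis by (simp add: sums_iff)
  qed
  have bdd: "bounded (deriv f ` sphere 0 1)" "bounded ((\<lambda>u. cnj (f u)) ` sphere 0 1)"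
    by (intro compact_imp_bounded compact_continuous_image cdf' continuous_intros cf compact_sphere)+
  have ul1: "uniform_limit (sphere 0 1) (\<lambda>n u. \<Sum>m<n. cnj (a m) * inverse u ^ m)
              (\<lambda>u. cnj (f u)) sequentially"
    using ul by (rule uniform_limit_cong'[THEN iffD1, rotated -1]) (auto simp: cnjf)
  have ul2: "uniform_limit (sphere 0 1) (\<lambda>n u. deriv f u * (\<Sum>m<n. cnj (a m) * inverse u ^ m))
              (\<lambda>u. deriv f u * cnj (f u)) sequentially"
    by (rule uniform_lim_mult[OF uniform_limit_const ul1 bdd])
  have trm: "((\<lambda>u. deriv f u * (cnj (a m) * inverse u ^ m)) has_contour_integral
       (2 * of_real pi * \<i> * of_real (real m * (cmod (a m))\<^sup>2))) (circlepath 0 1)" for m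
  proof (cases m)
    case 0
    have "(deriv f has_contour_integral 0) (circlepath 0 1)"
      by (rule Cauchy_theorem_convex_simple[OF hdf]) (use sub in auto)
    then have "((\<lambda>u. deriv f u * cnj (a m)) has_contour_integral 0 * cnj (a m)) (circlepath 0 1)"
      by (rule has_contour_integral_rmul)
    then show ?thesis using 0 by simp
  next
    case (Suc k)
    have "((\<lambda>u. deriv f u / (u - 0) ^ Suc k) has_contour_integral
        ((2 * pi * \<i>) / (fact k) * (deriv ^^ k) (deriv f) 0)) (circlepath 0 1)"
      by (rule Cauchy_has_contour_integral_higher_derivative_circlepath[OF cdf])
         (use hdf R in \<open>auto intro: holomorphic_on_subset\<close>)
    also have "(deriv ^^ k) (deriv f) 0 = fact m * a m" 
      by (simp add: a_def Suc funpow_swap1 del: fact_Suc)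
    finally have "((\<lambda>u. cnj (a m) * (deriv f u / (u - 0) ^ Suc k)) has_contour_integral
        cnj (a m) * ((2 * pi * \<i>) / (fact k) * (fact m * a m))) (circlepath 0 1)"
      by (rule has_contour_integral_lmul)
    moreover have "cnj (a m) * ((2 * pi * \<i>) / (fact k) * (fact m * a m)) =
       2 * of_real pi * \<i> * of_real (real m * (cmod (a m))\<^sup>2)"
      unfolding of_real_mult complex_norm_square Suc by (simp add: field_simps del: of_nat_Suc)
    moreover have "(\<lambda>u. cnj (a m) * (deriv f u / (u - 0) ^ Suc k)) =
        (\<lambda>u. deriv f u * (cnj (a m) * inverse u ^ m))"
      unfolding Suc by (simp add: divide_inverse power_inverse algebra_simps)
    ultimately show ?thesis by simp
  qed
  have part: "((\<lambda>u. deriv f u * (\<Sum>m<n. cnj (a m) * inverse u ^ m)) has_contour_integral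
       (2 * of_real pi * \<i> * of_real (\<Sum>m<n. real m * (cmod (a m))\<^sup>2))) (circlepath 0 1)" for n
    unfolding sum_distrib_left of_real_sum by (intro has_contour_integral_sum trm) auto
  have "(\<lambda>n. contour_integral (circlepath 0 1) (\<lambda>u. deriv f u * (\<Sum>m<n. cnj (a m) * inverse u ^ m)))
      \<longlonglongrightarrow> contour_integral (circlepath 0 1) (\<lambda>u. deriv f u * cnj (f u))"
    by (rule contour_integral_uniform_limit_circlepath[OF _ ul2])
       (auto intro!: always_eventually has_contour_integral_integrable[OF part])
  then have "(\<lambda>n. 2 * of_real pi * \<i> * of_real (\<Sum>m<n. real m * (cmod (a m))\<^sup>2)) \<longlonglongrightarrow> 2 * of_real pi * \<i> * complex_of_real d"
    using contour_integral_unique[OF part] contour_integral_unique[OF I] by simp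
  then have "(\<lambda>n. inverse (2 * of_real pi * \<i>) * (2 * of_real pi * \<i> * complex_of_real (\<Sum>m<n. real m * (cmod (a m))\<^sup>2)))
      \<longlonglongrightarrow> inverse (2 * of_real pi * \<i>) * (2 * of_real pi * \<i> * complex_of_real d)"
    by (rule tendsto_mult_left)
  then have "(\<lambda>n. complex_of_real (\<Sum>m<n. real m * (cmod (a m))\<^sup>2)) \<longlonglongrightarrow> complex_of_real d"
    by (simp add: field_simps)
  then have "(\<lambda>n. \<Sum>m<n. real m * (cmod (a m))\<^sup>2) \<longlonglongrightarrow> d"
    using tendsto_of_real_iff by blast
  then show ?thesis by (simp add: sums_def a_def)
qed


lemma inner_function_in_disc:
  assumes R: "1 < R" and hB: "B holomorphic_on ball 0 R" and "B 0 = 0"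
    and B1: "\<And>z. cmod z = 1 \<Longrightarrow> cmod (B z) = 1" and w: "cmod w < 1"
  shows "cmod (B w) < 1"
proof (rule ccontr)
  assume "\<not> cmod (B w) < 1"
  have sub: "cball 0 1 \<subseteq> ball (0::complex) R" using R by auto
  have hB1: "B holomorphic_on ball 0 1" by (rule holomorphic_on_subset[OF hB]) (use R in auto)
  have cB1: "continuous_on (cball 0 1) B"
    by (rule holomorphic_on_imp_continuous_on[OF holomorphic_on_subset[OF hB sub]])
  have le: "cmod (B z) \<le> 1" if "cmod z < 1" for z
    by (rule maximum_modulus_frontier[of B "ball 0 1"])
       (use that B1 hB1 cB1 in auto)
  have "B constant_on ball 0 1"
    by (rule maximum_modulus_principle[of B "ball 0 1" "ball 0 1" w])
       (use w le \<open>\<not> cmod (B w) < 1\<close> hB1 in \<open>fastforce+\<close>)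
  then have "B w = B 0" using w by (auto simp: constant_on_def)
  with \<open>\<not> cmod (B w) < 1\<close> \<open>B 0 = 0\<close> show False by simp
qed

text \<open>The powers of an inner function of winding number q are orthogonal in the Dirichlet space, where
  \<open>B ^ k\<close> has squared norm \<open>q * k\<close>; the estimate is Bessel's inequality for the point
  evaluations at the \<open>z i\<close>.\<close>

lemma energy_inner_function:
  assumes R: "1 < R" and hB: "B holomorphic_on ball 0 R" and B0: "B 0 = 0"
    and B1: "\<And>z. cmod z = 1 \<Longrightarrow> cmod (B z) = 1"
    and q: "contour_integral (circlepath 0 1) (\<lambda>z. deriv B z / B z) = 2 * of_real pi * \<i> * of_nat q"
    and J: "finite J" "\<And>i. i \<in> J \<Longrightarrow> cmod (z i) < 1"
  shows "(\<Sum>i\<in>J. \<Sum>j\<in>J. - ln (cmod (1 - B (z i) * cnj (B (z j)))))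
         \<le> real q * (\<Sum>i\<in>J. \<Sum>j\<in>J. - ln (cmod (1 - z i * cnj (z j))))"
proof -
  define I where "I = (\<Sum>i\<in>J. \<Sum>j\<in>J. - ln (cmod (1 - z i * cnj (z j))))"
  define S where "S m = (\<Sum>i\<in>J. z i ^ m)" for m
  define Y where "Y k = (\<Sum>i\<in>J. B (z i) ^ k)" for k
  define E where "E n = (\<Sum>k<n. (cmod (Y k))\<^sup>2 / real k)" for n
  have BJ: "\<And>i. i \<in> J \<Longrightarrow> cmod (B (z i)) < 1"
    using inner_function_in_disc[OF R hB B0 B1] J by blast
  have Isums: "(\<lambda>m. (cmod (S m))\<^sup>2 / real m) sums I"
    unfolding S_def I_def by (rule energy_sums[OF J])
  have Ipart: "(\<Sum>m<n. (cmod (S m))\<^sup>2 / real m) \<le> I" for n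
    using sum_le_suminf[OF sums_summable[OF Isums], of "{..<n}"] sums_unique[OF Isums] by simp
  have "E n \<le> real q * I" for n
  proof -
    \<comment> \<open>The extremal test function of Bessel's inequality: with these coefficients the
      values \<open>f (z i)\<close> add up to \<open>E n\<close> and the squared norm of
      \<open>f\<close> is \<open>q * E n\<close>, so Cauchy-Schwarz yields
      \<open>E n ^ 2 \<le> q * E n * I\<close>. Division by zero gives \<open>c 0 = 0\<close>, so
      \<open>f\<close> vanishes at 0.\<close>
    define c where "c k = cnj (Y k) / of_nat k" for k
    define f where "f u = (\<Sum>k<n. c k * B u ^ k)" for u
    define a where "a m = (deriv ^^ m) f 0 / fact m" for m
    have c2: "real k * (cmod (c k))\<^sup>2 = (cmod (Y k))\<^sup>2 / real k" for k
      by (simp add: c_def norm_divide power2_eq_square)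
    have hf: "f holomorphic_on ball 0 R"
      unfolding f_def by (intro holomorphic_intros hB)
    have df: "deriv f u = (\<Sum>l<n. c l * (of_nat l * B u ^ (l - 1) * deriv B u))" if "u \<in> ball 0 R" for u
    proof (rule DERIV_imp_deriv)
      have "(B has_field_derivative deriv B u) (at u)"
        by (rule holomorphic_derivI[OF hB]) (use that in auto)
      then show "(f has_field_derivative (\<Sum>l<n. c l * (of_nat l * B u ^ (l - 1) * deriv B u))) (at u)"
        unfolding f_def by (auto intro!: derivative_eq_intros sum.cong)
    qed
    have cinv: "cnj (B u) = inverse (B u)" if "cmod u = 1" for u
      using B1[OF that] by (metis complex_norm_square inverse_unique of_real_1 one_power2)
    have "((\<lambda>u. \<Sum>l<n. \<Sum>k<n. (c l * cnj (c k)) * (of_nat l * B u ^ (l - 1) * deriv B u * inverse (B u) ^ k))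
      has_contour_integral (\<Sum>l<n. \<Sum>k<n. (c l * cnj (c k)) *
         (if k = l then 2 * of_real pi * \<i> * of_nat q * of_nat l else 0))) (circlepath 0 1)"
    proof -
      have "\<And>z. cmod z = 1 \<Longrightarrow> B z \<noteq> 0" using B1 by force
      then show ?thesis
        by (intro has_contour_integral_sum has_contour_integral_lmul circle_integral_powers[OF R hB _ q]) auto
    qed
    also have "(\<Sum>l<n. \<Sum>k<n. (c l * cnj (c k)) *
         (if k = l then 2 * of_real pi * \<i> * of_nat q * of_nat l else 0))
       = (\<Sum>l<n. (c l * cnj (c l)) * (2 * of_real pi * \<i> * of_nat q * of_nat l))"
      by (intro sum.cong refl) (auto simp: if_distrib[of "\<lambda>x. _ * x"] sum.delta cong: if_cong)
    also have "\<dots> = 2 * of_real pi * \<i> * of_real (real q * E n)"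
      unfolding E_def c2[symmetric] of_real_mult of_real_sum complex_norm_square sum_distrib_left
      by (intro sum.cong refl) (simp add: algebra_simps)
    finally have "((\<lambda>u. deriv f u * cnj (f u)) has_contour_integral
        2 * of_real pi * \<i> * of_real (real q * E n)) (circlepath 0 1)"
    proof (rule has_contour_integral_eq)
      fix u assume "u \<in> path_image (circlepath 0 1)"
      then have u: "cmod u = 1" "u \<in> ball 0 R" using R by auto
      show "(\<Sum>l<n. \<Sum>k<n. (c l * cnj (c k)) * (of_nat l * B u ^ (l - 1) * deriv B u * inverse (B u) ^ k))
          = deriv f u * cnj (f u)"
        unfolding df[OF u(2)] f_def cnj_sum sum_product
        by (intro sum.cong refl) (simp add: cinv[OF u(1)])
    qed
    from dirichlet_norm_sums[OF R hf this]
    have D: "(\<lambda>m. real m * (cmod (a m))\<^sup>2) sums (real q * E n)" by (simp add: a_def)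
    have Dpart: "(\<Sum>m<N. real m * (cmod (a m))\<^sup>2) \<le> real q * E n" for N
      using sum_le_suminf[OF sums_summable[OF D], of "{..<N}"] sums_unique[OF D] by simp
    have "f 0 = 0" unfolding f_def by (rule sum.neutral) (auto simp: B0 c_def power_0_left)
    then have a0: "a 0 = 0" by (simp add: a_def)
    have "(\<lambda>m. \<Sum>i\<in>J. a m * z i ^ m) sums (\<Sum>i\<in>J. f (z i))"
    proof (intro sums_sum)
      fix i assume "i \<in> J"
      then have "z i \<in> ball 0 R" using J R by force
      from holomorphic_power_series[OF hf this] show "(\<lambda>m. a m * z i ^ m) sums f (z i)"
        by (simp add: a_def)
    qed
    moreover have "(\<Sum>i\<in>J. f (z i)) = of_real (E n)"
    proof -
      have "(\<Sum>i\<in>J. f (z i)) = (\<Sum>k<n. c k * Y k)"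
        unfolding f_def Y_def sum_distrib_left by (rule sum.swap)
      also have "\<dots> = of_real (E n)"
        unfolding E_def of_real_sum of_real_divide complex_norm_square c_def
        by (intro sum.cong refl) (simp add: algebra_simps)
      finally show ?thesis .
    qed
    ultimately have lim: "(\<lambda>N. \<Sum>m<N. a m * S m) \<longlonglongrightarrow> of_real (E n)"
      by (simp add: sums_def S_def sum_distrib_left)
    have En0: "0 \<le> E n" unfolding E_def by (intro sum_nonneg) auto
    have "(cmod (\<Sum>m<N. a m * S m))\<^sup>2 \<le> (real q * E n) * I" for N
    proof -
      \<comment> \<open>The weights \<open>sqrt m\<close> split each term between the Dirichlet norm
        of \<open>f\<close> and the energy of the points. At \<open>m = 0\<close> they would lose a
        term, but \<open>a 0 = 0\<close>.\<close>
      have "cmod (\<Sum>m<N. a m * S m) \<le> (\<Sum>m<N. (sqrt (real m) * cmod (a m)) * (cmod (S m) / sqrt (real m)))"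
        by (rule sum_norm_le) (use a0 in \<open>auto simp: norm_mult field_simps\<close>)
      then have "(cmod (\<Sum>m<N. a m * S m))\<^sup>2 \<le>
          (\<Sum>m<N. (sqrt (real m) * cmod (a m)) * (cmod (S m) / sqrt (real m)))\<^sup>2"
        by (rule power_mono) simp
      also have "\<dots> \<le> (\<Sum>m<N. (sqrt (real m) * cmod (a m))\<^sup>2) * (\<Sum>m<N. (cmod (S m) / sqrt (real m))\<^sup>2)"
        by (rule Cauchy_Schwarz_ineq_sum)
      also have "\<dots> = (\<Sum>m<N. real m * (cmod (a m))\<^sup>2) * (\<Sum>m<N. (cmod (S m))\<^sup>2 / real m)"
        by (simp add: power_mult_distrib power_divide)
      also have "\<dots> \<le> (real q * E n) * I"
        by (intro mult_mono Dpart Ipart) (use En0 in \<open>auto intro!: sum_nonneg\<close>)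
      finally show ?thesis .
    qed
    moreover have "(\<lambda>N. (cmod (\<Sum>m<N. a m * S m))\<^sup>2) \<longlonglongrightarrow> (cmod (of_real (E n)))\<^sup>2"
      by (intro tendsto_intros lim)
    ultimately have "(cmod (of_real (E n)))\<^sup>2 \<le> (real q * E n) * I"
      by (intro LIMSEQ_le_const2) auto
    then have le: "E n * E n \<le> E n * (real q * I)" using En0 by (simp add: power2_eq_square algebra_simps)
    have "0 \<le> I" using energy_nonneg[OF J] by (simp add: I_def)
    then show ?thesis using le En0 by (cases "E n = 0") (auto simp: mult_le_cancel_left)
  qed
  moreover have "E \<longlonglongrightarrow> (\<Sum>i\<in>J. \<Sum>j\<in>J. - ln (cmod (1 - B (z i) * cnj (B (z j)))))"
    using energy_sums[of J "\<lambda>i. B (z i)", OF J(1) BJ] unfolding sums_def E_def Y_def by simp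
  ultimately show ?thesis unfolding I_def by (intro LIMSEQ_le_const2) auto
qed

subsection \<open>The Blaschke product of a family of gaps\<close>

text \<open>An argument principle obtained by splitting off one root at a time: a root inside the
  circle contributes 1, a root outside contributes 0. Bounding the count by the degree is enough,
  because the energy it multiplies is nonnegative.\<close>

lemma poly_log_deriv_circle:
  fixes p :: "complex poly"
  assumes "p \<noteq> 0" "\<And>z. cmod z = 1 \<Longrightarrow> poly p z \<noteq> 0"
  shows "\<exists>q\<le>degree p. ((\<lambda>z. poly (pderiv p) z / poly p z) has_contour_integral
           2 * of_real pi * \<i> * of_nat q) (circlepath 0 1)"
  using assms
proof (induction "degree p" arbitrary: p)
  case 0
  then obtain c where "p = [:c:]" by (metis degree_eq_zeroE)
  then show ?case using has_contour_integral_0 by (auto intro!: exI[of _ 0])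
next
  case (Suc d)
  have "lead_coeff p \<noteq> 0" "degree p \<in> {1..degree p}" using Suc.prems Suc.hyps by auto
  then obtain a where "(\<Sum>i\<le>degree p. coeff p i * a ^ i) = 0"
    using fundamental_theorem_of_algebra[of "coeff p" "degree p"] by blast
  then have "poly p a = 0" by (simp add: poly_altdef)
  then obtain r where p: "p = [:- a, 1:] * r" by (metis poly_eq_0_iff_dvd dvdE)
  have r0: "r \<noteq> 0" using Suc.prems p by auto
  have a1: "cmod a \<noteq> 1" using Suc.prems(2) \<open>poly p a = 0\<close> by auto
  have "degree p = Suc (degree r)" using r0 by (simp add: p degree_mult_eq del: mult_pCons_left)
  moreover have "poly r z \<noteq> 0" if "cmod z = 1" for z using Suc.prems(2)[OF that] by (simp add: p)
  ultimately obtain q where q: "q \<le> degree r"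
    and I: "((\<lambda>z. poly (pderiv r) z / poly r z) has_contour_integral
           2 * of_real pi * \<i> * of_nat q) (circlepath 0 1)"
    using Suc.hyps r0 by auto
  obtain e where e: "e \<le> (1::nat)" and Ia: "((\<lambda>z. 1 / (z - a)) has_contour_integral
           2 * of_real pi * \<i> * of_nat e) (circlepath 0 1)"
  proof (cases "cmod a < 1")
    case True
    have "((\<lambda>u. 1 / (u - a)) has_contour_integral (2 * of_real pi * \<i> * 1)) (circlepath 0 1)"
      by (rule Cauchy_integral_circlepath_simple[of "\<lambda>_. 1"]) (use True in auto)
    then show ?thesis using that[of 1] by simp
  next
    case False
    have "((\<lambda>u. 1 / (u - a)) has_contour_integral 0) (circlepath 0 1)"
      by (rule Cauchy_theorem_convex_simple[of _ "ball 0 (cmod a)"])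
         (use False a1 in \<open>auto intro!: holomorphic_intros\<close>)
    then show ?thesis using that[of 0] by simp
  qed
  have "((\<lambda>z. poly (pderiv p) z / poly p z) has_contour_integral
      2 * of_real pi * \<i> * of_nat e + 2 * of_real pi * \<i> * of_nat q) (circlepath 0 1)"
    using has_contour_integral_add[OF Ia I]
  proof (rule has_contour_integral_eq)
    fix x assume "x \<in> path_image (circlepath 0 1)"
    then have "poly p x \<noteq> 0" using Suc.prems by auto
    then have "x - a \<noteq> 0" "poly r x \<noteq> 0" by (auto simp: p)
    moreover have pd: "poly (pderiv p) x = poly r x + (x - a) * poly (pderiv r) x"
      unfolding p by (subst pderiv_mult) (simp add: pderiv_pCons algebra_simps)
    moreover have pp: "poly p x = (x - a) * poly r x" by (simp add: p algebra_simps)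
    ultimately show "1 / (x - a) + poly (pderiv r) x / poly r x = poly (pderiv p) x / poly p x"
      unfolding pd pp by (simp add: add_divide_distrib)
  qed
  moreover have "2 * of_real pi * \<i> * of_nat e + 2 * of_real pi * \<i> * of_nat q
      = 2 * of_real pi * \<i> * of_nat (e + q)" by (simp add: algebra_simps)
  moreover have "e + q \<le> degree p" using e q \<open>degree p = Suc (degree r)\<close> by simp
  ultimately show ?case by metis
qed

section \<open>The direction of a circle point seen from inside the disc\<close>

text \<open>A branch of the argument of \<open>cis \<phi> - z\<close> that is continuous for all
  real \<open>\<phi>\<close> when \<open>cmod z < 1\<close>: factoring out \<open>cis \<phi>\<close>
  leaves a number in the right half plane, away from the cut of \<open>Ln\<close>.\<close>

definition arg_from :: "complex \<Rightarrow> real \<Rightarrow> real" where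
  "arg_from z \<phi> = \<phi> + Im (Ln (1 - z * cis (- \<phi>)))"

lemma cis_diff_arg_from:
  assumes "cmod z < 1"
  shows "cis \<phi> - z = of_real (cmod (cis \<phi> - z)) * cis (arg_from z \<phi>)"
proof -
  have "cmod (z * cis (-\<phi>)) < 1" using assms by (simp add: norm_mult)
  then have nz: "1 - z * cis (- \<phi>) \<noteq> 0" by auto
  have e: "cis \<phi> - z = cis \<phi> * (1 - z * cis (- \<phi>))"
    by (simp add: algebra_simps cis_mult)
  have "1 - z * cis (- \<phi>) = exp (Ln (1 - z * cis (- \<phi>)))" using nz by simp
  also have "\<dots> = of_real (cmod (1 - z * cis (- \<phi>))) * cis (Im (Ln (1 - z * cis (- \<phi>))))"
    using nz by (subst exp_eq_polar) simp
  finally have "1 - z * cis (- \<phi>) = of_real (cmod (1 - z * cis (- \<phi>))) * cis (Im (Ln (1 - z * cis (- \<phi>))))" .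
  moreover have "cmod (cis \<phi> - z) = cmod (1 - z * cis (- \<phi>))"
    by (subst e) (simp add: norm_mult)
  ultimately show ?thesis unfolding arg_from_def cis_mult[symmetric] using e
    by (metis mult.left_commute)
qed

text \<open>With \<open>w = z * cis (- \<phi>)\<close> the derivative is
  \<open>Re (inverse (1 - w))\<close>, which is positive because \<open>1 - w\<close> lies in the
  right half plane.\<close>

lemma strict_mono_arg_from:
  assumes "cmod z < 1"
  shows "strict_mono (arg_from z)"
proof -
  have "\<exists>y. (arg_from z has_real_derivative y) (at \<phi>) \<and> y > 0" for \<phi>
  proof -
    define w where "w = z * cis (- \<phi>)"
    have w: "cmod w < 1" using assms by (simp add: w_def norm_mult)
    then have re: "0 < Re (1 - w)" using complex_Re_le_cmod[of w] by simp
    then have nr: "1 - w \<notin> \<real>\<^sub>\<le>\<^sub>0" using complex_nonpos_Reals_iff by auto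
    have "((\<lambda>x. cis (- x)) has_vector_derivative (- \<i> * cis (- \<phi>))) (at \<phi>)"
      unfolding has_vector_derivative_def
      by (auto intro!: derivative_eq_intros simp: fun_eq_iff scaleR_conv_of_real)
    then have "((\<lambda>x. 1 - z * cis (- x)) has_vector_derivative (\<i> * w)) (at \<phi>)"
      by (auto intro!: derivative_eq_intros simp: w_def)
    moreover have "(Ln has_field_derivative inverse (1 - w)) (at (1 - z * cis (- \<phi>)))"
      using nr by (auto intro!: derivative_eq_intros simp: w_def)
    ultimately have "((Ln \<circ> (\<lambda>x. 1 - z * cis (- x))) has_vector_derivative (\<i> * w * inverse (1 - w))) (at \<phi>)"
      by (rule field_vector_diff_chain_at)
    then have "((\<lambda>x. Im ((Ln \<circ> (\<lambda>x. 1 - z * cis (- x))) x)) has_vector_derivative Im (\<i> * w * inverse (1 - w))) (at \<phi>)"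
      by (rule bounded_linear.has_vector_derivative[OF bounded_linear_Im])
    then have "((\<lambda>x. x + Im (Ln (1 - z * cis (- x)))) has_real_derivative (1 + Im (\<i> * w * inverse (1 - w)))) (at \<phi>)"
      by (auto intro!: derivative_eq_intros simp: has_real_derivative_iff_has_vector_derivative)
    moreover have "1 + Im (\<i> * w * inverse (1 - w)) = Re (inverse (1 - w))"
    proof -
      have "1 - w \<noteq> 0" using re by auto
      then have "1 + w * inverse (1 - w) = inverse (1 - w)" by (simp add: field_simps)
      from arg_cong[OF this, of Re] show ?thesis by simp
    qed
    moreover have "Re (inverse (1 - w)) > 0"
      using re by (auto simp: Re_divide inverse_complex.simps intro!: divide_pos_pos add_pos_nonneg)
    ultimately show ?thesis unfolding arg_from_def[abs_def] by auto
  qed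
  then show ?thesis unfolding strict_mono_def by (metis DERIV_pos_imp_increasing)
qed

lemma arg_from_period: "arg_from z pi = arg_from z (- pi) + 2 * pi"
proof -
  have "cis (- pi) = - 1" by (simp add: complex_eq_iff)
  then show ?thesis by (simp add: arg_from_def)
qed

text \<open>The intervals are numbered from right to left, so \<open>p m\<close> is the leftmost and
  \<open>q 1\<close> the rightmost endpoint; the increments skipped between them are
  positive.\<close>

lemma sum_increments_bounds:
  fixes A :: "real \<Rightarrow> real" and m :: nat
  assumes A: "strict_mono A" and m: "m \<ge> 1"
    and pq: "\<And>k. k \<in> {1..m} \<Longrightarrow> p k < q k" and qp: "\<And>k. k \<in> {1..<m} \<Longrightarrow> q (k + 1) < p k"
  shows "0 < (\<Sum>k=1..m. A (q k) - A (p k))" "(\<Sum>k=1..m. A (q k) - A (p k)) \<le> A (q 1) - A (p m)"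
proof -
  show "0 < (\<Sum>k=1..m. A (q k) - A (p k))"
    using m pq A by (intro sum_pos) (auto simp: strict_mono_def)
  show "(\<Sum>k=1..m. A (q k) - A (p k)) \<le> A (q 1) - A (p m)"
    using m pq qp
  proof (induction m rule: nat_induct_at_least)
    case base
    then show ?case by simp
  next
    case (Suc m)
    have "(\<Sum>k=1..Suc m. A (q k) - A (p k)) = (\<Sum>k=1..m. A (q k) - A (p k)) + (A (q (Suc m)) - A (p (Suc m)))"
      by simp
    also have "(\<Sum>k=1..m. A (q k) - A (p k)) \<le> A (q 1) - A (p m)"
      using Suc.prems by (intro Suc.IH) auto
    also have "A (q (Suc m)) < A (p m)" using Suc.prems(2)[of m] Suc.hyps A by (auto simp: strict_mono_def)
    finally show ?case by simp
  qed
qed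


section \<open>The rational inner function built from the gaps\<close>

text \<open>Gap \<open>k\<close> of \<open>arccos E\<close> is the open interval from
  \<open>p k\<close> to \<open>q k\<close>. The numbering decreases along the half circle because
  \<open>arccos\<close> reverses the order of the gaps of \<open>E\<close>.\<close>

locale circle_gaps =
  fixes m :: nat and p q :: "nat \<Rightarrow> real"
  assumes m: "m \<ge> 1"
    and pq: "\<And>k. k \<in> {1..m} \<Longrightarrow> p k < q k"
    and qp: "\<And>k. k \<in> {1..<m} \<Longrightarrow> q (k + 1) < p k"
    and p0: "0 < p m" and q_pi: "q 1 < pi"
begin

definition "gap_angle = (\<Sum>k=1..m. q k - p k)"
text \<open>Counterclockwise, the mirror image of gap \<open>k\<close> in the lower half circle
  starts at \<open>- q k\<close> and ends at \<open>- p k\<close>, so each of the two polynomials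
  takes one endpoint from a gap and the opposite one from its mirror image.\<close>

definition "gap_start = (\<Prod>k=1..m. [:- cis (p k), 1:] * [:- cis (- q k), 1:])"
definition "gap_end = (\<Prod>k=1..m. [:- cis (q k), 1:] * [:- cis (- p k), 1:])"

text \<open>Put \<open>Q = gap_start / gap_end\<close>. It maps the circle into the line of real
  multiples of \<open>cis (- gap_angle)\<close>, and \<open>Q 0 = cis (- 2 * gap_angle)\<close>,
  whose reflection in this line is 1. The Moebius map with zero at \<open>Q 0\<close> and pole at 1
  therefore sends the line to a circle about 0; the constants here make its radius 1 and send the
  positive ray to the arc through 1.\<close>

definition "inner_num = smult (cis (- gap_angle)) gap_end - smult (cis gap_angle) gap_start"
definition "inner_den = gap_start - gap_end"
definition "inner_fun z = poly inner_num z / poly inner_den z"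

text \<open>What remains of \<open>gap_start\<close> and \<open>gap_end\<close> on the circle once
  the phases are removed. Both are real, and the sign of their product distinguishes arcs from
  gaps.\<close>

definition "start_factor \<theta> = (\<Prod>k=1..m. - 4 * sin ((\<theta> - p k) / 2) * sin ((\<theta> + q k) / 2))"
definition "end_factor \<theta> = (\<Prod>k=1..m. - 4 * sin ((\<theta> - q k) / 2) * sin ((\<theta> + p k) / 2))"

lemma gap_angle_bounds: "0 < gap_angle" "gap_angle < pi"
proof -
  have "strict_mono (\<lambda>x::real. x)" by (simp add: strict_mono_def)
  from sum_increments_bounds[of "\<lambda>x. x" m p q, OF this m pq qp] show "0 < gap_angle" "gap_angle < pi"
    using p0 q_pi by (auto simp: gap_angle_def)
qed

lemma p_antimono: "1 \<le> i \<Longrightarrow> i \<le> j \<Longrightarrow> j \<le> m \<Longrightarrow> p j \<le> p i"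
  and q_antimono: "1 \<le> i \<Longrightarrow> i \<le> j \<Longrightarrow> j \<le> m \<Longrightarrow> q j \<le> q i"
proof -
  assume i: "1 \<le> i" and ij: "i \<le> j" "j \<le> m"
  show "p j \<le> p i"
    using ij
  proof (induction j rule: dec_induct)
    case base then show ?case by simp
  next
    case (step n)
    then show ?case using qp[of n] pq[of "Suc n"] i by force
  qed
  show "q j \<le> q i"
    using ij
  proof (induction j rule: dec_induct)
    case base then show ?case by simp
  next
    case (step n)
    then show ?case using qp[of n] pq[of n] i by force
  qed
qed

lemma pq_bounds:
  assumes "k \<in> {1..m}" shows "0 < p k" "p k < pi" "0 < q k" "q k < pi"
  using p_antimono[of k m] q_antimono[of 1 k] pq[OF assms] p0 q_pi assms by auto

lemma p_neq_q: assumes "i \<in> {1..m}" "j \<in> {1..m}" shows "p i \<noteq> q j"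
proof (cases i j rule: linorder_cases)
  case less
  then show ?thesis using qp[of i] q_antimono[of "i + 1" j] assms by force
next
  case equal
  then show ?thesis using pq[of i] assms by force
next
  case greater
  then show ?thesis using pq[of i] q_antimono[of j i] assms by force
qed

lemma poly_two_roots: "poly ([:- a, 1:] * [:- b, 1:]) z = (z - a) * (z - b)" for a b z :: complex
  by (simp add: algebra_simps)

lemma poly_gap_start: "poly gap_start z = (\<Prod>k=1..m. (z - cis (p k)) * (z - cis (- q k)))"
  unfolding gap_start_def poly_prod poly_two_roots ..

lemma poly_gap_end: "poly gap_end z = (\<Prod>k=1..m. (z - cis (q k)) * (z - cis (- p k)))"
  unfolding gap_end_def poly_prod poly_two_roots ..

lemma poly_gap_cnj: "poly gap_start (cnj z) = cnj (poly gap_end z)" "poly gap_end (cnj z) = cnj (poly gap_start z)"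
  by (simp_all add: poly_gap_start poly_gap_end mult.commute cis_cnj)

text \<open>Conjugation exchanges starts and ends, which changes the sign of both numerator and
  denominator. This symmetry lets the inner function act on conjugate pairs of points.\<close>

lemma inner_fun_cnj: "inner_fun (cnj z) = cnj (inner_fun z)"
proof -
  have "poly inner_num (cnj z) = - cnj (poly inner_num z)" "poly inner_den (cnj z) = - cnj (poly inner_den z)"
    by (simp_all add: inner_num_def inner_den_def poly_gap_cnj cis_cnj)
  then show ?thesis by (simp add: inner_fun_def)
qed

lemma prod_cis: "finite I \<Longrightarrow> (\<Prod>i\<in>I. cis (f i)) = cis (\<Sum>i\<in>I. f i)"
  by (induction I rule: finite_induct) (simp_all add: cis_mult)

lemma cis_minus_cis: "cis \<theta> - cis \<alpha> = 2 * \<i> * of_real (sin ((\<theta> - \<alpha>) / 2)) * cis ((\<theta> + \<alpha>) / 2)"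
proof -
  have "\<theta> = (\<theta> + \<alpha>) / 2 + (\<theta> - \<alpha>) / 2" "\<alpha> = (\<theta> + \<alpha>) / 2 - (\<theta> - \<alpha>) / 2"
    by (simp_all add: field_simps)
  then have "cis \<theta> - cis \<alpha> = cis ((\<theta> + \<alpha>) / 2 + (\<theta> - \<alpha>) / 2) - cis ((\<theta> + \<alpha>) / 2 - (\<theta> - \<alpha>) / 2)"
    by metis
  also have "\<dots> = 2 * \<i> * of_real (sin ((\<theta> - \<alpha>) / 2)) * cis ((\<theta> + \<alpha>) / 2)"
    by (simp add: complex_eq_iff cos_add sin_add cos_diff sin_diff)
  finally show ?thesis .
qed

lemma gap_start_circle:
  "poly gap_start (cis \<theta>) = cis (- gap_angle) * cis (real m * \<theta> + gap_angle / 2) * of_real (start_factor \<theta>)"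
proof -
  have "(cis \<theta> - cis (p k)) * (cis \<theta> - cis (- q k)) =
      of_real (- 4 * sin ((\<theta> - p k) / 2) * sin ((\<theta> + q k) / 2)) * cis (\<theta> + (p k - q k) / 2)" for k
    unfolding cis_minus_cis by (simp add: algebra_simps cis_mult add_divide_distrib diff_divide_distrib)
  then have "poly gap_start (cis \<theta>) = of_real (start_factor \<theta>) * cis (\<Sum>k=1..m. \<theta> + (p k - q k) / 2)"
    unfolding poly_gap_start start_factor_def of_real_prod prod_cis[OF finite_atLeastAtMost, symmetric] prod.distrib[symmetric]
    by (intro prod.cong refl)
  also have "(\<Sum>k=1..m. \<theta> + (p k - q k) / 2) = - gap_angle + (real m * \<theta> + gap_angle / 2)"
    by (simp add: gap_angle_def sum.distrib sum_subtractf field_simps flip: sum_divide_distrib)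
  finally show ?thesis by (simp add: cis_mult)
qed

lemma gap_end_circle:
  "poly gap_end (cis \<theta>) = cis (real m * \<theta> + gap_angle / 2) * of_real (end_factor \<theta>)"
proof -
  have "(cis \<theta> - cis (q k)) * (cis \<theta> - cis (- p k)) =
      of_real (- 4 * sin ((\<theta> - q k) / 2) * sin ((\<theta> + p k) / 2)) * cis (\<theta> + (q k - p k) / 2)" for k
    unfolding cis_minus_cis by (simp add: algebra_simps cis_mult add_divide_distrib diff_divide_distrib)
  then have "poly gap_end (cis \<theta>) = of_real (end_factor \<theta>) * cis (\<Sum>k=1..m. \<theta> + (q k - p k) / 2)"
    unfolding poly_gap_end end_factor_def of_real_prod prod_cis[OF finite_atLeastAtMost, symmetric] prod.distrib[symmetric]
    by (intro prod.cong refl)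
  also have "(\<Sum>k=1..m. \<theta> + (q k - p k) / 2) = real m * \<theta> + gap_angle / 2"
    by (simp add: gap_angle_def sum.distrib sum_subtractf field_simps flip: sum_divide_distrib)
  finally show ?thesis by (simp add: cis_mult)
qed

lemma factors_not_both_zero:
  assumes "- pi < \<theta>" "\<theta> \<le> pi"
  shows "start_factor \<theta> \<noteq> 0 \<or> end_factor \<theta> \<noteq> 0"
proof (rule ccontr)
  have z: "x = 0" if "sin (x / 2) = 0" "\<bar>x\<bar> < 2 * pi" for x
    using that sin_eq_0_pi[of "x / 2"] by auto
  assume "\<not> ?thesis"
  then obtain i j where ij: "i \<in> {1..m}" "j \<in> {1..m}"
     and i: "sin ((\<theta> - p i) / 2) = 0 \<or> sin ((\<theta> + q i) / 2) = 0"
     and j: "sin ((\<theta> - q j) / 2) = 0 \<or> sin ((\<theta> + p j) / 2) = 0"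
    by (auto simp: start_factor_def end_factor_def)
  have "\<theta> = p i \<or> \<theta> = - q i"
  proof -
    have "\<bar>\<theta> - p i\<bar> < 2 * pi" "\<bar>\<theta> + q i\<bar> < 2 * pi" using assms pq_bounds[OF ij(1)] by linarith+
    then show ?thesis using i z[of "\<theta> - p i"] z[of "\<theta> + q i"] by auto
  qed
  moreover have "\<theta> = q j \<or> \<theta> = - p j"
  proof -
    have "\<bar>\<theta> - q j\<bar> < 2 * pi" "\<bar>\<theta> + p j\<bar> < 2 * pi" using assms pq_bounds[OF ij(2)] by linarith+
    then show ?thesis using j z[of "\<theta> - q j"] z[of "\<theta> + p j"] by auto
  qed
  ultimately show False using p_neq_q[OF ij] p_neq_q[OF ij(2) ij(1)] pq_bounds[OF ij(1)] pq_bounds[OF ij(2)]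
    by auto
qed

lemma inner_circle:
  fixes \<theta> :: real
  defines "a \<equiv> start_factor \<theta>" and "b \<equiv> end_factor \<theta>"
  shows "poly inner_num (cis \<theta>) = cis (real m * \<theta> + gap_angle / 2) * (cis (- gap_angle) * of_real b - of_real a)"
    and "poly inner_den (cis \<theta>) = cis (real m * \<theta> + gap_angle / 2) * (cis (- gap_angle) * of_real a - of_real b)"
proof -
  let ?w = "cis (real m * \<theta> + gap_angle / 2)"
  have "poly inner_num (cis \<theta>) =
      cis (- gap_angle) * (?w * of_real b) - cis gap_angle * (cis (- gap_angle) * ?w * of_real a)"
    by (simp add: inner_num_def gap_start_circle gap_end_circle a_def b_def)
  also have "\<dots> = ?w * (cis (- gap_angle) * of_real b - (cis gap_angle * cis (- gap_angle)) * of_real a)"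
    by (simp add: algebra_simps)
  also have "cis gap_angle * cis (- gap_angle) = 1" by (simp add: cis_mult)
  finally show "poly inner_num (cis \<theta>) = ?w * (cis (- gap_angle) * of_real b - of_real a)" by simp
  show "poly inner_den (cis \<theta>) = cis (real m * \<theta> + gap_angle / 2) * (cis (- gap_angle) * of_real a - of_real b)"
    by (simp add: inner_den_def gap_start_circle gap_end_circle a_def b_def algebra_simps)
qed

lemma circle_point:
  assumes "cmod z = 1" obtains \<theta> where "z = cis \<theta>" "- pi < \<theta>" "\<theta> \<le> pi"
proof
  show "z = cis (Arg z)" using assms by (metis cis_Arg norm_zero sgn_div_norm complex_sgn_def div_by_1 zero_neq_one inverse_1 scaleR_one)
qed (use Arg_bounded[of z] in auto)

lemma inner_den_circle: assumes "cmod z = 1" shows "poly inner_den z \<noteq> 0"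
proof -
  obtain \<theta> where \<theta>: "z = cis \<theta>" "- pi < \<theta>" "\<theta> \<le> pi" using circle_point[OF assms] .
  show ?thesis
  proof
    assume "poly inner_den z = 0"
    then have e: "cis (- gap_angle) * of_real (start_factor \<theta>) - of_real (end_factor \<theta>) = 0"
      unfolding \<theta>(1) inner_circle by simp
    from arg_cong[OF e, of Im] have "sin gap_angle * start_factor \<theta> = 0" by simp
    moreover have "sin gap_angle > 0" using gap_angle_bounds by (intro sin_gt_zero) auto
    ultimately have "start_factor \<theta> = 0" by simp
    with e have "end_factor \<theta> = 0" by simp
    with \<open>start_factor \<theta> = 0\<close> factors_not_both_zero[OF \<theta>(2,3)] show False by simp
  qed
qed

lemma inner_num_den_norm: assumes "cmod z = 1" shows "cmod (poly inner_num z) = cmod (poly inner_den z)"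
proof -
  obtain \<theta> where \<theta>: "z = cis \<theta>" using circle_point[OF assms] by metis
  show ?thesis unfolding \<theta> inner_circle norm_mult
    by (simp add: cmod_def power2_eq_square algebra_simps)
       (simp add: algebra_simps flip: distrib_left power2_eq_square)
qed

lemma norm_inner_fun_circle: "cmod z = 1 \<Longrightarrow> cmod (inner_fun z) = 1"
  using inner_num_den_norm[of z] inner_den_circle[of z] by (simp add: inner_fun_def norm_divide)


text \<open>Off the gaps \<open>a\<close> and \<open>b\<close> do not have opposite signs, and
  \<open>Re (inner_fun (cis \<theta>)) + cos gap_angle\<close> equals
  \<open>2 * a * b * (1 - cos gap_angle ^ 2)\<close> divided by the squared modulus of
  \<open>D\<close>.\<close>

lemma Re_inner_fun_circle:
  assumes \<theta>: "0 \<le> \<theta>" "\<theta> \<le> pi" and F: "\<And>k. k \<in> {1..m} \<Longrightarrow> \<theta> \<le> p k \<or> q k \<le> \<theta>"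
  shows "- cos gap_angle \<le> Re (inner_fun (cis \<theta>))"
proof -
  define a where "a = start_factor \<theta>"
  define b where "b = end_factor \<theta>"
  define N where "N = cis (- gap_angle) * of_real b - of_real a"
  define D where "D = cis (- gap_angle) * of_real a - of_real b"
  have "0 \<le> a * b"
  proof -
    have "0 \<le> (- 4 * sin ((\<theta> - p k) / 2) * sin ((\<theta> + q k) / 2)) * (- 4 * sin ((\<theta> - q k) / 2) * sin ((\<theta> + p k) / 2))"
      if k: "k \<in> {1..m}" for k
    proof -
      note b = pq_bounds[OF k]
      have 1: "0 \<le> sin ((\<theta> + q k) / 2)" "0 \<le> sin ((\<theta> + p k) / 2)"
        using b \<theta> by (auto intro!: sin_ge_zero)
      have 2: "0 \<le> sin ((\<theta> - p k) / 2) * sin ((\<theta> - q k) / 2)"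
        using F[OF k]
      proof
        assume "\<theta> \<le> p k"
        then have "0 \<le> sin ((p k - \<theta>) / 2)" "0 \<le> sin ((q k - \<theta>) / 2)"
          using b \<theta> pq[OF k] by (auto intro!: sin_ge_zero)
        then have "0 \<le> sin ((p k - \<theta>) / 2) * sin ((q k - \<theta>) / 2)" by simp
        also have "\<dots> = sin (- ((p k - \<theta>) / 2)) * sin (- ((q k - \<theta>) / 2))" by simp
        finally show ?thesis by (simp add: minus_divide_left del: sin_minus)
      next
        assume "q k \<le> \<theta>"
        then show ?thesis
          using b \<theta> pq[OF k] by (auto intro!: mult_nonneg_nonneg sin_ge_zero)
      qed
      have "0 \<le> 16 * ((sin ((\<theta> - p k) / 2) * sin ((\<theta> - q k) / 2)) * (sin ((\<theta> + q k) / 2) * sin ((\<theta> + p k) / 2)))"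
        using 1 2 by simp
      then show ?thesis by (simp add: algebra_simps)
    qed
    then show ?thesis unfolding a_def b_def start_factor_def end_factor_def prod.distrib[symmetric]
      by (intro prod_nonneg) auto
  qed
  have f: "inner_fun (cis \<theta>) = N / D"
    unfolding inner_fun_def inner_circle N_def D_def a_def b_def by simp
  have "D \<noteq> 0" using inner_den_circle[of "cis \<theta>"] unfolding inner_circle D_def a_def b_def by auto
  then have D0: "0 < (cmod D)\<^sup>2" by simp
  have d2: "(cmod D)\<^sup>2 = a\<^sup>2 + b\<^sup>2 - 2 * a * b * cos gap_angle"
  proof -
    have "(a * c - b)\<^sup>2 + (a * s)\<^sup>2 = a\<^sup>2 * (c\<^sup>2 + s\<^sup>2) + b\<^sup>2 - 2 * a * b * c" for c s
      by (simp add: power2_eq_square algebra_simps)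
    from this[of "cos gap_angle" "sin gap_angle"] show ?thesis
      unfolding cmod_power2 by (simp add: D_def mult.commute)
  qed
  have nd: "Re (N * cnj D) = 2 * a * b - (a\<^sup>2 + b\<^sup>2) * cos gap_angle"
  proof -
    have "Re (N * cnj D) = a * b * ((cos gap_angle)\<^sup>2 + (sin gap_angle)\<^sup>2) + a * b - (a\<^sup>2 + b\<^sup>2) * cos gap_angle"
      by (simp add: N_def D_def power2_eq_square algebra_simps)
    then show ?thesis by simp
  qed
  have "Re (inner_fun (cis \<theta>)) + cos gap_angle = (Re (N * cnj D) + cos gap_angle * (cmod D)\<^sup>2) / (cmod D)\<^sup>2"
  proof -
    have "N / D = N * cnj D / of_real ((cmod D)\<^sup>2)" by (subst complex_div_cnj) simp
    then have "Re (inner_fun (cis \<theta>)) = Re (N * cnj D) / (cmod D)\<^sup>2"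
      unfolding f by (simp only: Re_divide_of_real)
    then show ?thesis using D0 by (simp add: add_divide_distrib)
  qed
  also have "Re (N * cnj D) + cos gap_angle * (cmod D)\<^sup>2 = 2 * (a * b) * (1 - (cos gap_angle)\<^sup>2)"
  proof -
    have "2 * a * b - (a\<^sup>2 + b\<^sup>2) * c + c * (a\<^sup>2 + b\<^sup>2 - 2 * a * b * c) = 2 * (a * b) * (1 - c\<^sup>2)" for c
      by (simp add: power2_eq_square algebra_simps)
    then show ?thesis unfolding d2 nd .
  qed
  also have "0 \<le> \<dots> / (cmod D)\<^sup>2"
    using \<open>0 \<le> a * b\<close> by (auto intro!: divide_nonneg_nonneg mult_nonneg_nonneg simp: abs_square_le_1)
  finally show ?thesis by simp
qed

text \<open>On the unit disc the argument of \<open>gap_start / gap_end\<close> is minus the total increment of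
  the increasing function \<open>arg_from z\<close> over the disjoint gaps, so it lies strictly
  between \<open>- 2 * pi\<close> and \<open>0\<close> and the quotient cannot be 1.\<close>

lemma inner_den_disc:
  assumes z: "cmod z < 1" shows "poly inner_den z \<noteq> 0"
proof
  assume "poly inner_den z = 0"
  then have eq: "poly gap_start z = poly gap_end z" by (simp add: inner_den_def)
  define A where "A = arg_from z"
  have A: "strict_mono A" unfolding A_def by (rule strict_mono_arg_from[OF z])
  \<comment> \<open>The reflected function is again increasing and measures the mirrored gaps as
    increments over the original ones, so one estimate serves both halves of the circle.\<close>
  define A' where "A' x = - A (- x)" for x
  have A': "strict_mono A'" using A by (auto simp: strict_mono_def A'_def)
  have polar: "(z - cis \<alpha>) * (z - cis \<beta>) =
     of_real (cmod ((z - cis \<alpha>) * (z - cis \<beta>))) * cis (A \<alpha> + A \<beta>)" for \<alpha> \<beta>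
  proof -
    have "(z - cis \<alpha>) * (z - cis \<beta>) = (cis \<alpha> - z) * (cis \<beta> - z)" by (simp add: algebra_simps)
    also have "\<dots> = (of_real (cmod (cis \<alpha> - z)) * cis (A \<alpha>)) * (of_real (cmod (cis \<beta> - z)) * cis (A \<beta>))"
      unfolding A_def using cis_diff_arg_from[OF z, symmetric] by simp
    also have "\<dots> = of_real (cmod ((z - cis \<alpha>) * (z - cis \<beta>))) * cis (A \<alpha> + A \<beta>)"
      by (simp add: cis_mult[symmetric] norm_mult norm_minus_commute mult_ac)
    finally show ?thesis .
  qed
  have s: "poly gap_start z = of_real (cmod (poly gap_start z)) * cis (\<Sum>k=1..m. A (p k) + A (- q k))"
    unfolding poly_gap_start prod_norm[symmetric] of_real_prod prod_cis[OF finite_atLeastAtMost, symmetric] prod.distrib[symmetric]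
    by (intro prod.cong refl polar)
  have e: "poly gap_end z = of_real (cmod (poly gap_end z)) * cis (\<Sum>k=1..m. A (q k) + A (- p k))"
    unfolding poly_gap_end prod_norm[symmetric] of_real_prod prod_cis[OF finite_atLeastAtMost, symmetric] prod.distrib[symmetric]
    by (intro prod.cong refl polar)
  have "z \<noteq> cis \<alpha>" for \<alpha> using z by auto
  then have nz: "poly gap_start z \<noteq> 0" by (simp add: poly_gap_start)
  have "cis (\<Sum>k=1..m. A (p k) + A (- q k)) = cis (\<Sum>k=1..m. A (q k) + A (- p k))"
    using s e nz unfolding eq by (metis mult_cancel_left of_real_eq_0_iff norm_eq_zero)
  then have "cis ((\<Sum>k=1..m. A (q k) + A (- p k)) - (\<Sum>k=1..m. A (p k) + A (- q k))) = 1"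
    by (metis cis_divide divide_self cis_neq_zero)
  then have c1: "cos ((\<Sum>k=1..m. A (q k) + A (- p k)) - (\<Sum>k=1..m. A (p k) + A (- q k))) = 1"
    by (metis cis.sel(1) one_complex.sel(1))
  define T where "T = (\<Sum>k=1..m. A (q k) + A (- p k)) - (\<Sum>k=1..m. A (p k) + A (- q k))"
  have "T = (\<Sum>k=1..m. A (q k) - A (p k)) + (\<Sum>k=1..m. A' (q k) - A' (p k))"
    by (simp add: T_def A'_def sum.distrib sum_subtractf)
  moreover have "(\<Sum>k=1..m. A (q k) - A (p k)) \<le> A (q 1) - A (p m)" "0 < (\<Sum>k=1..m. A (q k) - A (p k))"
    using sum_increments_bounds[of A m p q, OF A m pq qp] by auto
  moreover have "(\<Sum>k=1..m. A' (q k) - A' (p k)) \<le> A' (q 1) - A' (p m)" "0 < (\<Sum>k=1..m. A' (q k) - A' (p k))"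
    using sum_increments_bounds[of A' m p q, OF A' m pq qp] by auto
  moreover have "A (q 1) < A pi" "A 0 < A (p m)" "A' (q 1) < A' pi" "A' 0 < A' (p m)"
    using A A' p0 q_pi by (auto simp: strict_mono_def)
  \<comment> \<open>The two half circles together form one full turn of \<open>arg_from z\<close>;
    the strict inequalities at 0 and \<open>pi\<close> keep \<open>T\<close> strictly below
    it.\<close>
  moreover have "A pi + A' pi = 2 * pi" "A 0 + A' 0 = 0"
    using arg_from_period[of z] by (auto simp: A_def A'_def)
  ultimately have T: "0 < T" "T < 2 * pi" by linarith+
  obtain j :: int where "T = of_int j * (2 * pi)"
    using c1 unfolding T_def[symmetric] cos_one_2pi_int by (auto simp: mult.assoc)
  then have "0 < of_int j * (2 * pi)" "of_int j * (2 * pi) < 1 * (2 * pi)" using T by simp_all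
  then have "0 < (of_int j :: real)" "(of_int j :: real) < 1"
    using pi_gt_zero by (auto simp: zero_less_mult_iff)
  then show False by simp
qed

lemma inner_fun_0: "inner_fun 0 = 0"
proof -
  have "poly gap_start 0 = (\<Prod>k=1..m. cis (p k - q k))" "poly gap_end 0 = (\<Prod>k=1..m. cis (q k - p k))"
    by (simp_all add: poly_gap_start poly_gap_end cis_mult)
  then have "poly gap_start 0 = cis (- gap_angle)" "poly gap_end 0 = cis gap_angle"
    by (simp_all add: prod_cis gap_angle_def flip: sum_negf)
  then show ?thesis by (simp add: inner_fun_def inner_num_def cis_mult)
qed

lemma degree_gap: "degree gap_start \<le> 2 * m" "degree gap_end \<le> 2 * m"
proof -
  have deg: "degree (\<Prod>k=1..m. [:- f k, 1:] * [:- g k, 1:]) \<le> 2 * m" for f g :: "nat \<Rightarrow> complex"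
  proof -
    have "degree (\<Prod>k=1..m. [:- f k, 1:] * [:- g k, 1:]) \<le> (\<Sum>k=1..m. degree ([:- f k, 1:] * [:- g k, 1:]))"
      using degree_prod_sum_le[of "{1..m}" "\<lambda>k. [:- f k, 1:] * [:- g k, 1:]"] by (simp add: o_def)
    also have "\<dots> \<le> (\<Sum>k=1..m. 2)" by (intro sum_mono) (simp add: degree_pCons_le)
    finally show ?thesis by simp
  qed
  show "degree gap_start \<le> 2 * m" "degree gap_end \<le> 2 * m"
    unfolding gap_start_def gap_end_def by (rule deg)+
qed

lemma inner_fun_extension:
  obtains R w where "1 < R" "inner_fun holomorphic_on ball 0 R" "w \<le> 2 * m"
    "contour_integral (circlepath 0 1) (\<lambda>z. deriv inner_fun z / inner_fun z) = 2 * of_real pi * \<i> * of_nat w"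
proof -
  have den: "poly inner_den z \<noteq> 0" if "cmod z \<le> 1" for z
    using inner_den_disc inner_den_circle that by (cases "cmod z = 1") auto
  have num: "poly inner_num z \<noteq> 0" if "cmod z = 1" for z
    using inner_num_den_norm[OF that] den[of z] that by auto
  have den0: "inner_den \<noteq> 0" using den[of 0] by auto
  have num0: "inner_num \<noteq> 0" using num[of 1] by auto
  \<comment> \<open>The least modulus of a pole; the extra element 2 keeps the set nonempty if there
    are no poles.\<close>
  define R where "R = Min (insert 2 (cmod ` {z. poly inner_den z = 0}))"
  have fin: "finite (insert 2 (cmod ` {z. poly inner_den z = 0}))"
    using poly_roots_finite[OF den0] by simp
  have R1: "1 < R" unfolding R_def using fin den by (subst Min_gr_iff) (auto simp: not_le[symmetric])
  have denR: "poly inner_den z \<noteq> 0" if "z \<in> ball 0 R" for z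
  proof
    assume "poly inner_den z = 0"
    then have "R \<le> cmod z" unfolding R_def using fin by (intro Min_le) auto
    then show False using that by simp
  qed
  have hol: "inner_fun holomorphic_on ball 0 R"
    unfolding inner_fun_def[abs_def] by (intro holomorphic_intros denR)
  have "degree inner_num \<le> 2 * m"
    unfolding inner_num_def using degree_gap by (intro degree_diff_le order_trans[OF degree_smult_le])
  then obtain w where w: "w \<le> 2 * m" and In: "((\<lambda>z. poly (pderiv inner_num) z / poly inner_num z) has_contour_integral
           2 * of_real pi * \<i> * of_nat w) (circlepath 0 1)"
    using poly_log_deriv_circle[OF num0 num] by (meson order_trans)
  have Id: "((\<lambda>z. poly (pderiv inner_den) z / poly inner_den z) has_contour_integral 0) (circlepath 0 1)"
    by (rule Cauchy_theorem_convex_simple[of _ "ball 0 R"])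
       (use R1 denR in \<open>auto intro!: holomorphic_intros\<close>)
  have "((\<lambda>z. deriv inner_fun z / inner_fun z) has_contour_integral
      2 * of_real pi * \<i> * of_nat w - 0) (circlepath 0 1)"
    using has_contour_integral_diff[OF In Id]
  proof (rule has_contour_integral_eq)
    fix x assume "x \<in> path_image (circlepath 0 1)"
    then have nz: "poly inner_num x \<noteq> 0" "poly inner_den x \<noteq> 0" using num den by auto
    have "(inner_fun has_field_derivative (poly (pderiv inner_num) x * poly inner_den x - poly inner_num x * poly (pderiv inner_den) x)
        / (poly inner_den x * poly inner_den x)) (at x)"
      unfolding inner_fun_def[abs_def] by (auto intro!: derivative_eq_intros nz)
    note d = DERIV_imp_deriv[OF this]
    show "poly (pderiv inner_num) x / poly inner_num x - poly (pderiv inner_den) x / poly inner_den x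
       = deriv inner_fun x / inner_fun x"
      unfolding d unfolding inner_fun_def using nz by (simp add: field_simps)
  qed
  then show ?thesis using that[OF R1 hol w] contour_integral_unique by fastforce
qed

end

subsection \<open>Energy of points on the arcs\<close>

text \<open>The kernels for \<open>v\<close> and for \<open>cnj v\<close> combined. On the unit
  circle this becomes twice the distance of real parts, the link between energies on the circle and
  on the real line.\<close>

definition sym_dist :: "complex \<Rightarrow> complex \<Rightarrow> real" where
  "sym_dist w v = cmod (1 - w * cnj v) * cmod (1 - w * v)"

lemma sym_dist_circle:
  assumes "cmod u = 1" "cmod v = 1"
  shows "sym_dist u v = 2 * \<bar>Re u - Re v\<bar>"
proof -
  have c: "x * cnj x = 1" if "cmod x = 1" for x :: complex
    using that by (metis complex_norm_square of_real_1 one_power2)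
  have "cmod (1 - u * cnj v) = cmod (v - u)"
    using assms c[OF assms(2)]
    by (metis mult.left_commute mult.right_neutral norm_mult norm_one mult_1 right_diff_distrib mult.commute)
  moreover have "cmod (1 - u * v) = cmod (cnj v - u)"
    using assms c[OF assms(2)]
    by (metis complex_mod_cnj mult.left_commute mult.right_neutral norm_mult mult_1 right_diff_distrib mult.commute)
  ultimately have "sym_dist u v = cmod ((v - u) * (cnj v - u))"
    by (simp add: sym_dist_def norm_mult)
  also have "(v - u) * (cnj v - u) = u * (of_real (2 * (Re u - Re v)))"
  proof -
    have "(v - u) * (cnj v - u) = v * cnj v - u * (v + cnj v) + u * u" by (simp add: algebra_simps)
    also have "\<dots> = u * cnj u - u * (v + cnj v) + u * u" using c assms by simp
    also have "\<dots> = u * ((u + cnj u) - (v + cnj v))" by (simp add: algebra_simps)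
    finally show ?thesis by (simp add: complex_add_cnj)
  qed
  finally show ?thesis using assms by (simp only: norm_mult norm_of_real abs_mult mult_1_left abs_numeral)
qed

lemma sym_dist_ge: "cmod w \<le> r \<Longrightarrow> cmod v \<le> r \<Longrightarrow> r < 1 \<Longrightarrow> (1 - r\<^sup>2)\<^sup>2 \<le> sym_dist w v"
proof -
  assume a: "cmod w \<le> r" "cmod v \<le> r" "r < 1"
  have r: "0 \<le> r" using a(1) norm_ge_zero order_trans by blast
  have "cmod w * cmod v \<le> r\<^sup>2" unfolding power2_eq_square using a r by (intro mult_mono) auto
  then have 1: "1 - r\<^sup>2 \<le> cmod (1 - w * cnj v)" "1 - r\<^sup>2 \<le> cmod (1 - w * v)"
    using norm_triangle_ineq2[of 1 "w * cnj v"] norm_triangle_ineq2[of 1 "w * v"] by (auto simp: norm_mult)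
  have "r\<^sup>2 \<le> 1" using r a by (simp add: power_le_one)
  then show ?thesis unfolding sym_dist_def power2_eq_square[of "1 - r\<^sup>2"] using 1 by (intro mult_mono) auto
qed

lemma sym_dist_pos: "cmod w < 1 \<Longrightarrow> cmod v < 1 \<Longrightarrow> 0 < sym_dist w v"
proof -
  assume a: "cmod w < 1" "cmod v < 1"
  define r where "r = max (cmod w) (cmod v)"
  have r: "r < 1" "0 \<le> r" using a by (auto simp: r_def le_max_iff_disj)
  then have "r\<^sup>2 < 1" by (simp add: power_less_one_iff)
  then have "0 < (1 - r\<^sup>2)\<^sup>2" by simp
  also have "\<dots> \<le> sym_dist w v" by (rule sym_dist_ge) (use r in \<open>auto simp: r_def\<close>)
  finally show ?thesis .
qed

text \<open>For unimodular \<open>x\<close> the squares of \<open>cmod (1 - r ^ 2 * x)\<close> and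
  \<open>r * cmod (1 - x)\<close> differ by \<open>(1 - r ^ 2) ^ 2\<close>, whatever
  \<open>x\<close> is. Pulling points inwards thus shrinks distances at most by the factor
  \<open>r ^ 2\<close>.\<close>

lemma sym_dist_scale:
  assumes "cmod u = 1" "cmod v = 1" "0 < r"
  shows "r\<^sup>2 * sym_dist u v \<le> sym_dist (of_real r * u) (of_real r * v)"
proof -
  have *: "r * cmod (1 - x) \<le> cmod (1 - of_real (r\<^sup>2) * x)" if "cmod x = 1" for x
  proof -
    have x2: "(Re x)\<^sup>2 + (Im x)\<^sup>2 = 1" using that by (metis cmod_power2 one_power2)
    have "(r * cmod (1 - x))\<^sup>2 = r\<^sup>2 * (1 - 2 * Re x + ((Re x)\<^sup>2 + (Im x)\<^sup>2))"
      unfolding power_mult_distrib cmod_power2 by (simp add: power2_eq_square algebra_simps)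
    also have "\<dots> \<le> 1 - 2 * r\<^sup>2 * Re x + (r\<^sup>2)\<^sup>2 * ((Re x)\<^sup>2 + (Im x)\<^sup>2)"
      unfolding x2 using zero_le_power2[of "1 - r\<^sup>2"] by (simp add: power2_eq_square algebra_simps)
    also have "\<dots> = (cmod (1 - of_real (r\<^sup>2) * x))\<^sup>2"
      unfolding cmod_power2 by (simp add: power2_eq_square algebra_simps)
    finally show ?thesis by (rule power2_le_imp_le) simp
  qed
  have "r\<^sup>2 * sym_dist u v = (r * cmod (1 - u * cnj v)) * (r * cmod (1 - u * v))"
    by (simp add: sym_dist_def power2_eq_square)
  also have "\<dots> \<le> cmod (1 - of_real (r\<^sup>2) * (u * cnj v)) * cmod (1 - of_real (r\<^sup>2) * (u * v))"
    using assms by (intro mult_mono *) (auto simp: norm_mult)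
  also have "\<dots> = sym_dist (of_real r * u) (of_real r * v)"
    by (simp add: sym_dist_def power2_eq_square mult_ac)
  finally show ?thesis .
qed

lemma sym_dist_lipschitz:
  assumes "cmod w \<le> 1" "cmod v \<le> 1" "cmod w' \<le> 1" "cmod v' \<le> 1" "cmod (w - w') \<le> e" "cmod (v - v') \<le> e"
  shows "sym_dist w v \<le> sym_dist w' v' + 8 * e"
proof -
  have e: "0 \<le> e" using assms(5) norm_ge_zero order_trans by blast
  have *: "cmod (1 - x * y) \<le> cmod (1 - x' * y') + 2 * e" "cmod (1 - x * y) \<le> 2"
    if "cmod x \<le> 1" "cmod y \<le> 1" "cmod x' \<le> 1" "cmod y' \<le> 1" "cmod (x - x') \<le> e" "cmod (y - y') \<le> e" for x y x' y'
  proof -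
    have "cmod ((1 - x * y) - (1 - x' * y')) = cmod ((x' - x) * y' + x * (y' - y))" by (simp add: algebra_simps)
    also have "\<dots> \<le> cmod (x' - x) * cmod y' + cmod x * cmod (y' - y)" by (metis norm_mult norm_triangle_ineq)
    also have "\<dots> \<le> e * 1 + 1 * e" using that e by (intro add_mono mult_mono) (auto simp: norm_minus_commute)
    finally show "cmod (1 - x * y) \<le> cmod (1 - x' * y') + 2 * e"
      using norm_triangle_ineq2[of "1 - x * y" "1 - x' * y'"] by simp
    have "cmod (x * y) \<le> 1 * 1" unfolding norm_mult using that by (intro mult_mono) auto
    then show "cmod (1 - x * y) \<le> 2" using norm_triangle_ineq4[of 1 "x * y"] by simp
  qed
  have c: "cmod (cnj v - cnj v') = cmod (v - v')" by (metis complex_cnj_diff complex_mod_cnj)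
  have 1: "cmod (1 - w * cnj v) \<le> cmod (1 - w' * cnj v') + 2 * e" "cmod (1 - w * v) \<le> cmod (1 - w' * v') + 2 * e"
    "cmod (1 - w * v) \<le> 2" "cmod (1 - w' * cnj v') \<le> 2"
    using *[of w "cnj v" w' "cnj v'"] *[of w v w' v'] *(2)[of w' "cnj v'" w' "cnj v'"] assms c e by auto
  have "sym_dist w v \<le> (cmod (1 - w' * cnj v') + 2 * e) * cmod (1 - w * v)"
    unfolding sym_dist_def by (intro mult_right_mono 1) auto
  also have "\<dots> = cmod (1 - w' * cnj v') * cmod (1 - w * v) + 2 * e * cmod (1 - w * v)" by (simp add: algebra_simps)
  also have "\<dots> \<le> cmod (1 - w' * cnj v') * (cmod (1 - w' * v') + 2 * e) + 2 * e * 2"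
    by (intro add_mono mult_left_mono 1) (use e in auto)
  also have "\<dots> = sym_dist w' v' + 2 * e * cmod (1 - w' * cnj v') + 2 * e * 2" by (simp add: sym_dist_def algebra_simps)
  also have "\<dots> \<le> sym_dist w' v' + 2 * e * 2 + 2 * e * 2"
    by (intro add_mono mult_left_mono order_refl 1) (use e in auto)
  finally show ?thesis by simp
qed

text \<open>An indexed family instead of a set, so that a real point is counted twice like any other
  pair.\<close>

definition conj_pair :: "(nat \<Rightarrow> complex) \<Rightarrow> nat \<times> bool \<Rightarrow> complex" where
  "conj_pair w = (\<lambda>(i, s). if s then w i else cnj (w i))"

lemma sym_energy_conj_pair:
  fixes w :: "nat \<Rightarrow> complex"
  assumes w: "\<forall>i<N. cmod (w i) < 1"
  shows "(\<Sum>x\<in>{..<N} \<times> UNIV. \<Sum>y\<in>{..<N} \<times> UNIV. - ln (cmod (1 - conj_pair w x * cnj (conj_pair w y))))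
     = 2 * (\<Sum>i<N. \<Sum>j<N. - ln (sym_dist (w i) (w j)))"
proof -
  have c: "cmod (1 - cnj a * b) = cmod (1 - a * cnj b)" "cmod (1 - cnj a * cnj b) = cmod (1 - a * b)" for a b
    by (metis complex_cnj_cnj complex_cnj_diff complex_cnj_mult complex_cnj_one complex_mod_cnj)+
  have "(\<Sum>s\<in>UNIV. \<Sum>t\<in>UNIV. - ln (cmod (1 - conj_pair w (i, s) * cnj (conj_pair w (j, t)))))
     = 2 * - ln (sym_dist (w i) (w j))" if "i < N" "j < N" for i j
  proof -
    have "0 < sym_dist (w i) (w j)" using w that sym_dist_pos by blast
    then have "cmod (1 - w i * cnj (w j)) \<noteq> 0" "cmod (1 - w i * w j) \<noteq> 0" unfolding sym_dist_def by auto
    then have "ln (sym_dist (w i) (w j)) = ln (cmod (1 - w i * cnj (w j))) + ln (cmod (1 - w i * w j))"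
      unfolding sym_dist_def by (intro ln_mult_pos) auto
    then show ?thesis by (simp add: conj_pair_def UNIV_bool c)
  qed
  then have "(\<Sum>i<N. \<Sum>j<N. \<Sum>s\<in>UNIV. \<Sum>t\<in>UNIV. - ln (cmod (1 - conj_pair w (i, s) * cnj (conj_pair w (j, t)))))
     = (\<Sum>i<N. \<Sum>j<N. 2 * - ln (sym_dist (w i) (w j)))" by simp
  also have "\<dots> = 2 * (\<Sum>i<N. \<Sum>j<N. - ln (sym_dist (w i) (w j)))" by (simp only: sum_distrib_left)
  also have "(\<Sum>i<N. \<Sum>j<N. \<Sum>s\<in>UNIV. \<Sum>t\<in>UNIV. - ln (cmod (1 - conj_pair w (i, s) * cnj (conj_pair w (j, t)))))
    = (\<Sum>i<N. \<Sum>s\<in>UNIV. \<Sum>j<N. \<Sum>t\<in>UNIV. - ln (cmod (1 - conj_pair w (i, s) * cnj (conj_pair w (j, t)))))"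
    by (intro sum.cong refl, rule sum.swap)
  also have "\<dots> = (\<Sum>x\<in>{..<N} \<times> UNIV. \<Sum>y\<in>{..<N} \<times> UNIV. - ln (cmod (1 - conj_pair w x * cnj (conj_pair w y))))"
    unfolding sum.cartesian_product' by (simp add: split_def)
  finally show ?thesis .
qed

lemma sym_energy_nonneg:
  fixes w :: "nat \<Rightarrow> complex"
  assumes w: "\<forall>i<N. cmod (w i) < 1"
  shows "0 \<le> (\<Sum>i<N. \<Sum>j<N. - ln (sym_dist (w i) (w j)))"
proof -
  have "0 \<le> (\<Sum>x\<in>{..<N} \<times> UNIV. \<Sum>y\<in>{..<N} \<times> UNIV. - ln (cmod (1 - conj_pair w x * cnj (conj_pair w y))))"
    by (rule energy_nonneg) (auto simp: conj_pair_def w)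
  then show ?thesis unfolding sym_energy_conj_pair[of N w, OF w] by simp
qed

context circle_gaps begin

lemma sym_energy_inner_fun:
  fixes w :: "nat \<Rightarrow> complex"
  assumes w: "\<forall>i<N. cmod (w i) < 1"
  shows "(\<Sum>i<N. \<Sum>j<N. - ln (sym_dist (inner_fun (w i)) (inner_fun (w j))))
     \<le> 2 * real m * (\<Sum>i<N. \<Sum>j<N. - ln (sym_dist (w i) (w j)))"
proof -
  obtain R d where R: "1 < R" "inner_fun holomorphic_on ball 0 R" and d: "d \<le> 2 * m" and
    I: "contour_integral (circlepath 0 1) (\<lambda>z. deriv inner_fun z / inner_fun z) = 2 * of_real pi * \<i> * of_nat d"
    using inner_fun_extension by metis
  have w': "\<forall>i<N. cmod (inner_fun (w i)) < 1"
    using inner_function_in_disc[OF R inner_fun_0 norm_inner_fun_circle] w by blast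
  have cp: "inner_fun (conj_pair w x) = conj_pair (\<lambda>i. inner_fun (w i)) x" for x
    by (auto simp: conj_pair_def inner_fun_cnj split: prod.split)
  let ?E = "\<lambda>w. (\<Sum>i<N. \<Sum>j<N. - ln (sym_dist (w i) (w j)))"
  have "(\<Sum>x\<in>{..<N} \<times> UNIV. \<Sum>y\<in>{..<N} \<times> UNIV.
      - ln (cmod (1 - inner_fun (conj_pair w x) * cnj (inner_fun (conj_pair w y)))))
    \<le> real d * (\<Sum>x\<in>{..<N} \<times> UNIV. \<Sum>y\<in>{..<N} \<times> UNIV. - ln (cmod (1 - conj_pair w x * cnj (conj_pair w y))))"
    by (rule energy_inner_function[OF R inner_fun_0 norm_inner_fun_circle I]) (auto simp: conj_pair_def w)
  then have "2 * ?E (\<lambda>i. inner_fun (w i)) \<le> real d * (2 * ?E w)"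
    unfolding cp sym_energy_conj_pair[OF w] sym_energy_conj_pair[OF w'] .
  moreover have "real d * ?E w \<le> 2 * real m * ?E w"
    using d sym_energy_nonneg[OF w] by (intro mult_right_mono) auto
  ultimately show ?thesis by simp
qed

text \<open>Three configurations are compared: the given points pulled to radius \<open>r\<close>,
  their images under the inner function, and points at radius \<open>s\<close> above the rescaled
  real parts of the boundary images. The energy of the last is nonnegative, and each passage costs a
  fraction of \<open>e\<close> per pair. \<open>C\<close> depends on \<open>e\<close> but not on the
  points.\<close>

lemma energy_lower_bound:
  assumes e: "0 < e"
  shows "\<exists>C. \<forall>N \<theta>. (\<forall>i<N. 0 \<le> \<theta> i \<and> \<theta> i \<le> pi \<and> (\<forall>k\<in>{1..m}. \<theta> i \<le> p k \<or> q k \<le> \<theta> i)) \<longrightarrow>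
     inj_on \<theta> {..<N} \<longrightarrow>
     (real N)\<^sup>2 * (ln 2 - ln ((1 + cos gap_angle) / 2) / (2 * real m) - e) - C * real N
      \<le> (\<Sum>i<N. \<Sum>j\<in>{..<N} - {i}. - ln \<bar>cos (\<theta> i) - cos (\<theta> j)\<bar>)"
proof -
  define \<kappa> where "\<kappa> = (1 + cos gap_angle) / 2"
  have "cos pi < cos gap_angle" using gap_angle_bounds by (intro cos_monotone_0_pi) auto
  then have \<kappa>: "0 < \<kappa>" by (simp add: \<kappa>_def)
  \<comment> \<open>Scaling by \<open>s\<close> costs \<open>- 2 * ln s = e / 4\<close> per pair;
    the same bound covers scaling by any \<open>r \<ge> s\<close>.\<close>
  define s where "s = exp (- e / 8)"
  have s: "0 < s" "s < 1" using e by (auto simp: s_def)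
  have s2: "s\<^sup>2 < 1" using s by (simp add: power_less_one_iff)
  define e1 where "e1 = exp (e / 4) - 1"
  have e1: "0 < e1" using e by (simp add: e1_def)
  \<comment> \<open>The perturbation of \<open>sym_dist\<close> is at most
    \<open>8 * \<eta>\<close>. This value makes it at most an \<open>e1\<close>-fraction of the main
    term, whose lower bound is \<open>\<kappa> * (1 - s ^ 2) ^ 2\<close>, and
    \<open>1 + e1 = exp (e / 4)\<close>.\<close>
  define \<eta> where "\<eta> = e1 * \<kappa> * (1 - s\<^sup>2)\<^sup>2 / 8"
  have \<eta>: "0 < \<eta>" using e1 \<kappa> s2 by (simp add: \<eta>_def)
  obtain R d where R: "1 < R" "inner_fun holomorphic_on ball 0 R"
    using inner_fun_extension by metis
  have "continuous_on (cball 0 1) inner_fun"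
    by (rule holomorphic_on_imp_continuous_on[OF holomorphic_on_subset[OF R(2)]]) (use R in auto)
  then have "uniformly_continuous_on (cball 0 1) inner_fun"
    by (intro compact_uniformly_continuous) auto
  then obtain \<delta> where \<delta>: "0 < \<delta>"
    and uc: "\<And>x y. cmod x \<le> 1 \<Longrightarrow> cmod y \<le> 1 \<Longrightarrow> dist y x < \<delta> \<Longrightarrow> dist (inner_fun y) (inner_fun x) < \<eta>"
    using \<eta> unfolding uniformly_continuous_on_def by (metis mem_cball_0)
  define r where "r = max s (1 - \<delta> / 2)"
  have r: "0 < r" "r < 1" "1 - r < \<delta>" "s \<le> r" using s \<delta> by (auto simp: r_def)
  have r2: "r\<^sup>2 < 1" using r by (simp add: power_less_one_iff)
  \<comment> \<open>The diagonal contributes at most \<open>- 2 * ln (1 - r ^ 2)\<close> per point,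
    and \<open>ln 2\<close> makes up for having \<open>N * (N - 1)\<close> instead of
    \<open>N ^ 2\<close> pairs.\<close>
  define C where "C = ln 2 - 2 * ln (1 - r\<^sup>2)"
  show ?thesis
  proof (intro exI[of _ C] allI impI)
    fix N and \<theta> :: "nat \<Rightarrow> real"
    assume F: "\<forall>i<N. 0 \<le> \<theta> i \<and> \<theta> i \<le> pi \<and> (\<forall>k\<in>{1..m}. \<theta> i \<le> p k \<or> q k \<le> \<theta> i)"
      and inj: "inj_on \<theta> {..<N}"
    define u where "u i = cis (\<theta> i)" for i
    define w where "w i = of_real r * u i" for i
    have u1: "cmod (u i) = 1" for i by (simp add: u_def)
    have w1: "cmod (w i) = r" for i using r by (simp add: w_def u_def norm_mult)
    define t where "t i = Re (inner_fun (u i))" for i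
    have t: "- cos gap_angle \<le> t i" "t i \<le> 1" if "i < N" for i
    proof -
      show "- cos gap_angle \<le> t i"
        unfolding t_def u_def by (rule Re_inner_fun_circle) (use F that in auto)
      show "t i \<le> 1" using norm_inner_fun_circle[OF u1] complex_Re_le_cmod[of "inner_fun (u i)"]
        by (simp add: t_def)
    qed
    \<comment> \<open>The affine map from the interval between \<open>- cos gap_angle\<close> and 1,
      of length \<open>2 * \<kappa>\<close>, onto the one between -1 and 1.\<close>
    define \<tau> where "\<tau> i = (t i + cos gap_angle) / \<kappa> - 1" for i
    have \<tau>: "- 1 \<le> \<tau> i" "\<tau> i \<le> 1" if "i < N" for i
      using t[OF that] \<kappa> by (auto simp: \<tau>_def field_simps) (simp add: \<kappa>_def field_simps)
    have t_diff: "t i - t j = \<kappa> * (\<tau> i - \<tau> j)" for i j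
      using \<kappa> by (simp add: \<tau>_def field_simps)
    define v where "v i = cis (arccos (\<tau> i))" for i
    have v1: "cmod (v i) = 1" for i by (simp add: v_def)
    define sv where "sv i = of_real s * v i" for i
    have sv1: "cmod (sv i) = s" for i using s by (simp add: sv_def v_def norm_mult)
    \<comment> \<open>The case \<open>i = j\<close> is included: there the main term on the circle
      is 0, and the slack from \<open>e1\<close> alone carries the estimate.\<close>
    have key: "- ln \<kappa> - e / 2 - ln (sym_dist (sv i) (sv j)) \<le> - ln (sym_dist (inner_fun (w i)) (inner_fun (w j)))"
      if ij: "i < N" "j < N" for i j
    proof -
      define d where "d = sym_dist (sv i) (sv j)"
      have w': "cmod (inner_fun (w i)) < 1" for i
        using inner_function_in_disc[OF R inner_fun_0 norm_inner_fun_circle] w1 r by simp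
      have near: "cmod (inner_fun (w i) - inner_fun (u i)) \<le> \<eta>" for i
      proof -
        have "dist (w i) (u i) = cmod (of_real (r - 1) * u i)" by (simp add: w_def dist_norm algebra_simps)
        also have "\<dots> = \<bar>r - 1\<bar>" by (simp only: norm_mult norm_of_real u1 mult_1_right)
        also have "\<dots> < \<delta>" using r by simp
        finally show ?thesis using uc[of "u i" "w i"] u1 w1 r by (simp add: dist_norm)
      qed
      have d_ge: "(1 - s\<^sup>2)\<^sup>2 \<le> d" unfolding d_def by (rule sym_dist_ge) (use sv1 s in auto)
      have d0: "0 < d" using d_ge s2 by (meson less_le_trans zero_less_power diff_gt_0_iff_gt)
      have "sym_dist (inner_fun (w i)) (inner_fun (w j)) \<le> sym_dist (inner_fun (u i)) (inner_fun (u j)) + 8 * \<eta>"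
        by (rule sym_dist_lipschitz) (use w' near norm_inner_fun_circle[OF u1] in \<open>auto intro: less_imp_le\<close>)
      also have "sym_dist (inner_fun (u i)) (inner_fun (u j)) = 2 * \<bar>t i - t j\<bar>"
        unfolding t_def by (rule sym_dist_circle) (auto intro: norm_inner_fun_circle u1)
      also have "\<dots> = \<kappa> * (2 * \<bar>\<tau> i - \<tau> j\<bar>)" unfolding t_diff using \<kappa> by (simp add: abs_mult)
      also have "2 * \<bar>\<tau> i - \<tau> j\<bar> = sym_dist (v i) (v j)"
        using sym_dist_circle[OF v1 v1, of i j] \<tau>[OF ij(1)] \<tau>[OF ij(2)] by (simp add: v_def)
      also have "sym_dist (v i) (v j) \<le> d / s\<^sup>2"
        using sym_dist_scale[OF v1[of i] v1[of j] s(1)] s by (simp add: d_def sv_def field_simps)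
      also have "8 * \<eta> \<le> e1 * \<kappa> * (d / s\<^sup>2)"
      proof -
        have "d * s\<^sup>2 \<le> d * 1" using s2 d0 by (intro mult_left_mono) auto
        then have "d \<le> d / s\<^sup>2" using s by (simp add: field_simps)
        then have "e1 * \<kappa> * (1 - s\<^sup>2)\<^sup>2 \<le> e1 * \<kappa> * (d / s\<^sup>2)"
          using d_ge e1 \<kappa> by (intro mult_left_mono) auto
        then show ?thesis by (simp add: \<eta>_def)
      qed
      also have "\<kappa> * (d / s\<^sup>2) + e1 * \<kappa> * (d / s\<^sup>2) = \<kappa> * (d / s\<^sup>2) * exp (e / 4)"
        by (simp add: e1_def algebra_simps)
      finally have "sym_dist (inner_fun (w i)) (inner_fun (w j)) \<le> \<kappa> * (d / s\<^sup>2) * exp (e / 4)"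
        using \<kappa> by simp
      moreover have "0 < sym_dist (inner_fun (w i)) (inner_fun (w j))"
        using sym_dist_pos[OF w' w'] .
      ultimately have "ln (sym_dist (inner_fun (w i)) (inner_fun (w j))) \<le> ln (\<kappa> * (d / s\<^sup>2) * exp (e / 4))"
        by simp
      also have "\<dots> = ln \<kappa> + (ln d - 2 * ln s) + e / 4"
        using \<kappa> d0 s by (simp add: ln_mult_pos ln_div ln_realpow)
      also have "ln s = - e / 8" by (simp add: s_def)
      finally show ?thesis by (simp add: d_def)
    qed
    let ?E = "\<lambda>w. (\<Sum>i<N. \<Sum>j<N. - ln (sym_dist (w i) (w j)))"
    \<comment> \<open>Positivity of the kernel at radius \<open>s\<close> is the whole input from
      the model interval between -1 and 1, for which \<open>ln 2\<close> is the extremal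
      energy.\<close>
    have "0 \<le> ?E sv" by (rule sym_energy_nonneg) (use sv1 s in auto)
    moreover have "(\<Sum>i<N. \<Sum>j<N. - ln \<kappa> - e / 2 + - ln (sym_dist (sv i) (sv j))) =
        (real N)\<^sup>2 * (- ln \<kappa> - e / 2) + ?E sv"
      unfolding sum.distrib by (simp add: power2_eq_square algebra_simps)
    ultimately have "(real N)\<^sup>2 * (- ln \<kappa> - e / 2) \<le> (\<Sum>i<N. \<Sum>j<N. - ln \<kappa> - e / 2 - ln (sym_dist (sv i) (sv j)))"
      by simp
    also have "\<dots> \<le> ?E (\<lambda>i. inner_fun (w i))"
      by (intro sum_mono key) auto
    also have "\<dots> \<le> 2 * real m * ?E w"
      by (rule sym_energy_inner_fun) (use w1 r in auto)
    finally have Ew: "(real N)\<^sup>2 * ((- ln \<kappa> - e / 2) / (2 * real m)) \<le> ?E w"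
      using m by (simp add: field_simps)
    have pair: "- ln (sym_dist (w i) (w j)) \<le> - ln \<bar>cos (\<theta> i) - cos (\<theta> j)\<bar> - ln 2 + e / 4"
      if ij: "i < N" "j < N" "i \<noteq> j" for i j
    proof -
      have "cos (\<theta> i) \<noteq> cos (\<theta> j)"
        using F ij inj by (metis cos_inj_pi inj_on_eq_iff lessThan_iff)
      then have pos: "0 < \<bar>cos (\<theta> i) - cos (\<theta> j)\<bar>" by simp
      have "r\<^sup>2 * (2 * \<bar>cos (\<theta> i) - cos (\<theta> j)\<bar>) \<le> sym_dist (w i) (w j)"
        using sym_dist_scale[OF u1[of i] u1[of j] r(1)] sym_dist_circle[OF u1[of i] u1[of j]]
        by (simp add: w_def u_def)
      then have "ln (r\<^sup>2 * (2 * \<bar>cos (\<theta> i) - cos (\<theta> j)\<bar>)) \<le> ln (sym_dist (w i) (w j))"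
        using pos r by (subst ln_le_cancel_iff) (auto intro: less_le_trans[rotated])
      also have "ln (r\<^sup>2 * (2 * \<bar>cos (\<theta> i) - cos (\<theta> j)\<bar>)) = 2 * ln r + ln 2 + ln \<bar>cos (\<theta> i) - cos (\<theta> j)\<bar>"
        using pos r by (simp add: ln_mult_pos ln_realpow)
      finally have "2 * ln r + ln 2 + ln \<bar>cos (\<theta> i) - cos (\<theta> j)\<bar> \<le> ln (sym_dist (w i) (w j))" .
      moreover have "- e / 8 \<le> ln r" using r s by (metis ln_exp ln_le_cancel_iff s_def)
      ultimately show ?thesis by simp
    qed
    have diag: "- ln (sym_dist (w i) (w i)) \<le> - 2 * ln (1 - r\<^sup>2)" for i
    proof -
      have "(1 - r\<^sup>2)\<^sup>2 \<le> sym_dist (w i) (w i)" by (rule sym_dist_ge) (use w1 r in auto)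
      then have "ln ((1 - r\<^sup>2)\<^sup>2) \<le> ln (sym_dist (w i) (w i))"
        using r2 by (subst ln_le_cancel_iff) (auto intro: less_le_trans[rotated])
      then show ?thesis using r2 by (simp add: ln_realpow)
    qed
    let ?S = "\<Sum>i<N. \<Sum>j\<in>{..<N} - {i}. - ln \<bar>cos (\<theta> i) - cos (\<theta> j)\<bar>"
    have "?E w = (\<Sum>i<N. - ln (sym_dist (w i) (w i)) + (\<Sum>j\<in>{..<N} - {i}. - ln (sym_dist (w i) (w j))))"
      by (intro sum.cong refl) (simp add: sum.remove)
    also have "\<dots> \<le> (\<Sum>i<N. - 2 * ln (1 - r\<^sup>2) + (\<Sum>j\<in>{..<N} - {i}. - ln \<bar>cos (\<theta> i) - cos (\<theta> j)\<bar> + (e / 4 - ln 2)))"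
      by (intro sum_mono add_mono diag) (use pair in force)
    also have "\<dots> = - 2 * ln (1 - r\<^sup>2) * real N + ?S + real N * (real N - 1) * (e / 4 - ln 2)"
    proof -
      have "real (card ({..<N} - {i})) = real N - 1" if "i \<in> {..<N}" for i
        using that by (auto simp: of_nat_diff Suc_leI)
      then have "(\<Sum>i<N. \<Sum>j\<in>{..<N} - {i}. e / 4 - ln 2) = (\<Sum>i<N. (real N - 1) * (e / 4 - ln 2))"
        by (intro sum.cong refl) (simp only: sum_constant)
      then show ?thesis unfolding sum.distrib by simp
    qed
    finally have "(real N)\<^sup>2 * ((- ln \<kappa> - e / 2) / (2 * real m)) \<le> \<dots>" using Ew by simp
    moreover have "(e / 2) / (2 * real m) \<le> e / 2"
      using m e by (simp add: field_simps)
    then have "(real N)\<^sup>2 * ((e / 2) / (2 * real m)) \<le> (real N)\<^sup>2 * (e / 2)" by (rule mult_left_mono) simp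
    moreover have "0 \<le> real N * (e / 4)" "0 \<le> (real N)\<^sup>2 * (e / 4)" using e by auto
    ultimately show "(real N)\<^sup>2 * (ln 2 - ln ((1 + cos gap_angle) / 2) / (2 * real m) - e) - C * real N \<le> ?S"
      unfolding C_def \<kappa>_def[symmetric]
      by (simp add: power2_eq_square algebra_simps diff_divide_distrib)
  qed
qed

end

subsection \<open>The capacity estimate\<close>

lemma circle_gaps_interval_endpoints:
  assumes n: "n \<ge> 2" and ab: "interval_endpoints n a b"
  shows "circle_gaps (n - 1) (\<lambda>k. arccos (a (k + 1))) (\<lambda>k. arccos (b k))"
    and "\<And>i j. 1 \<le> i \<Longrightarrow> i \<le> j \<Longrightarrow> j \<le> n \<Longrightarrow> a i \<le> a j \<and> b i \<le> b j"
    and "\<And>k. 1 \<le> k \<Longrightarrow> k \<le> n \<Longrightarrow> - 1 \<le> a k \<and> a k < b k \<and> b k \<le> 1"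
proof -
  have a1: "a 1 = - 1" and bn: "b n = 1" and lt: "\<And>k. 1 \<le> k \<Longrightarrow> k \<le> n \<Longrightarrow> a k < b k"
    and gap: "\<And>k. 1 \<le> k \<Longrightarrow> k < n \<Longrightarrow> b k < a (k + 1)"
    using ab by (auto simp: interval_endpoints_def)
  show mono: "a i \<le> a j \<and> b i \<le> b j" if "1 \<le> i" "i \<le> j" "j \<le> n" for i j
    using that(2,3)
  proof (induction j rule: dec_induct)
    case (step k)
    then show ?case using lt[of k] lt[of "Suc k"] gap[of k] that(1) by force
  qed simp
  show bd: "- 1 \<le> a k \<and> a k < b k \<and> b k \<le> 1" if "1 \<le> k" "k \<le> n" for k
    using mono[of 1 k] mono[of k n] lt[of k] that a1 bn n by auto
  show "circle_gaps (n - 1) (\<lambda>k. arccos (a (k + 1))) (\<lambda>k. arccos (b k))"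
  proof
    show "1 \<le> n - 1" using n by simp
    fix k
    show "arccos (a (k + 1)) < arccos (b k)" if "k \<in> {1..n - 1}"
    proof -
      have k: "1 \<le> k" "k < n" "k + 1 \<le> n" using that n by auto
      show ?thesis using gap[OF k(1,2)] bd[of k] bd[of "k + 1"] k by (intro arccos_less_arccos) auto
    qed
    show "arccos (b (k + 1)) < arccos (a (k + 1))" if "k \<in> {1..<n - 1}"
    proof -
      have "1 \<le> k + 1" "k + 1 \<le> n" using that by auto
      from bd[OF this] show ?thesis by (intro arccos_less_arccos) auto
    qed
  next
    show "0 < arccos (a (n - 1 + 1))"
      using n bd[of n] bn arccos_less_arccos[of "a n" 1] by auto
    show "arccos (b 1) < pi"
      using n bd[of 1] a1 arccos_less_arccos[of "- 1" "b 1"] by auto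
  qed
qed

lemma interval_union_facts:
  assumes n: "n \<ge> 2" and ab: "interval_endpoints n a b"
  shows "compact (interval_union n a b)" "interval_union n a b \<subseteq> \<real>" "infinite (interval_union n a b)"
proof -
  have "compact (\<Union>k\<in>{1..n}. {a k..b k})" by (intro compact_UN) auto
  then show "compact (interval_union n a b)"
    unfolding interval_union_def by (intro compact_continuous_image continuous_intros)
  show "interval_union n a b \<subseteq> \<real>" by (auto simp: interval_union_def)
  have "a 1 < b 1" using circle_gaps_interval_endpoints(3)[OF n ab, of 1] n by simp
  then have "infinite {a 1..b 1}" by simp
  moreover have "{a 1..b 1} \<subseteq> (\<Union>k\<in>{1..n}. {a k..b k})" using n by (intro UN_upper) auto
  ultimately have "infinite (\<Union>k\<in>{1..n}. {a k..b k})" using finite_subset by blast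
  then show "infinite (interval_union n a b)"
    unfolding interval_union_def by (subst finite_image_iff) (auto simp: inj_on_def)
qed

text \<open>The energy of \<open>N\<close> Leja points lies between
  \<open>N ^ 2 * (L - e) - C * N\<close> and \<open>N * (N - 1) * c\<close>; letting
  \<open>N\<close> grow and then \<open>e\<close> shrink gives \<open>L \<le> c\<close>.\<close>

lemma log_capacity_interval_union_le:
  assumes n: "n \<ge> 2" and ab: "interval_endpoints n a b"
  shows "log_capacity (interval_union n a b)
    \<le> 1 / 2 * cos (1 / 2 * (\<Sum>k=1..n-1. arccos (a (k + 1)) - arccos (b k))) powr (1 / (real n - 1))"
proof -
  let ?p = "\<lambda>k. arccos (a (k + 1))" and ?q = "\<lambda>k. arccos (b k)"
  interpret circle_gaps "n - 1" ?p ?q by (rule circle_gaps_interval_endpoints[OF n ab])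
  note mono = circle_gaps_interval_endpoints(2)[OF n ab] and bd = circle_gaps_interval_endpoints(3)[OF n ab]
  let ?E = "interval_union n a b"
  note E = interval_union_facts[OF n ab]
  define \<gamma> where "\<gamma> = gap_angle"
  have \<gamma>: "0 < \<gamma>" "\<gamma> < pi" using gap_angle_bounds by (auto simp: \<gamma>_def)
  \<comment> \<open>\<open>arccos\<close> is decreasing, so the sum in the statement is negative;
    the sign disappears under the even cosine.\<close>
  have sum: "(\<Sum>k=1..n-1. arccos (a (k + 1)) - arccos (b k)) = - \<gamma>"
    unfolding \<gamma>_def gap_angle_def by (simp only: sum_subtractf minus_diff_eq)
  define L where "L = ln 2 - ln ((1 + cos \<gamma>) / 2) / (2 * real (n - 1))"
  have cpos: "0 < cos (\<gamma> / 2)" using \<gamma> by (intro cos_gt_zero) auto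
  have expL: "exp (- L) = 1 / 2 * cos (\<gamma> / 2) powr (1 / (real n - 1))"
  proof -
    have "(1 + cos \<gamma>) / 2 = (cos (\<gamma> / 2))\<^sup>2" using cos_double_cos[of "\<gamma> / 2"] by simp
    then have "- L = ln (1 / 2) + 1 / (real n - 1) * ln (cos (\<gamma> / 2))"
      using cpos n by (simp add: L_def ln_realpow ln_div of_nat_diff field_simps)
    then show ?thesis using cpos by (simp add: exp_add powr_def)
  qed
  obtain x :: "nat \<Rightarrow> complex" where x: "\<And>k. x k \<in> ?E" "inj x"
    "\<And>k z. z \<in> ?E \<Longrightarrow> (\<Prod>j<k. cmod (z - x j)) \<le> (\<Prod>j<k. cmod (x k - x j))"
    by (rule leja_points[OF E(1,3)], rule that)
  define \<theta> where "\<theta> k = arccos (Re (x k))" for k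
  have "\<forall>k. \<exists>j. 1 \<le> j \<and> j \<le> n \<and> a j \<le> Re (x k) \<and> Re (x k) \<le> b j \<and> x k = of_real (Re (x k))"
  proof
    fix k show "\<exists>j. 1 \<le> j \<and> j \<le> n \<and> a j \<le> Re (x k) \<and> Re (x k) \<le> b j \<and> x k = of_real (Re (x k))"
      using x(1)[of k] by (auto simp: interval_union_def)
  qed
  then obtain j where j: "\<And>k. 1 \<le> j k" "\<And>k. j k \<le> n" "\<And>k. a (j k) \<le> Re (x k)" "\<And>k. Re (x k) \<le> b (j k)"
    "\<And>k. x k = of_real (Re (x k))" by metis
  have y: "- 1 \<le> Re (x k)" "Re (x k) \<le> 1" for k
    using j(3,4)[of k] bd[OF j(1,2), of k] by linarith+
  have cos\<theta>: "cos (\<theta> k) = Re (x k)" for k using y by (simp add: \<theta>_def)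
  have \<theta>_gap: "\<theta> i \<le> ?p k \<or> ?q k \<le> \<theta> i" if "k \<in> {1..n - 1}" for i k
  proof (cases "k + 1 \<le> j i")
    case True
    then have "a (k + 1) \<le> Re (x i)" using mono[of "k + 1" "j i"] j(2,3)[of i] by force
    then show ?thesis unfolding \<theta>_def using y[of i] bd[of "k + 1"] that
      by (intro disjI1 arccos_le_arccos) auto
  next
    case False
    then have "Re (x i) \<le> b k" using mono[of "j i" k] j(1,4)[of i] that by force
    then show ?thesis unfolding \<theta>_def using y[of i] bd[of k] that
      by (intro disjI2 arccos_le_arccos) auto
  qed
  have inj\<theta>: "inj_on \<theta> A" for A
    using x(2) cos\<theta> j(5) by (metis injD inj_on_def)
  show ?thesis unfolding sum
  proof (rule log_capacity_le[OF E(1,2)])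
    fix h c assume h: "log_pole_at_infinity (- ?E) h" and c: "((\<lambda>z. h z - ln (cmod z)) \<longlongrightarrow> c) at_infinity"
    have up: "(\<Sum>i<N. \<Sum>j\<in>{..<N} - {i}. - ln (cmod (x i - x j))) \<le> real N * (real N - 1) * c" for N
      by (rule leja_energy_bound log_pole_leja_bound[OF E(1) x(1,2,3) h c])+
    have "L - e \<le> c" if e: "0 < e" for e
    proof (rule ccontr)
      assume "\<not> L - e \<le> c"
      then have pos: "0 < L - e - c" by simp
      have F: "\<forall>i<N. 0 \<le> \<theta> i \<and> \<theta> i \<le> pi \<and> (\<forall>k\<in>{1..n - 1}. \<theta> i \<le> ?p k \<or> ?q k \<le> \<theta> i)" for N
        using \<theta>_gap arccos_lbound[OF y] arccos_ubound[OF y] by (simp add: \<theta>_def)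
      have "\<exists>C. \<forall>N. (real N)\<^sup>2 * (L - e) - C * real N
          \<le> (\<Sum>i<N. \<Sum>j\<in>{..<N} - {i}. - ln \<bar>cos (\<theta> i) - cos (\<theta> j)\<bar>)"
        using energy_lower_bound[OF e] unfolding L_def \<gamma>_def
        by (elim ex_forward, intro allI, drule_tac spec, drule_tac spec[where x = \<theta>])
           (drule mp, rule F, drule mp, rule inj\<theta>, assumption)
      then obtain C where C: "\<And>N. (real N)\<^sup>2 * (L - e) - C * real N
          \<le> (\<Sum>i<N. \<Sum>j\<in>{..<N} - {i}. - ln \<bar>cos (\<theta> i) - cos (\<theta> j)\<bar>)" by (elim exE) (rule that, elim allE)
      \<comment> \<open>After cancelling one factor \<open>N\<close>, a linear function of
        \<open>N\<close> with positive slope is bounded by a constant.\<close>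
      have "real N * (L - e - c) \<le> C - c" if "0 < N" for N
      proof -
        have "cmod (x i - x j) = \<bar>cos (\<theta> i) - cos (\<theta> j)\<bar>" for i j
          unfolding cos\<theta> by (subst (1 2) j(5)) (metis norm_of_real of_real_diff)
        then have "(real N)\<^sup>2 * (L - e) - C * real N \<le> real N * (real N - 1) * c"
          using C[of N] up[of N] by simp
        then have "real N * (real N * (L - e - c)) \<le> real N * (C - c)"
          by (simp add: power2_eq_square algebra_simps)
        then show ?thesis using that by simp
      qed
      moreover obtain N :: nat where "(C - c) / (L - e - c) < real N" using reals_Archimedean2 by blast
      then have "C - c < real (Suc N) * (L - e - c)" using pos by (simp add: field_simps)
      ultimately show False by (metis not_le zero_less_Suc)
    qed
    then have "L \<le> c" by (metis diff_le_eq field_le_epsilon)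
    then have "exp (- c) \<le> exp (- L)" by simp
    then show "exp (- c) \<le> 1 / 2 * cos (1 / 2 * - \<gamma>) powr (1 / (real n - 1))"
      using expL by simp
  qed simp
qed

subsection \<open>Preimages of intervals under Chebyshev polynomials\<close>

text \<open>The branch of \<open>w + sqrt (w ^ 2 - 1)\<close> behaving like \<open>2 * w\<close> at
  infinity. Pulling out \<open>w\<close> puts the cut of the principal root on the segment from -1
  to 1, so that no separate choice of branch is needed.\<close>

definition joukowski_inverse :: "complex \<Rightarrow> complex" where
  "joukowski_inverse w = w * (1 + csqrt (1 - 1 / w\<^sup>2))"

abbreviation unit_segment :: "complex set" where "unit_segment \<equiv> complex_of_real ` {-1..1}"

lemma unit_segment_csqrt_arg:
  assumes w: "w \<notin> unit_segment"
  shows "w \<noteq> 0" "1 - 1 / w\<^sup>2 \<notin> \<real>\<^sub>\<le>\<^sub>0" "0 < Re (csqrt (1 - 1 / w\<^sup>2))"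
proof -
  have "0 \<in> unit_segment" by (rule image_eqI[of _ _ 0]) auto
  with w show w0: "w \<noteq> 0" by auto
  show nr: "1 - 1 / w\<^sup>2 \<notin> \<real>\<^sub>\<le>\<^sub>0"
  proof
    assume "1 - 1 / w\<^sup>2 \<in> \<real>\<^sub>\<le>\<^sub>0"
    then obtain r where r: "1 - 1 / w\<^sup>2 = of_real r" "r \<le> 0" by (auto elim!: nonpos_Reals_cases)
    then have "1 / w\<^sup>2 = of_real (1 - r)" by (simp add: algebra_simps)
    moreover have "w\<^sup>2 = 1 / (1 / w\<^sup>2)" by simp
    ultimately have w2: "w\<^sup>2 = of_real (1 / (1 - r))" by simp
    define x where "x = sqrt (1 / (1 - r))"
    have "0 \<le> 1 / (1 - r)" "1 / (1 - r) \<le> 1" using r by auto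
    then have x: "0 \<le> x" "x \<le> 1" "x\<^sup>2 = 1 / (1 - r)" by (auto simp: x_def)
    then have "w\<^sup>2 = (of_real x)\<^sup>2" using w2 by (metis of_real_power)
    then have "w = of_real x \<or> w = of_real (- x)" by (simp add: power2_eq_iff)
    then show False using w x by auto
  qed
  have "\<not> Re (csqrt (1 - 1 / w\<^sup>2)) = 0"
  proof
    assume 0: "Re (csqrt (1 - 1 / w\<^sup>2)) = 0"
    have "(csqrt (1 - 1 / w\<^sup>2))\<^sup>2 = of_real (- (Im (csqrt (1 - 1 / w\<^sup>2)))\<^sup>2)"
      using 0 by (simp add: complex_eq_iff power2_eq_square)
    then have "1 - 1 / w\<^sup>2 = of_real (- (Im (csqrt (1 - 1 / w\<^sup>2)))\<^sup>2)" by (simp only: power2_csqrt)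
    then have "1 - 1 / w\<^sup>2 \<in> \<real>\<^sub>\<le>\<^sub>0" by (metis neg_le_0_iff_le nonpos_Reals_of_real_iff zero_le_power2)
    with nr show False by simp
  qed
  moreover have "0 \<le> Re (csqrt (1 - 1 / w\<^sup>2))" using csqrt_principal[of "1 - 1 / w\<^sup>2"] by linarith
  ultimately show "0 < Re (csqrt (1 - 1 / w\<^sup>2))" by simp
qed

text \<open>The two solutions \<open>J\<close> and \<open>J'\<close> of the Joukowski equation have
  product 1, and the positive real part of the root selects the larger one. The second identity is
  the description of level curves as ellipses with foci 1 and -1; it controls the modulus near the
  segment, where the branch itself is discontinuous.\<close>

lemma joukowski_inverse_norm:
  assumes w: "w \<notin> unit_segment"
  shows "1 < cmod (joukowski_inverse w)"
    and "cmod (joukowski_inverse w) + 1 / cmod (joukowski_inverse w) = cmod (w - 1) + cmod (w + 1)"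
proof -
  define s where "s = csqrt (1 - 1 / w\<^sup>2)"
  define J where "J = joukowski_inverse w"
  define J' where "J' = w * (1 - s)"
  note f = unit_segment_csqrt_arg[OF w, folded s_def]
  have J: "J = w * (1 + s)" by (simp add: J_def joukowski_inverse_def s_def)
  have s2: "s\<^sup>2 = 1 - 1 / w\<^sup>2" by (simp add: s_def)
  have "J * J' = w\<^sup>2 * (1 - s\<^sup>2)" by (simp add: J J'_def power2_eq_square algebra_simps)
  also have "\<dots> = 1" using f(1) by (simp add: s2)
  finally have JJ: "J * J' = 1" .
  have "cmod (1 - s) < cmod (1 + s)"
  proof (rule power2_less_imp_less)
    show "(cmod (1 - s))\<^sup>2 < (cmod (1 + s))\<^sup>2"
      unfolding cmod_power2 using f(3) by (simp add: power2_eq_square algebra_simps)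
  qed simp
  then have lt: "cmod J' < cmod J" using f(1) by (simp add: J J'_def norm_mult)
  have JJn: "cmod J * cmod J' = 1" using JJ by (metis norm_mult norm_one)
  have J1: "1 < cmod J"
  proof (rule ccontr)
    assume "\<not> 1 < cmod J"
    then have "cmod J \<le> 1" by simp
    then have "cmod J * cmod J' < 1 * 1"
      using lt by (intro mult_le_less_imp_less) auto
    with JJn show False by simp
  qed
  then show "1 < cmod (joukowski_inverse w)" by (simp add: J_def)
  have J0: "J \<noteq> 0" using J1 by auto
  have sum: "J + J' = 2 * w" by (simp add: J J'_def algebra_simps)
  have "J' = 1 / J" using JJ J0 by (simp add: field_simps)
  then have w': "w = (J + 1 / J) / 2" using sum by simp
  have "w - 1 = (J - 1)\<^sup>2 / (2 * J)" "w + 1 = (J + 1)\<^sup>2 / (2 * J)"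
    using J0 by (simp_all add: w' power2_eq_square field_simps)
  then have "cmod (w - 1) + cmod (w + 1) = ((cmod (J - 1))\<^sup>2 + (cmod (J + 1))\<^sup>2) / (2 * cmod J)"
    by (simp add: norm_divide norm_mult norm_power add_divide_distrib)
  also have "(cmod (J - 1))\<^sup>2 + (cmod (J + 1))\<^sup>2 = 2 * (cmod J)\<^sup>2 + 2"
    unfolding cmod_power2 by (simp add: power2_eq_square algebra_simps)
  also have "\<dots> / (2 * cmod J) = cmod J + 1 / cmod J"
    using J0 by (simp add: power2_eq_square field_simps)
  finally show "cmod (joukowski_inverse w) + 1 / cmod (joukowski_inverse w) = cmod (w - 1) + cmod (w + 1)"
    by (simp add: J_def)
qed

lemma joukowski_inverse_holomorphic: "joukowski_inverse holomorphic_on - unit_segment"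
  unfolding joukowski_inverse_def[abs_def]
  using unit_segment_csqrt_arg by (intro holomorphic_intros) auto

lemma ln_joukowski_inverse_less:
  assumes w: "w \<notin> unit_segment" and e: "0 < e" and lt: "cmod (w - 1) + cmod (w + 1) < exp e + exp (- e)"
  shows "ln (cmod (joukowski_inverse w)) < e"
proof (rule ccontr)
  define \<rho> where "\<rho> = cmod (joukowski_inverse w)"
  have \<rho>: "1 < \<rho>" "\<rho> + 1 / \<rho> < exp e + exp (- e)"
    using joukowski_inverse_norm[OF w] lt by (auto simp: \<rho>_def)
  assume "\<not> ln (cmod (joukowski_inverse w)) < e"
  then have "exp e \<le> exp (ln \<rho>)" by (simp add: \<rho>_def)
  then have "exp e \<le> \<rho>" using \<rho>(1) by simp
  moreover have "1 \<le> exp e" using e by simp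
  ultimately have "0 \<le> (\<rho> - exp e) * (\<rho> * exp e - 1)"
    using \<rho>(1) by (intro mult_nonneg_nonneg) (auto simp: mult_ge1_I)
  also have "(\<rho> - exp e) * (\<rho> * exp e - 1) = (\<rho> + 1 / \<rho> - exp e - exp (- e)) * (\<rho> * exp e)"
    using \<rho>(1) by (simp add: exp_minus field_simps)
  finally have "0 \<le> \<rho> + 1 / \<rho> - exp e - exp (- e)"
  proof -
    assume *: "0 \<le> (\<rho> + 1 / \<rho> - exp e - exp (- e)) * (\<rho> * exp e)"
    have "0 < \<rho> * exp e" using \<rho>(1) by simp
    with * show ?thesis by (metis mult_less_0_iff not_le)
  qed
  with \<rho>(2) show False by simp
qed

section \<open>Chebyshev polynomials in the complex plane\<close>

fun cheb :: "nat \<Rightarrow> complex \<Rightarrow> complex" where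
  "cheb 0 z = 1"
| "cheb (Suc 0) z = z"
| "cheb (Suc (Suc k)) z = 2 * z * cheb (Suc k) z - cheb k z"

lemma cheb_cos: "cheb k (cos z) = cos (of_nat k * z)"
proof (induction k rule: induct_nat_012)
  case (ge2 n)
  have "cos (of_nat (Suc (Suc n)) * z) = cos (of_nat (Suc n) * z + z)" by (simp add: algebra_simps)
  moreover have "cos (of_nat n * z) = cos (of_nat (Suc n) * z - z)" by (simp add: algebra_simps)
  ultimately show ?case using ge2 by (simp only: cheb.simps cos_add cos_diff) (simp add: algebra_simps)
qed auto

lemma cheb_holomorphic: "cheb k holomorphic_on S"
proof (induction k rule: induct_nat_012)
  case (ge2 n)
  then show ?case by (auto intro!: holomorphic_intros)
qed (auto intro!: holomorphic_intros)

lemma cheb_leading: "((\<lambda>z. cheb (Suc k) z / z ^ Suc k) \<longlongrightarrow> 2 ^ k) at_infinity"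
proof -
  have nz: "eventually (\<lambda>z::complex. z \<noteq> 0) at_infinity"
    unfolding eventually_at_infinity by (rule exI[of _ 1]) auto
  have inv: "((\<lambda>z::complex. 1 / z\<^sup>2) \<longlongrightarrow> 0) at_infinity"
  proof -
    have "((\<lambda>z::complex. (1 / z)\<^sup>2) \<longlongrightarrow> 0\<^sup>2) at_infinity"
      by (intro tendsto_power tendsto_divide_0[OF tendsto_const filterlim_ident])
    then show ?thesis by (simp add: power_divide)
  qed
  \<comment> \<open>For the lower index any finite limit is enough, since the recursion multiplies
    it by \<open>1 / z ^ 2\<close>. This spares the exceptional leading coefficient at degree
    0.\<close>
  have "(\<exists>L. ((\<lambda>z. cheb k z / z ^ k) \<longlongrightarrow> L) at_infinity) \<and> ((\<lambda>z. cheb (Suc k) z / z ^ Suc k) \<longlongrightarrow> 2 ^ k) at_infinity"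
  proof (induction k)
    case 0
    have "((\<lambda>z. cheb (Suc 0) z / z ^ Suc 0) \<longlongrightarrow> 1) at_infinity"
      by (rule Lim_transform_eventually[OF tendsto_const]) (rule eventually_mono[OF nz], simp)
    then show ?case by auto
  next
    case (Suc k)
    then obtain L where L: "((\<lambda>z. cheb k z / z ^ k) \<longlongrightarrow> L) at_infinity" by blast
    from Suc have S: "((\<lambda>z. cheb (Suc k) z / z ^ Suc k) \<longlongrightarrow> 2 ^ k) at_infinity" by blast
    have "((\<lambda>z. 2 * (cheb (Suc k) z / z ^ Suc k) - (cheb k z / z ^ k) * (1 / z\<^sup>2)) \<longlongrightarrow> 2 * 2 ^ k - L * 0) at_infinity"
      by (intro tendsto_diff tendsto_mult tendsto_const S L inv)
    then have "((\<lambda>z. cheb (Suc (Suc k)) z / z ^ Suc (Suc k)) \<longlongrightarrow> 2 * 2 ^ k - L * 0) at_infinity"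
      by (rule Lim_transform_eventually)
         (rule eventually_mono[OF nz], simp add: power2_eq_square diff_divide_distrib)
    then show ?case using S by auto
  qed
  then show ?thesis by blast
qed

lemma cos_eq_real_imp_real:
  fixes w :: complex
  assumes "cos w = of_real r" "- 1 \<le> r" "r \<le> 1"
  shows "w \<in> \<real>"
proof -
  have "cos w = cos (of_real (arccos r))" using assms by (simp add: cos_of_real)
  then obtain k where "k \<in> \<int>" "w = of_real (arccos r) + of_real (2 * k * pi) \<or> w = - of_real (arccos r) + of_real (2 * k * pi)"
    by (auto simp: complex_cos_eq)
  then show ?thesis by auto
qed

text \<open>After the substitution \<open>z = cos \<zeta>\<close>, the cosine of
  \<open>k * \<zeta>\<close> is real and between -1 and 1, which forces \<open>\<zeta>\<close> to be
  real. All solutions, complex ones included, therefore lie on the segment.\<close>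

lemma cheb_preimage:
  assumes k: "0 < k" and z: "cheb k z = of_real r" "- 1 \<le> r" "r \<le> 1"
  obtains x where "z = of_real x" "- 1 \<le> x" "x \<le> 1" "r = cos (real k * arccos x)"
proof -
  define \<zeta> where "\<zeta> = Arccos z"
  have z': "z = cos \<zeta>" by (simp add: \<zeta>_def)
  have c: "cos (of_nat k * \<zeta>) = of_real r" using z by (simp add: z' cheb_cos)
  have "of_nat k * \<zeta> \<in> \<real>" by (rule cos_eq_real_imp_real[OF c z(2,3)])
  then have "\<zeta> \<in> \<real>" using k by (simp add: complex_is_Real_iff)
  then obtain t where t: "\<zeta> = of_real t" by (auto elim: Reals_cases)
  define x where "x = cos t"
  have x: "z = of_real x" by (simp add: z' t x_def cos_of_real)
  have "z = cos (of_real (arccos x))" by (simp add: x cos_of_real x_def)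
  then have "of_real r = cos (of_nat k * complex_of_real (arccos x))" using z(1) cheb_cos by metis
  also have "\<dots> = of_real (cos (real k * arccos x))" by (metis cos_of_real of_real_mult of_real_of_nat_eq)
  finally have "r = cos (real k * arccos x)" by (simp only: of_real_eq_iff)
  then show ?thesis using that[OF x] by (simp add: x_def)
qed

lemma cos_multiple_arccos: "cos (real k * arccos (cos t)) = cos (real k * t)"
proof -
  have *: "complex_of_real (cos (real k * u)) = cheb k (of_real (cos u))" for u
    by (metis cheb_cos cos_of_real of_real_mult of_real_of_nat_eq)
  have "complex_of_real (cos (real k * arccos (cos t))) = complex_of_real (cos (real k * t))"
    unfolding * by simp
  then show ?thesis by (simp only: of_real_eq_iff)
qed

lemma cheb_of_real: "- 1 \<le> x \<Longrightarrow> x \<le> 1 \<Longrightarrow> cheb k (of_real x) = of_real (cos (real k * arccos x))"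
  by (metis cheb_cos cos_of_real of_real_mult of_real_of_nat_eq cos_arccos)

section \<open>Capacity of Chebyshev preimages and the equality case\<close>

text \<open>\<open>cos (real s * arccos x)\<close> is the Chebyshev polynomial of degree
  \<open>s\<close> on the segment, so this is the preimage of the interval from \<open>t0\<close> to
  1.\<close>

definition cheb_preimage_set :: "nat \<Rightarrow> real \<Rightarrow> real set" where
  "cheb_preimage_set s t0 = {x. - 1 \<le> x \<and> x \<le> 1 \<and> t0 \<le> cos (real s * arccos x)}"

lemma projected_arcs_eq:
  assumes l: "0 < l" "l < 2 * pi"
  shows "projected_arcs l s = of_real ` cheb_preimage_set s (cos (l / 2))"
proof -
  have iff: "\<bar>Arg w\<bar> \<le> l / 2 \<longleftrightarrow> cos (l / 2) \<le> Re w" if "cmod w = 1" for w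
  proof -
    have "w \<noteq> 0" using that by auto
    then have "Re w = cos \<bar>Arg w\<bar>" using that by (simp add: cos_Arg)
    moreover have "\<bar>Arg w\<bar> \<le> pi" using Arg_bounded[of w] by auto
    ultimately show ?thesis using l cos_mono_le_eq[of "l / 2" "\<bar>Arg w\<bar>"] by simp
  qed
  have pow: "cmod (cis t ^ s) = 1" "Re (cis t ^ s) = cos (real s * t)" for t
    by (simp add: norm_power) (simp add: Complex.DeMoivre)
  show ?thesis
  proof (intro equalityI subsetI)
    fix w assume "w \<in> projected_arcs l s"
    then obtain z where z: "cmod z = 1" "\<bar>Arg (z ^ s)\<bar> \<le> l / 2" and w: "w = of_real (Re z)"
      by (auto simp: projected_arcs_def circle_arcs_def)
    have "z \<noteq> 0" using z by auto
    then have "z = cis (Arg z)" using z(1) by (simp add: cis_Arg sgn_div_norm)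
    then obtain t where t: "z = cis t" by blast
    have "cos (l / 2) \<le> cos (real s * t)" using z iff[OF pow(1)] pow(2) by (simp add: t)
    then show "w \<in> of_real ` cheb_preimage_set s (cos (l / 2))"
      by (auto simp: w t cheb_preimage_set_def cos_multiple_arccos)
  next
    fix w :: complex assume "w \<in> of_real ` cheb_preimage_set s (cos (l / 2))"
    then obtain x where x: "w = of_real x" "- 1 \<le> x" "x \<le> 1" "cos (l / 2) \<le> cos (real s * arccos x)"
      by (auto simp: cheb_preimage_set_def)
    have "\<bar>Arg (cis (arccos x) ^ s)\<bar> \<le> l / 2" using iff[OF pow(1)] pow(2) x by simp
    then have "cis (arccos x) \<in> circle_arcs l s" by (simp add: circle_arcs_def)
    moreover have "w = of_real (Re (cis (arccos x)))" using x by simp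
    ultimately show "w \<in> projected_arcs l s" unfolding projected_arcs_def by blast
  qed
qed

lemma compact_cheb_preimage_set: "compact (cheb_preimage_set s t0)"
proof -
  have "continuous_on {-1..1} (\<lambda>x. cos (real s * arccos x))"
    by (intro continuous_intros) auto
  then have "closed ({-1..1} \<inter> (\<lambda>x. cos (real s * arccos x)) -` {t0..})"
    by (rule continuous_closed_preimage) auto
  moreover have "cheb_preimage_set s t0 = {-1..1} \<inter> (\<lambda>x. cos (real s * arccos x)) -` {t0..}"
    by (auto simp: cheb_preimage_set_def)
  ultimately show ?thesis
    by (metis bounded_closed_interval bounded_Int compact_eq_bounded_closed)
qed

text \<open>The Green function is the pullback of that of the unit segment under \<open>W\<close>,
  divided by the degree \<open>s\<close>. Its constant at infinity is read off from the leading
  coefficient of \<open>W\<close>.\<close>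

lemma log_capacity_cheb_preimage:
  assumes s: "0 < s" and t0: "- 1 \<le> t0" "t0 < 1"
  shows "log_capacity (of_real ` cheb_preimage_set s t0) = 1 / 2 * ((1 - t0) / 2) powr (1 / real s)"
proof -
  define E where "E = complex_of_real ` cheb_preimage_set s t0"
  have E: "compact E" unfolding E_def
    by (intro compact_continuous_image continuous_intros compact_cheb_preimage_set)
  have oE: "open (- E)" using E by (simp add: compact_imp_closed open_Compl)
  have re: "E \<subseteq> \<real>" by (auto simp: E_def)
  \<comment> \<open>The Chebyshev polynomial followed by the affine map taking \<open>t0\<close> to
    -1 and 1 to 1.\<close>
  define W where "W z = (2 * cheb s z - 1 - of_real t0) / of_real (1 - t0)" for z
  have t0': "complex_of_real (1 - t0) \<noteq> 0" using t0 by (simp del: of_real_diff)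
  have hW: "W holomorphic_on S" for S
    unfolding W_def[abs_def] using t0' by (intro holomorphic_intros cheb_holomorphic) auto
  have W_out: "W z \<notin> unit_segment" if "z \<notin> E" for z
  proof
    assume "W z \<in> unit_segment"
    then obtain y where y: "W z = of_real y" "- 1 \<le> y" "y \<le> 1" by auto
    define r where "r = ((1 - t0) * y + 1 + t0) / 2"
    have "2 * cheb s z - 1 - of_real t0 = of_real (1 - t0) * W z" unfolding W_def using t0' by simp
    then have "2 * cheb s z = of_real ((1 - t0) * y + 1 + t0)" unfolding y by (simp add: algebra_simps)
    moreover have "cheb s z = 2 * cheb s z / 2" by simp
    ultimately have "cheb s z = of_real ((1 - t0) * y + 1 + t0) / 2" by (simp only:)
    then have c: "cheb s z = of_real r" by (simp add: r_def)
    have "(1 - t0) * - 1 \<le> (1 - t0) * y" "(1 - t0) * y \<le> (1 - t0) * 1"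
      using y t0 by (intro mult_left_mono; simp)+
    then have r: "t0 \<le> r" "r \<le> 1" by (simp_all add: r_def)
    obtain x where "z = of_real x" "- 1 \<le> x" "x \<le> 1" "r = cos (real s * arccos x)"
      using cheb_preimage[OF s c] r t0 by force
    then have "z \<in> E" using r by (auto simp: E_def cheb_preimage_set_def)
    with that show False by simp
  qed
  have W_in: "cmod (W z - 1) + cmod (W z + 1) = 2" if "z \<in> E" for z
  proof -
    obtain x where x: "z = of_real x" "- 1 \<le> x" "x \<le> 1" "t0 \<le> cos (real s * arccos x)"
      using \<open>z \<in> E\<close> by (auto simp: E_def cheb_preimage_set_def)
    define y where "y = (2 * cos (real s * arccos x) - 1 - t0) / (1 - t0)"
    have Wy: "W z = of_real y" using x by (simp add: W_def y_def cheb_of_real)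
    have "- 1 \<le> y" "y \<le> 1" using x t0 cos_le_one[of "real s * arccos x"] by (auto simp: y_def field_simps)
    moreover have "W z - 1 = of_real (y - 1)" "W z + 1 = of_real (y + 1)" by (simp_all add: Wy)
    ultimately show ?thesis by (simp only: norm_of_real)
  qed
  define f where "f z = joukowski_inverse (W z)" for z
  define g where "g z = 1 / real s * ln (cmod (f z)) + 0" for z
  have hf: "f holomorphic_on - E"
    unfolding f_def[abs_def]
  proof (rule holomorphic_on_compose_gen[OF hW joukowski_inverse_holomorphic, unfolded o_def], rule image_subsetI)
    fix z assume "z \<in> - E"
    then show "W z \<in> - unit_segment" using W_out[of z] by simp
  qed
  have f1: "1 < cmod (f z)" if "z \<notin> E" for z
    unfolding f_def by (rule joukowski_inverse_norm(1)[OF W_out[OF that]])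
  have hg: "harmonic_on g (- E)"
    unfolding g_def[abs_def] by (rule harmonic_on_scaled_ln_norm[OF oE hf]) (use f1 in force)
  have gpos: "0 < g z" if "z \<notin> E" for z using f1[OF that] s by (auto simp: g_def intro!: divide_pos_pos ln_gt_zero)
  obtain R where R: "\<And>z. z \<in> E \<Longrightarrow> cmod z \<le> R" using compact_imp_bounded[OF E] by (auto simp: bounded_iff)
  \<comment> \<open>The leading coefficient of \<open>W\<close>: twice that of the Chebyshev
    polynomial, \<open>2 ^ (s - 1)\<close>, divided by \<open>1 - t0\<close>.\<close>
  define K where "K = 2 ^ s / (1 - t0)"
  have K: "0 < K" using t0 by (simp add: K_def)
  have limW: "((\<lambda>z. W z / z ^ s) \<longlongrightarrow> of_real K) at_infinity"
  proof -
    obtain k where k: "s = Suc k" using s gr0_conv_Suc by auto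
    have inv: "((\<lambda>z::complex. (1 / z) ^ s) \<longlongrightarrow> 0 ^ s) at_infinity"
      by (intro tendsto_power tendsto_divide_0[OF tendsto_const filterlim_ident])
    have "((\<lambda>z. (2 * (cheb s z / z ^ s) - (1 + of_real t0) * (1 / z) ^ s) / of_real (1 - t0)) \<longlongrightarrow>
        (2 * 2 ^ k - (1 + of_real t0) * 0 ^ s) / of_real (1 - t0)) at_infinity"
      by (intro tendsto_divide tendsto_diff tendsto_mult tendsto_const inv cheb_leading[of k, folded k] t0')
    moreover have "(2 * (cheb s z / z ^ s) - (1 + of_real t0) * (1 / z) ^ s) / of_real (1 - t0) = W z / z ^ s" for z
      unfolding W_def by (simp add: power_divide diff_divide_distrib add_divide_distrib mult_ac del: of_real_diff)
    moreover have "(2 * 2 ^ k - (1 + complex_of_real t0) * 0 ^ s) / of_real (1 - t0) = of_real K"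
      using s by (simp add: K_def k)
    ultimately show ?thesis by simp
  qed
  have lim_inv: "((\<lambda>z. 1 / (W z)\<^sup>2) \<longlongrightarrow> 0) at_infinity"
  proof -
    have "((\<lambda>z. (1 / z) ^ s / (W z / z ^ s)) \<longlongrightarrow> 0 ^ s / of_real K) at_infinity"
      by (intro tendsto_divide tendsto_power tendsto_divide_0[OF tendsto_const filterlim_ident] limW) (use K in auto)
    moreover have "eventually (\<lambda>z::complex. z \<noteq> 0) at_infinity"
      unfolding eventually_at_infinity by (rule exI[of _ 1]) auto
    then have "eventually (\<lambda>z. (1 / z) ^ s / (W z / z ^ s) = 1 / W z) at_infinity"
      by (rule eventually_mono) (simp add: power_divide)
    ultimately have "((\<lambda>z. 1 / W z) \<longlongrightarrow> 0 ^ s / of_real K) at_infinity"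
      by (rule Lim_transform_eventually)
    then have "((\<lambda>z. (1 / W z)\<^sup>2) \<longlongrightarrow> (0 ^ s / of_real K)\<^sup>2) at_infinity" by (rule tendsto_power)
    then show ?thesis using s by (simp add: power_divide zero_power)
  qed
  \<comment> \<open>The second factor of \<open>joukowski_inverse\<close> tends to 2, so the
    constant is that of \<open>K * 2\<close> and not of \<open>K\<close>.\<close>
  have "((\<lambda>z. csqrt (1 - 1 / (W z)\<^sup>2)) \<longlongrightarrow> csqrt (1 - 0)) at_infinity"
    by (intro isCont_tendsto_compose[OF continuous_at_csqrt] tendsto_diff tendsto_const lim_inv) auto
  then have "((\<lambda>z. 1 + csqrt (1 - 1 / (W z)\<^sup>2)) \<longlongrightarrow> 1 + 1) at_infinity"
    by (intro tendsto_add tendsto_const) simp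
  from tendsto_mult[OF limW this]
  have "((\<lambda>z. cmod (W z / z ^ s * (1 + csqrt (1 - 1 / (W z)\<^sup>2)))) \<longlongrightarrow> cmod (of_real K * (1 + 1))) at_infinity"
    by (rule tendsto_norm)
  then have "((\<lambda>z. cmod (W z / z ^ s * (1 + csqrt (1 - 1 / (W z)\<^sup>2)))) \<longlongrightarrow> K * 2) at_infinity"
    using K by (simp add: norm_mult)
  then have "((\<lambda>z. 1 / real s * ln (cmod (W z / z ^ s * (1 + csqrt (1 - 1 / (W z)\<^sup>2))))) \<longlongrightarrow> 1 / real s * ln (K * 2)) at_infinity"
    using K by (intro tendsto_mult tendsto_const tendsto_ln) auto
  moreover have "eventually (\<lambda>z. 1 / real s * ln (cmod (W z / z ^ s * (1 + csqrt (1 - 1 / (W z)\<^sup>2)))) = g z - ln (cmod z)) at_infinity"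
    unfolding eventually_at_infinity
  proof (intro exI[of _ "\<bar>R\<bar> + 1"] allI impI)
    fix z assume z: "\<bar>R\<bar> + 1 \<le> cmod z"
    have z0: "0 < cmod z" using z by linarith
    have zE: "z \<notin> E" using R[of z] z by force
    have "cmod (W z / z ^ s * (1 + csqrt (1 - 1 / (W z)\<^sup>2))) = cmod (f z) / cmod z ^ s"
      by (simp add: f_def joukowski_inverse_def norm_mult norm_divide norm_power)
    also have "ln \<dots> = ln (cmod (f z)) - real s * ln (cmod z)"
    proof -
      have "f z \<noteq> 0" using f1[OF zE] by auto
      then show ?thesis using z0 by (simp add: ln_div ln_realpow)
    qed
    finally show "1 / real s * ln (cmod (W z / z ^ s * (1 + csqrt (1 - 1 / (W z)\<^sup>2)))) = g z - ln (cmod z)"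
      using s by (simp add: g_def field_simps)
  qed
  ultimately have limg: "((\<lambda>z. g z - ln (cmod z)) \<longlongrightarrow> 1 / real s * ln (K * 2)) at_infinity"
    by (rule Lim_transform_eventually)
  have pole: "log_pole_at_infinity (- E) g"
    unfolding log_pole_at_infinity_def using hg gpos limg by auto
  \<comment> \<open>On \<open>E\<close> the sum of the distances of \<open>W \<zeta>\<close> to the
    foci is 2, below the value belonging to modulus \<open>exp (s * e)\<close>. This sum is
    continuous across \<open>E\<close>, while \<open>f\<close> is not.\<close>
  have bdry: "eventually (\<lambda>z. g z < e) (at \<zeta> within - E)" if \<zeta>: "\<zeta> \<in> E" and e: "0 < e" for \<zeta> e
  proof -
    define y where "y = exp (real s * e)"
    have y: "1 < y" using s e by (simp add: y_def)
    have "0 < (y - 1)\<^sup>2" using y by simp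
    then have "2 < y + 1 / y" using y by (simp add: power2_eq_square field_simps)
    then have "cmod (W \<zeta> - 1) + cmod (W \<zeta> + 1) < exp (real s * e) + exp (- (real s * e))"
      using W_in[OF \<zeta>] by (simp add: y_def exp_minus divide_inverse)
    moreover have "continuous_on UNIV W" by (rule holomorphic_on_imp_continuous_on[OF hW])
    then have "isCont W \<zeta>" by (simp add: continuous_on_eq_continuous_at)
    then have "((\<lambda>z. W z) \<longlongrightarrow> W \<zeta>) (at \<zeta> within - E)"
      by (metis isCont_def tendsto_within_subset subset_UNIV)
    then have "((\<lambda>z. cmod (W z - 1) + cmod (W z + 1)) \<longlongrightarrow> cmod (W \<zeta> - 1) + cmod (W \<zeta> + 1)) (at \<zeta> within - E)"
      by (intro tendsto_intros)
    ultimately have "eventually (\<lambda>z. cmod (W z - 1) + cmod (W z + 1) < exp (real s * e) + exp (- (real s * e))) (at \<zeta> within - E)"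
      by (intro order_tendstoD(2))
    moreover have "eventually (\<lambda>z. z \<in> - E) (at \<zeta> within - E)" by (simp add: eventually_at_filter)
    ultimately show ?thesis
    proof eventually_elim
      case (elim z)
      then have "ln (cmod (f z)) < real s * e"
        unfolding f_def using s e by (intro ln_joukowski_inverse_less W_out) auto
      then show ?case using s by (simp add: g_def field_simps)
    qed
  qed
  have "is_green_at_infinity (- E) g"
    unfolding is_green_at_infinity_def using pole comparison[OF E hg _ limg bdry] by blast
  from log_capacity_eqI[OF E re this limg]
  have "log_capacity E = exp (- (1 / real s * ln (K * 2)))" .
  also have "- (1 / real s * ln (K * 2)) = ln (1 / 2) + 1 / real s * ln ((1 - t0) / 2)"
    using t0 s by (simp add: K_def ln_mult_pos ln_div ln_realpow field_simps)
  also have "exp \<dots> = 1 / 2 * ((1 - t0) / 2) powr (1 / real s)"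
    using t0 by (simp add: exp_add powr_def)
  finally show ?thesis by (simp add: E_def)
qed

text \<open>The function \<open>cos (2 * m * \<theta>)\<close> has \<open>n = m + 1\<close> peaks on
  the half circle, at the multiples of \<open>pi / m\<close>. Each contributes one interval, and the
  two outermost peaks lie at the ends 0 and \<open>pi\<close>, where only half of an arc
  remains.\<close>

lemma projected_arcs_equality_case:
  assumes n: "n \<ge> 2" and l: "0 < l" "l < 2 * pi"
  shows "\<exists>a b. interval_endpoints n a b
               \<and> projected_arcs l (2 * (n - 1)) = interval_union n a b
               \<and> log_capacity (projected_arcs l (2 * (n - 1)))
                   = 1 / 2 * cos (1 / 2 * (\<Sum>k=1..n-1. arccos (a (k + 1)) - arccos (b k)))
                               powr (1 / (real n - 1))"
proof -
  define m where "m = n - 1"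
  have m: "1 \<le> m" "n = Suc m" using n by (auto simp: m_def)
  \<comment> \<open>Angular half-width of a component: multiplication by the degree
    \<open>2 * m\<close> gives the half-width \<open>l / 2\<close> of the image arc.\<close>
  define w where "w = l / (4 * real m)"
  have w: "0 < w" "2 * w < pi / real m" "2 * real m * w = l / 2"
    using l m by (auto simp: w_def field_simps)
  \<comment> \<open>The peaks, numbered from \<open>pi\<close> down to 0 so that the intervals come
    out from left to right.\<close>
  define \<alpha> where "\<alpha> k = (real n - real k) * pi / real m" for k :: nat
  have \<alpha>1: "\<alpha> 1 = pi" and \<alpha>n: "\<alpha> n = 0" using m by (auto simp: \<alpha>_def)
  have \<alpha>_step: "\<alpha> k - \<alpha> (k + 1) = pi / real m" for k
    by (simp add: \<alpha>_def diff_divide_distrib algebra_simps add_divide_distrib)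
  have \<alpha>_le: "\<alpha> k + pi / real m \<le> pi" if "2 \<le> k" for k
  proof -
    have "(real n - real k + 1) * pi \<le> real m * pi" using that m by (intro mult_right_mono) auto
    then show ?thesis using m by (simp add: \<alpha>_def field_simps)
  qed
  have \<alpha>_ge: "pi / real m \<le> \<alpha> k" if "k < n" for k
  proof -
    have "1 * pi \<le> (real n - real k) * pi" using that by (intro mult_right_mono) auto
    then show ?thesis using m by (simp add: \<alpha>_def field_simps)
  qed
  have pim: "0 < pi / real m" "pi / real m \<le> pi" using m by (auto simp: field_simps)
  have \<alpha>_range: "0 \<le> \<alpha> k" "\<alpha> k \<le> pi" if "1 \<le> k" "k \<le> n" for k
  proof -
    show "0 \<le> \<alpha> k" using that by (simp add: \<alpha>_def)
    have "(real n - real k) * pi \<le> real m * pi" using that m by (intro mult_right_mono) auto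
    then show "\<alpha> k \<le> pi" using m by (simp add: \<alpha>_def field_simps)
  qed
  \<comment> \<open>The outermost peaks need separate values: \<open>pi + w\<close> and
    \<open>- w\<close> leave the range of \<open>arccos\<close>, and the cosine would fold back into
    the interval.\<close>
  define a where "a k = (if k = 1 then - 1 else cos (\<alpha> k + w))" for k
  define b where "b k = (if k = n then 1 else cos (\<alpha> k - w))" for k
  have arc_a: "arccos (a (k + 1)) = \<alpha> (k + 1) + w" if "k \<in> {1..m}" for k
  proof -
    have "\<alpha> (k + 1) + w \<le> pi" using \<alpha>_le[of "k + 1"] that w(1,2) by auto
    then show ?thesis using that \<alpha>_range[of "k + 1"] m w(1) by (simp add: a_def arccos_cos)
  qed
  have arc_b: "arccos (b k) = \<alpha> k - w" if "k \<in> {1..m}" for k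
  proof -
    have "0 \<le> \<alpha> k - w" using \<alpha>_ge[of k] that w(1,2) m by auto
    then show ?thesis using that \<alpha>_range[of k] m w(1) by (simp add: b_def arccos_cos)
  qed
  have ends: "interval_endpoints n a b"
    unfolding interval_endpoints_def
  proof (intro conjI ballI)
    show "a 1 = - 1" "b n = 1" by (auto simp: a_def b_def)
    fix k
    {
      assume k: "k \<in> {1..n}"
      have "arccos (b k) < arccos (a k)" if "k \<noteq> 1" "k \<noteq> n"
      proof -
        have "k - 1 \<in> {1..m}" "k - 1 + 1 = k" "k \<in> {1..m}" using that k m by auto
        then show ?thesis using arc_a[of "k - 1"] arc_b[of k] w(1) by simp
      qed
      moreover have "- 1 \<le> a k" "a k \<le> 1" "- 1 \<le> b k" "b k \<le> 1" by (auto simp: a_def b_def)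
      moreover have "- 1 < b 1"
      proof -
        have "b 1 = cos (pi - w)" using m \<alpha>1 by (simp add: b_def)
        moreover have "cos pi < cos (pi - w)" using w pim by (intro cos_monotone_0_pi) auto
        ultimately show ?thesis by simp
      qed
      moreover have "a n < 1"
      proof -
        have "a n = cos w" using m \<alpha>n by (simp add: a_def)
        moreover have "cos w < cos 0" using w pim by (intro cos_monotone_0_pi) auto
        ultimately show ?thesis by simp
      qed
      moreover have "a 1 = - 1" "b n = 1" by (auto simp: a_def b_def)
      ultimately show "a k < b k"
        by (metis arccos_le_arccos not_le)
    }
    {
      assume k: "k \<in> {1..<n}"
      then have km: "k \<in> {1..m}" using m by auto
      have "\<alpha> (k + 1) + w < \<alpha> k - w" using \<alpha>_step[of k] w by linarith
      then have "arccos (a (k + 1)) < arccos (b k)" using arc_a[OF km] arc_b[OF km] by simp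
      moreover have "- 1 \<le> b k" "b k \<le> 1" "- 1 \<le> a (k + 1)" "a (k + 1) \<le> 1" by (auto simp: a_def b_def)
      ultimately show "b k < a (k + 1)" by (metis arccos_le_arccos not_le)
    }
  qed
  \<comment> \<open>The hypothesis confines \<open>2 * m * \<theta>\<close> to the period centred at
    the peak \<open>j\<close>, where the cosine is a decreasing function of the distance to the
    centre.\<close>
  have cosiff: "cos (l / 2) \<le> cos (2 * real m * \<theta>) \<longleftrightarrow> \<bar>\<theta> - of_int j * pi / real m\<bar> \<le> w"
    if "\<bar>2 * real m * \<theta> - 2 * of_int j * pi\<bar> \<le> pi" for \<theta> and j :: int
  proof -
    have "cos (2 * real m * \<theta>) = cos (2 * real m * \<theta> - 2 * of_int j * pi)"
      using cos_int_2pin[of j] sin_int_2pin[of j] by (simp add: cos_diff mult_ac)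
    also have "\<dots> = cos \<bar>2 * real m * \<theta> - 2 * of_int j * pi\<bar>" by simp
    finally have "cos (l / 2) \<le> cos (2 * real m * \<theta>) \<longleftrightarrow> \<bar>2 * real m * \<theta> - 2 * of_int j * pi\<bar> \<le> l / 2"
      using l that by (simp only: cos_mono_le_eq abs_ge_zero)
    also have "2 * real m * \<theta> - 2 * of_int j * pi = (2 * real m) * (\<theta> - of_int j * pi / real m)"
      using m by (simp add: field_simps)
    also have "\<bar>\<dots>\<bar> = (2 * real m) * \<bar>\<theta> - of_int j * pi / real m\<bar>" by (simp add: abs_mult)
    also have "\<dots> \<le> l / 2 \<longleftrightarrow> \<bar>\<theta> - of_int j * pi / real m\<bar> \<le> w"
      unfolding w(3)[symmetric] using m by (subst mult_le_cancel_left_pos) auto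
    finally show ?thesis .
  qed
  have \<alpha>_int: "\<alpha> k = of_int (int n - int k) * pi / real m" for k by (simp add: \<alpha>_def)
  have set_eq: "cheb_preimage_set (2 * m) (cos (l / 2)) = (\<Union>k\<in>{1..n}. {a k..b k})"
  proof (intro equalityI subsetI)
    fix x assume "x \<in> cheb_preimage_set (2 * m) (cos (l / 2))"
    then have x: "- 1 \<le> x" "x \<le> 1" "cos (l / 2) \<le> cos (2 * real m * arccos x)"
      by (auto simp: cheb_preimage_set_def)
    define \<theta> where "\<theta> = arccos x"
    have \<theta>: "0 \<le> \<theta>" "\<theta> \<le> pi" "cos \<theta> = x" using x by (auto simp: \<theta>_def arccos_lbound arccos_ubound)
    \<comment> \<open>The nearest peak; rounding leaves an error of at most 1/2, which is the
      confinement required by \<open>cosiff\<close>.\<close>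
    define j where "j = round (real m * \<theta> / pi)"
    have "\<bar>of_int j - real m * \<theta> / pi\<bar> \<le> 1 / 2" unfolding j_def by (rule of_int_round_abs_le)
    then have "\<bar>of_int j - real m * \<theta> / pi\<bar> * (2 * pi) \<le> 1 / 2 * (2 * pi)" by (intro mult_right_mono) auto
    moreover have "\<bar>of_int j - real m * \<theta> / pi\<bar> * (2 * pi) = \<bar>2 * real m * \<theta> - 2 * of_int j * pi\<bar>"
    proof -
      have "\<bar>of_int j - real m * \<theta> / pi\<bar> * (2 * pi) = \<bar>(of_int j - real m * \<theta> / pi) * (2 * pi)\<bar>"
        by (simp add: abs_mult)
      also have "(of_int j - real m * \<theta> / pi) * (2 * pi) = - (2 * real m * \<theta> - 2 * of_int j * pi)"
        by (simp add: field_simps)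
      finally show ?thesis by simp
    qed
    ultimately have near: "\<bar>2 * real m * \<theta> - 2 * of_int j * pi\<bar> \<le> pi" by simp
    have dist: "\<bar>\<theta> - of_int j * pi / real m\<bar> \<le> w" using cosiff[OF near] x by (simp add: \<theta>_def)
    have "real m * \<theta> \<le> real m * pi" using \<theta> by (intro mult_left_mono) auto
    then have "0 \<le> real m * \<theta> / pi" "real m * \<theta> / pi \<le> real m" using \<theta> by (auto simp: field_simps)
    from this[THEN round_mono] have j: "0 \<le> j" "j \<le> int m" by (simp_all add: j_def)
    define k where "k = nat (int n - j)"
    have k: "k \<in> {1..n}" "int n - int k = j" using j m by (auto simp: k_def)
    then have d: "\<bar>\<theta> - \<alpha> k\<bar> \<le> w" using dist \<alpha>_int[of k] by simp
    have "a k \<le> x"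
    proof (cases "k = 1")
      case False
      then have "\<alpha> k + w \<le> pi" using \<alpha>_le[of k] k w(1,2) by auto
      then have "cos (\<alpha> k + w) \<le> cos \<theta>" using d \<theta> by (intro cos_monotone_0_pi_le) auto
      then show ?thesis using False \<theta> by (simp add: a_def)
    qed (use x in \<open>simp add: a_def\<close>)
    moreover have "x \<le> b k"
    proof (cases "k = n")
      case False
      then have "0 \<le> \<alpha> k - w" using \<alpha>_ge[of k] k w(1,2) by auto
      then have "cos \<theta> \<le> cos (\<alpha> k - w)" using d \<theta> by (intro cos_monotone_0_pi_le) auto
      then show ?thesis using False \<theta> by (simp add: b_def)
    qed (use x in \<open>simp add: b_def\<close>)
    ultimately show "x \<in> (\<Union>k\<in>{1..n}. {a k..b k})" using k by auto
  next
    fix x assume "x \<in> (\<Union>k\<in>{1..n}. {a k..b k})"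
    then obtain k where k: "k \<in> {1..n}" "a k \<le> x" "x \<le> b k" by auto
    have x: "- 1 \<le> x" "x \<le> 1"
      using k circle_gaps_interval_endpoints(3)[OF n ends, of k] by auto
    define \<theta> where "\<theta> = arccos x"
    have \<theta>: "0 \<le> \<theta>" "\<theta> \<le> pi" using x by (auto simp: \<theta>_def arccos_lbound arccos_ubound)
    have bd: "- 1 \<le> a k" "b k \<le> 1" by (auto simp: a_def b_def)
    have "\<theta> \<le> \<alpha> k + w"
    proof (cases "k = 1")
      case True then show ?thesis using \<theta> \<alpha>1 w(1) by auto
    next
      case False
      then have "k - 1 \<in> {1..m}" "k - 1 + 1 = k" using k m by auto
      then have "arccos (a k) = \<alpha> k + w" using arc_a[of "k - 1"] by simp
      then show ?thesis using arccos_le_arccos[of "a k" x] bd k x by (simp add: \<theta>_def)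
    qed
    moreover have "\<alpha> k - w \<le> \<theta>"
    proof (cases "k = n")
      case True then show ?thesis using \<theta> \<alpha>n w(1) by auto
    next
      case False
      then have "arccos (b k) = \<alpha> k - w" using arc_b[of k] k m by auto
      then show ?thesis using arccos_le_arccos[of x "b k"] bd k x by (simp add: \<theta>_def)
    qed
    ultimately have d: "\<bar>\<theta> - \<alpha> k\<bar> \<le> w" by auto
    have "2 * real m * \<bar>\<theta> - \<alpha> k\<bar> \<le> 2 * real m * w" using d by (intro mult_left_mono) auto
    also have "2 * real m * w \<le> pi" using w(3) l by simp
    finally have "\<bar>2 * real m * (\<theta> - \<alpha> k)\<bar> \<le> pi" by (simp add: abs_mult)
    moreover have "2 * real m * (\<theta> - \<alpha> k) = 2 * real m * \<theta> - 2 * of_int (int n - int k) * pi"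
      using m by (simp add: \<alpha>_def field_simps)
    ultimately have "\<bar>2 * real m * \<theta> - 2 * of_int (int n - int k) * pi\<bar> \<le> pi" by (simp only:)
    from cosiff[OF this] d have "cos (l / 2) \<le> cos (2 * real m * \<theta>)" by (simp add: \<alpha>_int)
    then show "x \<in> cheb_preimage_set (2 * m) (cos (l / 2))"
      using x by (simp add: cheb_preimage_set_def \<theta>_def)
  qed
  have arcs: "projected_arcs l (2 * (n - 1)) = of_real ` cheb_preimage_set (2 * m) (cos (l / 2))"
    unfolding m_def by (rule projected_arcs_eq[OF l])
  have eq: "projected_arcs l (2 * (n - 1)) = interval_union n a b"
    unfolding arcs set_eq interval_union_def ..
  have "(\<Sum>k=1..n-1. arccos (a (k + 1)) - arccos (b k)) = (\<Sum>k=1..m. 2 * w - pi / real m)"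
    unfolding m_def[symmetric]
  proof (intro sum.cong refl)
    fix k assume k: "k \<in> {1..m}"
    show "arccos (a (k + 1)) - arccos (b k) = 2 * w - pi / real m"
      unfolding arc_a[OF k] arc_b[OF k] using \<alpha>_step[of k] by linarith
  qed
  \<comment> \<open>Half of this is \<open>l / 4 - pi / 2\<close>, which turns the cosine into
    \<open>sin (l / 4)\<close>. On the capacity side \<open>(1 - cos (l / 2)) / 2\<close> is its
    square, and the exponent \<open>1 / (2 * m)\<close> absorbs the square.\<close>
  also have "\<dots> = l / 2 - pi" using m w(3) by (simp add: right_diff_distrib)
  finally have "cos (1 / 2 * (\<Sum>k=1..n-1. arccos (a (k + 1)) - arccos (b k))) = cos (l / 4 - pi / 2)"
    by (simp add: diff_divide_distrib)
  also have "\<dots> = sin (l / 4)" by (simp add: cos_diff)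
  finally have c: "cos (1 / 2 * (\<Sum>k=1..n-1. arccos (a (k + 1)) - arccos (b k))) = sin (l / 4)" .
  have spos: "0 < sin (l / 4)" using l by (intro sin_gt_zero) auto
  have "cos (l / 2) < cos 0" using l by (intro cos_monotone_0_pi) auto
  then have t0: "cos (l / 2) < 1" by simp
  have "log_capacity (projected_arcs l (2 * (n - 1))) = 1 / 2 * ((1 - cos (l / 2)) / 2) powr (1 / real (2 * m))"
    unfolding arcs using m t0 by (intro log_capacity_cheb_preimage) auto
  also have "(1 - cos (l / 2)) / 2 = (sin (l / 4))\<^sup>2" using cos_double_sin[of "l / 4"] by simp
  also have "(sin (l / 4))\<^sup>2 = sin (l / 4) powr 2" using spos by simp
  also have "(sin (l / 4) powr 2) powr (1 / real (2 * m)) = sin (l / 4) powr (1 / (real n - 1))"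
    unfolding powr_powr using m by simp
  finally show ?thesis unfolding c[symmetric] using ends eq by (intro exI conjI)
qed

theorem theorem3:
  fixes n :: nat
  assumes "n \<ge> 2"
  shows "(\<forall>a b. interval_endpoints n a b \<longrightarrow>
            log_capacity (interval_union n a b)
              \<le> 1 / 2 * cos (1 / 2 * (\<Sum>k=1..n-1. arccos (a (k + 1)) - arccos (b k)))
                          powr (1 / (real n - 1)))
       \<and> (\<forall>l. 0 < l \<and> l < 2 * pi \<longrightarrow>
            (\<exists>a b. interval_endpoints n a b
               \<and> projected_arcs l (2 * (n - 1)) = interval_union n a b
               \<and> log_capacity (projected_arcs l (2 * (n - 1)))
                   = 1 / 2 * cos (1 / 2 * (\<Sum>k=1..n-1. arccos (a (k + 1)) - arccos (b k)))
                               powr (1 / (real n - 1))))"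
proof (intro conjI allI impI)
  show "\<exists>a b. interval_endpoints n a b
               \<and> projected_arcs l (2 * (n - 1)) = interval_union n a b
               \<and> log_capacity (projected_arcs l (2 * (n - 1)))
                   = 1 / 2 * cos (1 / 2 * (\<Sum>k=1..n-1. arccos (a (k + 1)) - arccos (b k)))
                               powr (1 / (real n - 1))" if "0 < l \<and> l < 2 * pi" for l
    using that by (intro projected_arcs_equality_case[OF assms]) simp_all
qed (rule log_capacity_interval_union_le[OF assms])

end
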